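(* Let $E=\{n_1<n_2<\ldots\}\subset\mathbb{N}$ be a set that belongs to one of the classes $\mathcal{D}^{(\infty)}$, $\mathcal{E}_{\mathrm{c.pt.}}$ or $\mathcal{E}_{\mathrm{pol}}$, and suppose that the natural density $d(E)$ exists and is positive. Then $(n_j)_{j\in\mathbb{N}}$ is a totally ergodic sequence.
   Context: $\mathbb{N}=\{1,2,\ldots\}$. The natural density is $d(E):=\lim_{N\to\infty}\frac{|E\cap\{1,\ldots,N\}|}{N}$ when the limit exists. A probability measure preserving system $(X,\mathcal{B},\mu,T)$ is totally ergodic if $T^m\colon X\to X$ is ergodic for every $m\in\mathbb{N}$. A sequence $(n_j)_{j\in\mathbb{N}}$ in $\mathbb{N}$ is totally ergodic if for every totally ergodic probability measure preserving system $(X,\mathcal{B},\mu,T)$ and every $f\in L^2(X,\mathcal{B},\mu)$ one has $\lim_{N\to\infty}\frac1N\sum_{j=1}^N T^{n_j}f=\int_X f\,d\mu$ in $L^2(X,\mathcal{B},\mu)$, where $Tf(x):=f(Tx)$. A function $f\colon\mathbb{N}\to\mathbb{C}$ is multiplicative if $f(1)=1$ and $f(mn)=f(m)f(n)$ whenever $\gcd(m,n)=1$. For $r\in\mathbb{N}$, $\mathcal{D}^{(r)}$ is the collection of all sets of the form $\{n\in\mathbb{N}: f_1(n)=z_1,\ldots,f_r(n)=z_r\}$, where $f_1,\ldots,f_r\colon\mathbb{N}\to\mathbb{C}$ are arbitrary multiplicative functions and $z_1,\ldots,z_r$ are arbitrary complex numbers; $\mathcal{D}^{(\infty)}:=\bigcup_{r\geq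 1}\mathcal{D}^{(r)}$. A point $z\in\mathbb{C}$ is a concentration point for $f\colon\mathbb{N}\to\mathbb{C}$ if $\sum_{p\text{ prime},\,f(p)=z}\frac1p=\infty$. $\mathcal{E}_{\mathrm{c.pt.}}$ is the collection of all sets of the form $\{n\in\mathbb{N}:f(n)\in K\}$, where $K\subset\mathbb{C}$ is arbitrary and $f\colon\mathbb{N}\to\mathbb{C}$ is a multiplicative function possessing at least one concentration point. A set $K\subset\mathbb{C}$ is an elementary set in polar coordinates if it is a finite union of sets of the form $\{re^{2\pi i\varphi}: r\in I_1,\varphi\in I_2\}$, where $I_1,I_2$ are (open, closed or half-open) intervals in $\mathbb{R}$. $\mathcal{E}_{\mathrm{pol}}$ is the collection of all sets of the form $\{n\in\mathbb{N}:f(n)\in K\}$, where $K$ is an elementary set in polar coordinates and $f$ is a multiplicative function bounded in modulus by $1$ with $\lim_{N\to\infty}\frac1N\sum_{n=1}^N|f(n)|\neq 0$ (this limit always exists, by Wirsing's theorem). *)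

theory Defs
  imports "HOL-Probability.Probability" "HOL-Computational_Algebra.Primes"
begin

text \<open>
  The positive integers are rendered as the positive elements of type \<^typ>\<open>nat\<close>; the value of an
  arithmetic function (or of a sequence indexed by the positive integers) at \<open>0\<close> is irrelevant.
\<close>

definition has_natural_density :: "nat set \<Rightarrow> real \<Rightarrow> bool" where
  "has_natural_density E d \<longleftrightarrow>
     (\<lambda>N. real (card (E \<inter> {1..N})) / real N) \<longlonglongrightarrow> d"

definition multiplicative :: "(nat \<Rightarrow> complex) \<Rightarrow> bool" where
  "multiplicative f \<longleftrightarrow>
     f 1 = 1 \<and> (\<forall>m n. 0 < m \<longrightarrow> 0 < n \<longrightarrow> coprime m n \<longrightarrow> f (m * n) = f m * f n)"

definition mult_level_sets :: "nat \<Rightarrow> nat set set" where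
  "mult_level_sets r =
     {E. \<exists>(f :: nat \<Rightarrow> nat \<Rightarrow> complex) (z :: nat \<Rightarrow> complex).
           (\<forall>i\<in>{1..r}. multiplicative (f i)) \<and>
           E = {n. 0 < n \<and> (\<forall>i\<in>{1..r}. f i n = z i)}}"

definition all_mult_level_sets :: "nat set set" where
  "all_mult_level_sets = (\<Union>r\<in>{1..}. mult_level_sets r)"

text \<open>The sum is taken in \<^typ>\<open>ennreal\<close>, so that it always has a value.\<close>

definition concentration_point :: "(nat \<Rightarrow> complex) \<Rightarrow> complex \<Rightarrow> bool" where
  "concentration_point f z \<longleftrightarrow>
     (\<Sum>\<^sub>\<infinity>p\<in>{p. prime p \<and> f p = z}. ennreal (1 / real p)) = \<infinity>"

definition concentration_point_sets :: "nat set set" where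
  "concentration_point_sets =
     {E. \<exists>(f :: nat \<Rightarrow> complex) (K :: complex set).
           multiplicative f \<and> (\<exists>z. concentration_point f z) \<and>
           E = {n. 0 < n \<and> f n \<in> K}}"

definition polar_rectangle :: "real set \<Rightarrow> real set \<Rightarrow> complex set" where
  "polar_rectangle I\<^sub>1 I\<^sub>2 =
     {complex_of_real r * exp (2 * complex_of_real pi * \<i> * complex_of_real \<phi>) | r \<phi>.
        r \<in> I\<^sub>1 \<and> \<phi> \<in> I\<^sub>2}"

definition elementary_polar :: "complex set \<Rightarrow> bool" where
  "elementary_polar K \<longleftrightarrow>
     (\<exists>\<R>. finite \<R> \<and>
          (\<forall>R\<in>\<R>. \<exists>I\<^sub>1 I\<^sub>2. is_interval I\<^sub>1 \<and> is_interval I\<^sub>2 \<and> R = polar_rectangle I\<^sub>1 I\<^sub>2) \<and>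
          K = \<Union>\<R>)"

definition polar_sets :: "nat set set" where
  "polar_sets =
     {E. \<exists>(f :: nat \<Rightarrow> complex) (K :: complex set).
           multiplicative f \<and> (\<forall>n>0. cmod (f n) \<le> 1) \<and>
           (\<exists>L. (\<lambda>N. (\<Sum>n=1..N. cmod (f n)) / real N) \<longlonglongrightarrow> L \<and> L \<noteq> 0) \<and>
           elementary_polar K \<and>
           E = {n. 0 < n \<and> f n \<in> K}}"

definition measure_preserving_system :: "'a measure \<Rightarrow> ('a \<Rightarrow> 'a) \<Rightarrow> bool" where
  "measure_preserving_system M T \<longleftrightarrow>
     prob_space M \<and> T \<in> measurable M M \<and>
     (\<forall>A\<in>sets M. emeasure M (T -` A \<inter> space M) = emeasure M A)"

definition ergodic :: "'a measure \<Rightarrow> ('a \<Rightarrow> 'a) \<Rightarrow> bool" where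
  "ergodic M T \<longleftrightarrow>
     (\<forall>A\<in>sets M. T -` A \<inter> space M = A \<longrightarrow> emeasure M A = 0 \<or> emeasure M A = 1)"

definition totally_ergodic_system :: "'a measure \<Rightarrow> ('a \<Rightarrow> 'a) \<Rightarrow> bool" where
  "totally_ergodic_system M T \<longleftrightarrow>
     measure_preserving_system M T \<and> (\<forall>m\<ge>1. ergodic M (T ^^ m))"

definition square_integrable :: "'a measure \<Rightarrow> ('a \<Rightarrow> complex) \<Rightarrow> bool" where
  "square_integrable M f \<longleftrightarrow>
     f \<in> borel_measurable M \<and> integrable M (\<lambda>x. (cmod (f x))\<^sup>2)"

definition converges_L2 ::
    "'a measure \<Rightarrow> (nat \<Rightarrow> 'a \<Rightarrow> complex) \<Rightarrow> ('a \<Rightarrow> complex) \<Rightarrow> bool" where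
  "converges_L2 M F g \<longleftrightarrow>
     (\<lambda>N. \<integral>\<^sup>+x. ennreal ((cmod (F N x - g x))\<^sup>2) \<partial>M) \<longlonglongrightarrow> 0"

text \<open>
  Quantification over all measure preserving systems includes the underlying type, which cannot be
  quantified inside a formula. It is therefore a parameter; a theorem concluding
  \<open>totally_ergodic_seq TYPE('a) n\<close> with \<open>'a\<close> a type variable not occurring in its
  hypotheses makes the claim for all systems.
\<close>

definition totally_ergodic_seq :: "'a itself \<Rightarrow> (nat \<Rightarrow> nat) \<Rightarrow> bool" where
  "totally_ergodic_seq _ n \<longleftrightarrow>
     (\<forall>(M :: 'a measure) T f. totally_ergodic_system M T \<longrightarrow> square_integrable M f \<longrightarrow>
        converges_L2 M
          (\<lambda>N x. (\<Sum>j=1..N. f ((T ^^ n j) x)) / of_nat N)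
          (\<lambda>_. integral\<^sup>L M f))"

end

theory Submission
  imports Defs "HOL-Real_Asymp.Real_Asymp"
begin

text \<open>
  Let \<open>T\<close> be totally ergodic, let \<open>f\<close> have mean zero and put \<open>v n = f \<circ> T ^^ n\<close>. For primes \<open>p < q\<close> the
  inner product of \<open>v (p * m)\<close> and \<open>v (q * m)\<close> equals that of \<open>f \<circ> T ^^ ((q - p) * m)\<close> and \<open>f\<close>, and its
  average over \<open>m\<close> tends to \<open>0\<close> because \<open>T ^^ (q - p)\<close> is ergodic (\<open>correlation_L2\<close>). This is the
  hypothesis of Katai's orthogonality criterion for a sequence of vectors (\<open>katai_L2\<close>). By the
  Turan-Kubilius inequality a sum of \<open>v n\<close> over \<open>n \<le> N\<close> in \<open>E\<close> is close to the average over the primes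
  \<open>p\<close> of a finite set \<open>P\<close>, with weights proportional to \<open>1 / p\<close>, of \<open>p\<close> times the sum of \<open>v (p * m)\<close>
  over those \<open>m \<le> N / p\<close> with \<open>p * m \<in> E\<close>. If the last
  condition does not depend on \<open>p\<close>, the sum over \<open>p\<close> can be moved inside, and the Cauchy-Schwarz
  inequality leaves only correlations. So the theorem holds for every set \<open>E\<close> of positive density
  that is \<open>sieve_stable\<close> (\<open>sieve_stable_totally_ergodic\<close>): up to a set of \<open>m\<close> of small upper density, the condition \<open>p * m \<in> E\<close> is the
  same for all \<open>p\<close> in a set of primes whose reciprocals have a divergent sum. It remains to
  show that the sets of the three classes are sieve stable.

  If \<open>z\<close> is a concentration point of \<open>f\<close>, the primes with \<open>f p = z\<close> do, as \<open>p * m \<in> E\<close> then means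
  \<open>z * f m \<in> K\<close> for every \<open>m\<close> prime to \<open>p\<close> (\<open>concentration_sieve_stable\<close>).

  For joint level sets, restrict to primes at which the same \<open>f i\<close> vanish. Then
  the sections \<open>{m. p * m \<in> E}\<close>, read through the values \<open>f i p\<close>, are pairwise equal or disjoint. In
  the sense of logarithmic density almost all of them are about as dense as \<open>E\<close>, so that there are
  only finitely many, and one of them occurs for a divergent set of primes (\<open>frequent_section\<close>).
  Logarithmic density is essential here: the section at \<open>p\<close> is seen up to \<open>N / p\<close>, and disjointness
  is of no use for natural densities taken at different scales.

  For polar sets the nonzero mean of \<open>\<bar>f\<bar>\<close> forces \<open>\<bar>f p\<bar>\<close> to be near \<open>1\<close> for almost all
  primes, and by compactness \<open>f p\<close> is near some fixed \<open>z\<close> with \<open>\<bar>z\<bar> = 1\<close> for many of them. Then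
  \<open>p * m \<in> E\<close> means \<open>z * f m \<in> K\<close>, unless \<open>z * f m\<close> is near the boundary of \<open>K\<close>, which is contained in
  finitely many circles and rays. This exceptional set is small unless the values of \<open>\<bar>f\<bar>\<close> or of \<open>f / \<bar>f\<bar>\<close> accumulate at a
  point, and in that case the respective coordinate of \<open>f p\<close> takes only finitely many values on
  almost all primes (\<open>atomless_or_finite_values\<close>), so that it can be prescribed exactly and its
  boundary causes no error.

  The reason for this dichotomy is a rigidity of atoms. Choose an ultrafilter of numbers \<open>N\<close> along
  which the values \<open>g n\<close>, \<open>n \<le> N\<close>, accumulate at \<open>\<phi>\<close>, and let \<open>mass s \<phi>\<close> be the mass of the atom at
  \<open>\<phi>\<close> in the limiting distribution of \<open>g n\<close> for \<open>n \<le> s * N\<close>. The Turan-Kubilius inequality and the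
  compactness of the disc give \<open>mass (s / p) (\<phi> / g p) \<approx> mass s \<phi>\<close> uniformly in \<open>\<phi>\<close>, for almost all \<open>p\<close>.
  For two such primes with \<open>q / p \<approx> r\<close> it follows that the atoms at scale \<open>s / r\<close> have masses that
  occur at scale \<open>s\<close>. The ratios \<open>q / p\<close> accumulate at numbers \<open>r > 1\<close> arbitrarily close to \<open>1\<close>
  (\<open>prime_ratio\<close>), so all masses at scales \<open>s \<le> 1\<close> lie in the countable set of masses at scale \<open>1\<close>
  together with \<open>0\<close>. As \<open>mass s \<phi>\<close> is continuous in \<open>s\<close>, it is constant. Hence
  \<open>mass 1 (\<phi> / g p) \<approx> mass 1 \<phi> > 0\<close> for almost all \<open>p\<close>, and \<open>\<phi> / g p\<close> is one of finitely many heavy atoms.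
\<close>

section \<open>Correlations in an ergodic system\<close>

lemma mps_distr: "measure_preserving_system M T \<Longrightarrow> distr M M T = M"
  by (intro measure_eqI) (auto simp: measure_preserving_system_def emeasure_distr)

lemma mps_funpow:
  assumes "measure_preserving_system M T"
  shows "measure_preserving_system M (T ^^ k)"
proof -
  have meas: "T \<in> measurable M M" and ps: "prob_space M"
    using assms by (auto simp: measure_preserving_system_def)
  have m: "T ^^ k \<in> measurable M M" for k
    by (induction k) (auto intro!: measurable_comp[OF _ meas] simp: comp_def id_def
        intro: measurable_compose[OF _ meas])
  have d: "distr M M (T ^^ k) = M"
  proof (induction k)
    case 0
    show ?case by (simp add: distr_id)
  next
    case (Suc k)
    have "distr M M (T ^^ Suc k) = distr (distr M M (T ^^ k)) M T"
      by (simp add: distr_distr[OF meas m])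
    also have "\<dots> = M" by (simp add: Suc mps_distr[OF assms])
    finally show ?case .
  qed
  show ?thesis
    unfolding measure_preserving_system_def
    using ps m d by (metis emeasure_distr)
qed

lemma mps_integral:
  fixes h :: "'a \<Rightarrow> 'b :: {banach, second_countable_topology}"
  assumes "measure_preserving_system M T" "h \<in> borel_measurable M"
  shows "(\<integral>x. h (T x) \<partial>M) = (\<integral>x. h x \<partial>M)"
    and "integrable M (\<lambda>x. h (T x)) \<longleftrightarrow> integrable M h"
proof -
  have T: "T \<in> measurable M M" using assms by (auto simp: measure_preserving_system_def)
  show "(\<integral>x. h (T x) \<partial>M) = (\<integral>x. h x \<partial>M)"
    using integral_distr[OF T, of h] assms mps_distr[OF assms(1)] by simp
  show "integrable M (\<lambda>x. h (T x)) \<longleftrightarrow> integrable M h"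
    using integrable_distr_eq[OF T, of h] assms mps_distr[OF assms(1)] by simp
qed

lemma integrable_mult_L2:
  fixes a b :: "'a \<Rightarrow> real"
  assumes "a \<in> borel_measurable M" "b \<in> borel_measurable M"
    "integrable M (\<lambda>x. (a x)\<^sup>2)" "integrable M (\<lambda>x. (b x)\<^sup>2)"
  shows "integrable M (\<lambda>x. a x * b x)"
proof (rule Bochner_Integration.integrable_bound)
  show "integrable M (\<lambda>x. (a x)\<^sup>2 + (b x)\<^sup>2)" using assms by simp
  have "\<bar>s * t\<bar> \<le> s\<^sup>2 + t\<^sup>2" for s t :: real
  proof -
    have "2 * (\<bar>s\<bar> * \<bar>t\<bar>) \<le> s\<^sup>2 + t\<^sup>2"
      using sum_squares_bound[of "\<bar>s\<bar>" "\<bar>t\<bar>"] by (simp add: mult.assoc)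
    moreover have "0 \<le> \<bar>s\<bar> * \<bar>t\<bar>" by simp
    ultimately show ?thesis unfolding abs_mult by linarith
  qed
  then show "AE x in M. norm (a x * b x) \<le> norm ((a x)\<^sup>2 + (b x)\<^sup>2)" by simp
qed (use assms in simp)

text \<open>
  Unfolding the recursion shows that \<open>maximal_sum S u k x\<close> is the maximum of the first \<open>k + 1\<close> Birkhoff
  sums, the empty one included. The recursive form is the one that Garsia's proof of the maximal
  ergodic theorem uses.
\<close>

primrec maximal_sum :: "('a \<Rightarrow> 'a) \<Rightarrow> ('a \<Rightarrow> real) \<Rightarrow> nat \<Rightarrow> 'a \<Rightarrow> real" where
  "maximal_sum S u 0 x = 0"
| "maximal_sum S u (Suc k) x = max 0 (u x + maximal_sum S u k (S x))"

definition birkhoff_sum :: "('a \<Rightarrow> 'a) \<Rightarrow> ('a \<Rightarrow> real) \<Rightarrow> nat \<Rightarrow> 'a \<Rightarrow> real" where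
  "birkhoff_sum S u k x = (\<Sum>i<k. u ((S ^^ i) x))"

lemma birkhoff_sum_Suc: "birkhoff_sum S u (Suc k) x = u x + birkhoff_sum S u k (S x)"
  unfolding birkhoff_sum_def
  by (subst sum.lessThan_Suc_shift) (simp add: funpow_Suc_right del: funpow.simps)

lemma birkhoff_sum_le_maximal: "k \<le> N \<Longrightarrow> birkhoff_sum S u k x \<le> maximal_sum S u N x"
proof (induction N arbitrary: k x)
  case 0
  then show ?case by (simp add: birkhoff_sum_def)
next
  case (Suc N)
  show ?case
  proof (cases k)
    case 0
    then show ?thesis by (simp add: birkhoff_sum_def)
  next
    case (Suc k')
    then show ?thesis using Suc.IH[of k' "S x"] Suc.prems by (simp add: birkhoff_sum_Suc)
  qed
qed

lemma maximal_sum_nonneg: "0 \<le> maximal_sum S u k x"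
  by (cases k) auto

lemma maximal_sum_Suc_mono: "maximal_sum S u k x \<le> maximal_sum S u (Suc k) x"
proof (induction k arbitrary: x)
  case (Suc k)
  show ?case using Suc[of "S x"] by simp
qed simp

lemma maximal_sum_integrable:
  assumes S: "measure_preserving_system M S" and u: "integrable M u"
  shows "integrable M (maximal_sum S u k)"
proof (induction k)
  case 0
  show ?case by (simp cong: Bochner_Integration.integrable_cong)
next
  case (Suc k)
  have "integrable M (\<lambda>x. maximal_sum S u k (S x))"
    using mps_integral(2)[OF S, of "maximal_sum S u k"] Suc by auto
  then have "integrable M (\<lambda>x. max 0 (u x + maximal_sum S u k (S x)))"
    using u by simp
  then show ?case by simp
qed

text \<open>
  Where the maximal sum \<open>h\<close> is positive, the recursion bounds \<open>u\<close> from below by \<open>h - h \<circ> S\<close>; elsewhere this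
  difference is not positive. Its integral is zero.
\<close>

lemma maximal_ergodic:
  assumes S: "measure_preserving_system M S" and u: "integrable M u"
  shows "0 \<le> (\<integral>x. u x * indicator {x. 0 < maximal_sum S u (Suc k) x} x \<partial>M)"
proof -
  let ?m = "maximal_sum S u (Suc k)"
  have i: "integrable M ?m" by (rule maximal_sum_integrable[OF S u])
  have i': "integrable M (\<lambda>x. ?m (S x))"
    using mps_integral(2)[OF S, of ?m] i by auto
  have [measurable]: "?m \<in> borel_measurable M" "u \<in> borel_measurable M" using i u by auto
  have "0 = (\<integral>x. ?m x \<partial>M) - (\<integral>x. ?m (S x) \<partial>M)"
    using mps_integral(1)[OF S, of ?m] by simp
  also have "\<dots> = (\<integral>x. ?m x - ?m (S x) \<partial>M)" using i i' by (simp del: maximal_sum.simps)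
  also have "\<dots> \<le> (\<integral>x. u x * indicator {x. 0 < ?m x} x \<partial>M)"
  proof (rule integral_mono)
    show "integrable M (\<lambda>x. ?m x - ?m (S x))" using i i' by (simp del: maximal_sum.simps)
    have "{x. 0 < ?m x} \<inter> space M = {x\<in>space M. 0 < ?m x}" by auto
    then have "{x. 0 < ?m x} \<inter> space M \<in> sets M" by (simp del: maximal_sum.simps)
    from integrable_mult_indicator[OF this u]
    show "integrable M (\<lambda>x. u x * indicator {x. 0 < ?m x} x)"
      by (rule Bochner_Integration.integrable_cong[THEN iffD1, rotated -1]) (auto simp: indicator_def)
    fix x assume "x \<in> space M"
    have "?m x - ?m (S x) \<le> u x" if "0 < ?m x"
      using that maximal_sum_Suc_mono[of S u k "S x"] by (simp add: max_def split: if_splits)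
    moreover have "?m x - ?m (S x) \<le> 0" if "\<not> 0 < ?m x"
      using that maximal_sum_nonneg[of S u "Suc k" "S x"] by simp
    ultimately show "?m x - ?m (S x) \<le> u x * indicator {x. 0 < ?m x} x"
      by (simp add: indicator_def)
  qed
  finally show ?thesis .
qed

lemma integral_nonneg_if_birkhoff_pos:
  assumes S: "measure_preserving_system M S" and u: "integrable M u"
    and pos: "AE x in M. \<exists>k. 0 < birkhoff_sum S u k x"
  shows "0 \<le> (\<integral>x. u x \<partial>M)"
proof -
  have m[measurable]: "maximal_sum S u k \<in> borel_measurable M" "u \<in> borel_measurable M" for k
    using maximal_sum_integrable[OF S u] u by auto
  have lim: "(\<lambda>k. \<integral>x. u x * indicator {x. 0 < maximal_sum S u (Suc k) x} x \<partial>M)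
      \<longlonglongrightarrow> (\<integral>x. u x \<partial>M)"
  proof (rule integral_dominated_convergence[where w = "\<lambda>x. \<bar>u x\<bar>"])
    show "AE x in M. (\<lambda>k. u x * indicator {x. 0 < maximal_sum S u (Suc k) x} x) \<longlonglongrightarrow> u x"
      using pos
    proof eventually_elim
      case (elim x)
      then obtain k where k: "0 < birkhoff_sum S u k x" by blast
      have "0 < maximal_sum S u (Suc N) x" if "N \<ge> k" for N
        using birkhoff_sum_le_maximal[of k "Suc N" S u x] k that by linarith
      then have "eventually (\<lambda>N. u x * indicator {x. 0 < maximal_sum S u (Suc N) x} x = u x) sequentially"
        unfolding eventually_sequentially by (intro exI[of _ k]) (auto simp: indicator_def)
      then show ?case by (rule tendsto_eventually)
    qed
    show "(\<lambda>x. u x * indicator {x. 0 < maximal_sum S u (Suc k) x} x) \<in> borel_measurable M" for k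
    proof -
      have "(\<lambda>x. if 0 < maximal_sum S u (Suc k) x then u x else 0) \<in> borel_measurable M"
        using m by (intro measurable_If) (auto simp del: maximal_sum.simps)
      then show ?thesis
        by (rule measurable_cong[THEN iffD1, rotated]) (auto simp: indicator_def)
    qed
  qed (use u in \<open>auto simp: indicator_def\<close>)
  show ?thesis
    by (rule LIMSEQ_le_const[OF lim]) (use maximal_ergodic[OF S u] in blast)
qed

text \<open>
  As \<open>u\<close> is bounded, passing from \<open>x\<close> to \<open>S x\<close> changes the averages by a null sequence, so that
  the upper limit is invariant at every point and its superlevel sets are
  invariant in the strict sense in which ergodicity is defined. If such a set had full measure at a
  level above the mean, the maximal ergodic theorem would fail for \<open>u - c\<close>.
\<close>

lemma limsup_birkhoff_le:
  assumes S: "measure_preserving_system M S" and erg: "ergodic M S"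
    and um: "u \<in> borel_measurable M" and bd: "\<And>x. \<bar>u x\<bar> \<le> C" and c: "(\<integral>x. u x \<partial>M) < c"
  shows "AE x in M. limsup (\<lambda>k. ereal (birkhoff_sum S u k x / real k)) \<le> ereal c"
proof -
  interpret prob_space M using S by (auto simp: measure_preserving_system_def)
  have Sm[measurable]: "S \<in> measurable M M" using S by (auto simp: measure_preserving_system_def)
  have Sn[measurable]: "(S ^^ k) \<in> measurable M M" for k
    using mps_funpow[OF S, of k] by (auto simp: measure_preserving_system_def)
  note um[measurable]
  have iu: "integrable M u" by (rule integrable_const_bound[of _ C]) (use bd um in auto)
  define h where "h x = limsup (\<lambda>k. ereal (birkhoff_sum S u k x / real k))" for x
  have bm[measurable]: "birkhoff_sum S u k \<in> borel_measurable M" for k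
    unfolding birkhoff_sum_def by measurable
  have hm[measurable]: "h \<in> borel_measurable M" unfolding h_def by measurable
  have inv: "h (S x) = h x" for x
  proof -
    have "(\<lambda>k. (u ((S ^^ k) x) - u x) / real k) \<longlonglongrightarrow> 0"
    proof (rule tendsto_rabs_zero_cancel, rule tendsto_sandwich[where f = "\<lambda>_. 0"])
      show "(\<lambda>k. 2 * C / real k) \<longlonglongrightarrow> 0" by real_asymp
      show "eventually (\<lambda>k. \<bar>(u ((S ^^ k) x) - u x) / real k\<bar> \<le> 2 * C / real k) sequentially"
      proof (intro always_eventually allI)
        fix k
        have "\<bar>u ((S ^^ k) x) - u x\<bar> \<le> 2 * C" using bd[of "(S ^^ k) x"] bd[of x] by linarith
        then show "\<bar>(u ((S ^^ k) x) - u x) / real k\<bar> \<le> 2 * C / real k"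
          by (simp add: divide_right_mono)
      qed
    qed auto
    then have "(\<lambda>k. ereal ((u ((S ^^ k) x) - u x) / real k)) \<longlonglongrightarrow> ereal 0" by simp
    then have "limsup (\<lambda>k. ereal ((u ((S ^^ k) x) - u x) / real k) + ereal (birkhoff_sum S u k x / real k))
      = ereal 0 + limsup (\<lambda>k. ereal (birkhoff_sum S u k x / real k))"
      by (rule ereal_limsup_lim_add) simp
    moreover have "(u ((S ^^ k) x) - u x) / real k + birkhoff_sum S u k x / real k
        = birkhoff_sum S u k (S x) / real k" for k
      using birkhoff_sum_Suc[of S u k x]
      by (simp add: birkhoff_sum_def add_divide_distrib[symmetric])
    ultimately show ?thesis by (simp add: h_def)
  qed
  let ?A = "{x\<in>space M. h x > ereal c}"
  have A: "?A \<in> sets M" by measurable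
  have "S -` ?A \<inter> space M = ?A"
    using measurable_space[OF Sm] by (auto simp: inv)
  then have "emeasure M ?A = 0 \<or> emeasure M ?A = 1" using erg A by (auto simp: ergodic_def)
  moreover have "emeasure M ?A \<noteq> 1"
  proof
    assume "emeasure M ?A = 1"
    then have "AE x in M. x \<in> ?A" using A by (simp add: emeasure_eq_measure AE_iff_measurable prob_eq_1)
    then have ae: "AE x in M. \<exists>k. 0 < birkhoff_sum S (\<lambda>x. u x - c) k x"
    proof eventually_elim
      case (elim x)
      then have "ereal c < limsup (\<lambda>k. ereal (birkhoff_sum S u k x / real k))" by (simp add: h_def)
      then have "\<not> eventually (\<lambda>k. ereal (birkhoff_sum S u k x / real k) \<le> ereal c) sequentially"
        unfolding not_le[symmetric] by (rule contrapos_nn) (rule Limsup_bounded)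
      then obtain k where "k \<ge> 1" "\<not> birkhoff_sum S u k x / real k \<le> c"
        unfolding eventually_sequentially by (auto simp: not_le)
      then have "0 < birkhoff_sum S u k x - real k * c" by (simp add: field_simps)
      also have "birkhoff_sum S u k x - real k * c = birkhoff_sum S (\<lambda>x. u x - c) k x"
        by (simp add: birkhoff_sum_def sum_subtractf)
      finally show ?case by blast
    qed
    have "0 \<le> (\<integral>x. u x - c \<partial>M)"
      by (rule integral_nonneg_if_birkhoff_pos[OF S _ ae]) (use iu in simp)
    then show False using iu c by (simp add: prob_space)
  qed
  ultimately have "emeasure M ?A = 0" by blast
  then have "AE x in M. \<not> (h x > ereal c)" by (subst AE_iff_measurable[OF A]) auto
  then show ?thesis by (simp add: h_def not_less)
qed

lemma birkhoff_bounded: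
  assumes S: "measure_preserving_system M S" and erg: "ergodic M S"
    and um: "u \<in> borel_measurable M" and bd: "\<And>x. \<bar>u x\<bar> \<le> C"
  shows "AE x in M. (\<lambda>k. birkhoff_sum S u k x / real k) \<longlonglongrightarrow> (\<integral>x. u x \<partial>M)"
proof -
  let ?I = "\<integral>x. u x \<partial>M"
  have "AE x in M. \<forall>j. limsup (\<lambda>k. ereal (birkhoff_sum S u k x / real k)) \<le> ereal (?I + 1 / real (Suc j))"
    unfolding AE_all_countable by (intro allI limsup_birkhoff_le[OF S erg um bd]) simp
  moreover have "AE x in M. \<forall>j. limsup (\<lambda>k. ereal (birkhoff_sum S (\<lambda>x. - u x) k x / real k)) \<le> ereal (- ?I + 1 / real (Suc j))"
    unfolding AE_all_countable by (intro allI limsup_birkhoff_le[OF S erg _]) (use um bd in auto)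
  ultimately show ?thesis
  proof eventually_elim
    case (elim x)
    let ?b = "\<lambda>k. birkhoff_sum S u k x / real k"
    have neg: "birkhoff_sum S (\<lambda>x. - u x) k x = - birkhoff_sum S u k x" for k
      by (simp add: birkhoff_sum_def sum_negf)
    show ?case
    proof (rule LIMSEQ_I)
      fix e :: real assume "e > 0"
      then obtain j where j: "1 / real (Suc j) < e" using nat_approx_posE by blast
      have ub: "eventually (\<lambda>k. v k < c + e) sequentially"
        if "limsup (\<lambda>k. ereal (v k)) \<le> ereal (c + 1 / real (Suc j))" for v :: "nat \<Rightarrow> real" and c
      proof -
        have "limsup (\<lambda>k. ereal (v k)) < ereal (c + e)"
          using that j by (meson add_strict_left_mono ereal_less(2) le_less_trans less_ereal.simps(1))
        then have "eventually (\<lambda>k. ereal (v k) < ereal (c + e)) sequentially" by (rule Limsup_lessD)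
        then show ?thesis by simp
      qed
      have "eventually (\<lambda>k. ?b k < ?I + e) sequentially" by (rule ub) (use elim(1) in blast)
      moreover have "eventually (\<lambda>k. - ?b k < - ?I + e) sequentially"
        by (rule ub) (use elim(2) in \<open>simp add: neg\<close>)
      ultimately have "eventually (\<lambda>k. norm (?b k - ?I) < e) sequentially"
        by eventually_elim (simp add: abs_less_iff)
      then show "\<exists>no. \<forall>n\<ge>no. norm (?b n - ?I) < e" by (simp add: eventually_sequentially)
    qed
  qed
qed

lemma correlation_bounded:
  assumes S: "measure_preserving_system M S" and erg: "ergodic M S"
    and um: "u \<in> borel_measurable M" and bd: "\<And>x. \<bar>u x\<bar> \<le> C"
  shows "(\<lambda>N. (\<Sum>m=1..N. \<integral>x. u ((S ^^ m) x) * u x \<partial>M) / real N) \<longlonglongrightarrow> (\<integral>x. u x \<partial>M)\<^sup>2"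
proof -
  interpret prob_space M using S by (auto simp: measure_preserving_system_def)
  have Sm[measurable]: "S \<in> measurable M M" using S by (auto simp: measure_preserving_system_def)
  have Sn[measurable]: "(S ^^ k) \<in> measurable M M" for k
    using mps_funpow[OF S, of k] by (auto simp: measure_preserving_system_def)
  note um[measurable]
  let ?I = "\<integral>x. u x \<partial>M"
  have C: "0 \<le> C" using bd[of undefined] by linarith
  have bm[measurable]: "birkhoff_sum S u k \<in> borel_measurable M" for k
    unfolding birkhoff_sum_def by measurable
  have avg: "\<bar>birkhoff_sum S u k x / real k\<bar> \<le> C" for k x
  proof -
    have "\<bar>birkhoff_sum S u k x\<bar> \<le> (\<Sum>i<k. C)"
      unfolding birkhoff_sum_def by (rule order_trans[OF sum_abs]) (intro sum_mono bd)
    then show ?thesis using C by (cases "k = 0") (auto simp: field_simps)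
  qed
  have "(\<lambda>N. \<integral>x. birkhoff_sum S u N (S x) / real N * u x \<partial>M) \<longlonglongrightarrow> (\<integral>x. ?I * u x \<partial>M)"
  proof (rule integral_dominated_convergence[where w = "\<lambda>_. C * C"])
    have "AE x in distr M M S. (\<lambda>k. birkhoff_sum S u k x / real k) \<longlonglongrightarrow> ?I"
      unfolding mps_distr[OF S] by (rule birkhoff_bounded[OF S erg um bd])
    then have "AE x in M. (\<lambda>k. birkhoff_sum S u k (S x) / real k) \<longlonglongrightarrow> ?I"
      by (subst (asm) AE_distr_iff) auto
    then show "AE x in M. (\<lambda>N. birkhoff_sum S u N (S x) / real N * u x) \<longlonglongrightarrow> ?I * u x"
      by eventually_elim (intro tendsto_intros)
    show "AE x in M. norm (birkhoff_sum S u N (S x) / real N * u x) \<le> C * C" for N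
      using avg[of N] bd C by (intro AE_I2) (simp only: real_norm_def abs_mult mult_mono abs_ge_zero)
  qed auto
  also have "(\<integral>x. ?I * u x \<partial>M) = ?I\<^sup>2" by (simp add: power2_eq_square)
  also have "(\<lambda>N. \<integral>x. birkhoff_sum S u N (S x) / real N * u x \<partial>M)
    = (\<lambda>N. (\<Sum>m=1..N. \<integral>x. u ((S ^^ m) x) * u x \<partial>M) / real N)"
  proof
    fix N
    have int: "integrable M (\<lambda>x. u ((S ^^ m) x) * u x)" for m
    proof (rule integrable_const_bound[of _ "C * C"])
      show "AE x in M. norm (u ((S ^^ m) x) * u x) \<le> C * C"
        using bd C by (intro AE_I2) (simp only: real_norm_def abs_mult mult_mono abs_ge_zero)
    qed auto
    have eq: "birkhoff_sum S u N (S x) / real N * u x = (\<Sum>m=1..N. u ((S ^^ m) x) * u x) / real N" for x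
    proof -
      have "birkhoff_sum S u N (S x) = (\<Sum>i<N. u ((S ^^ Suc i) x))"
        by (simp add: birkhoff_sum_def funpow_swap1)
      also have "\<dots> = (\<Sum>m=1..N. u ((S ^^ m) x))"
        by (rule sum.reindex_bij_witness[of _ "\<lambda>m. m - 1" Suc]) auto
      finally show ?thesis by (simp add: sum_distrib_right)
    qed
    show "(\<integral>x. birkhoff_sum S u N (S x) / real N * u x \<partial>M)
      = (\<Sum>m=1..N. \<integral>x. u ((S ^^ m) x) * u x \<partial>M) / real N"
      unfolding eq using int by simp
  qed
  finally show ?thesis .
qed


text \<open>
  Truncation: \<open>w K\<close> is \<open>u\<close> cut off at height \<open>K\<close>. Since correlations are continuous in the mean square,
  uniformly in \<open>m\<close>, those of \<open>u\<close> are close to those of \<open>w K\<close>, whose averages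
  tend to the square of a mean that is itself small.
\<close>

lemma correlation_L2:
  assumes S: "measure_preserving_system M S" and erg: "ergodic M S"
    and um: "u \<in> borel_measurable M" and sq: "integrable M (\<lambda>x. (u x)\<^sup>2)"
    and mean: "(\<integral>x. u x \<partial>M) = 0"
  shows "(\<lambda>N. (\<Sum>m=1..N. \<integral>x. u ((S ^^ m) x) * u x \<partial>M) / real N) \<longlonglongrightarrow> 0"
proof (rule LIMSEQ_I)
  fix e :: real assume e: "e > 0"
  interpret prob_space M using S by (auto simp: measure_preserving_system_def)
  note um[measurable]
  have Sn[measurable]: "(S ^^ k) \<in> measurable M M" for k
    using mps_funpow[OF S, of k] by (auto simp: measure_preserving_system_def)
  define U where "U = (\<integral>x. (u x)\<^sup>2 \<partial>M)"
  have U: "0 \<le> U" unfolding U_def by simp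
  have iu: "integrable M u"
    using sq square_integrable_imp_integrable[OF um] by simp
  define w where "w K x = max (- real K) (min (real K) (u x))" for K x
  have wm[measurable]: "w K \<in> borel_measurable M" for K unfolding w_def by measurable
  have r_le: "(u x - w K x)\<^sup>2 \<le> (u x)\<^sup>2" and w_le: "(w K x)\<^sup>2 \<le> (u x)\<^sup>2" for K x
    unfolding w_def by (auto simp: abs_le_square_iff[symmetric] max_def min_def)
  have "(\<lambda>K. \<integral>x. (u x - w K x)\<^sup>2 \<partial>M) \<longlonglongrightarrow> (\<integral>x. 0 \<partial>M)"
  proof (rule integral_dominated_convergence[where w = "\<lambda>x. (u x)\<^sup>2"])
    show "AE x in M. (\<lambda>K. (u x - w K x)\<^sup>2) \<longlonglongrightarrow> 0"
    proof (intro AE_I2 tendsto_eventually)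
      fix x
      obtain K0 where "\<bar>u x\<bar> \<le> real K0" using real_arch_simple by blast
      then show "eventually (\<lambda>K. (u x - w K x)\<^sup>2 = 0) sequentially"
        unfolding eventually_sequentially by (intro exI[of _ K0]) (auto simp: w_def max_def min_def)
    qed
  qed (use sq r_le in auto)
  then have lim: "(\<lambda>K. \<integral>x. (u x - w K x)\<^sup>2 \<partial>M) \<longlonglongrightarrow> 0" by simp
  \<comment> \<open>\<open>h\<close> is the target for the norm of \<open>u - w K\<close>; it makes the total error below less than \<open>e\<close>.\<close>
  define h where "h = min 1 (e / (2 * (U + 3)))"
  have h: "0 < h" "h \<le> 1" using e U by (auto simp: h_def)
  have hU: "h * (U + 3) \<le> e / 2"
  proof -
    have "h * (U + 3) \<le> e / (2 * (U + 3)) * (U + 3)"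
      unfolding h_def using U by (intro mult_right_mono) auto
    also have "\<dots> = e / 2" using U by (simp add: divide_simps)
    finally show ?thesis .
  qed
  have "eventually (\<lambda>K. (\<integral>x. (u x - w K x)\<^sup>2 \<partial>M) < h\<^sup>2) sequentially"
    by (rule order_tendstoD(2)[OF lim]) (use h in simp)
  then obtain K where K: "(\<integral>x. (u x - w K x)\<^sup>2 \<partial>M) < h\<^sup>2"
    unfolding eventually_sequentially by blast
  let ?w = "w K"
  let ?r = "\<lambda>x. u x - w K x"
  have ir: "integrable M (\<lambda>x. (?r x)\<^sup>2)" 
    by (rule Bochner_Integration.integrable_bound[OF sq]) (use r_le in auto)
  have iw: "integrable M (\<lambda>x. (?w x)\<^sup>2)" 
    by (rule Bochner_Integration.integrable_bound[OF sq]) (use w_le in auto)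
  have w_U: "(\<integral>x. (?w x)\<^sup>2 \<partial>M) \<le> U"
    unfolding U_def by (rule integral_mono[OF iw sq w_le])
  have iS: "integrable M (\<lambda>x. (g ((S ^^ m) x))\<^sup>2)"
    and IS: "(\<integral>x. (g ((S ^^ m) x))\<^sup>2 \<partial>M) = (\<integral>x. (g x)\<^sup>2 \<partial>M)"
    if "g \<in> borel_measurable M" "integrable M (\<lambda>x. (g x)\<^sup>2)" for g :: "'a \<Rightarrow> real" and m
    using mps_integral[OF mps_funpow[OF S], of "\<lambda>x. (g x)\<^sup>2" m] that by auto
  have young: "\<bar>\<integral>x. a x * b x \<partial>M\<bar> \<le> (h + h * U) / 2"
    if "a \<in> borel_measurable M" "b \<in> borel_measurable M"
      "integrable M (\<lambda>x. (a x)\<^sup>2)" "integrable M (\<lambda>x. (b x)\<^sup>2)"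
      "(\<integral>x. (a x)\<^sup>2 \<partial>M) \<le> h\<^sup>2" "(\<integral>x. (b x)\<^sup>2 \<partial>M) \<le> U" for a b :: "'a \<Rightarrow> real"
  proof -
    have p: "\<bar>a x * b x\<bar> \<le> ((a x)\<^sup>2 / h + h * (b x)\<^sup>2) / 2" for x
    proof -
      have "0 \<le> (\<bar>a x\<bar> - h * \<bar>b x\<bar>)\<^sup>2 / h" using h by simp
      also have "\<dots> = (a x)\<^sup>2 / h + h * (b x)\<^sup>2 - 2 * \<bar>a x * b x\<bar>"
        using h by (simp add: field_simps power2_eq_square abs_mult)
      finally show ?thesis by simp
    qed
    have "\<bar>\<integral>x. a x * b x \<partial>M\<bar> \<le> (\<integral>x. \<bar>a x * b x\<bar> \<partial>M)" by (rule integral_abs_bound)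
    also have "\<dots> \<le> (\<integral>x. ((a x)\<^sup>2 / h + h * (b x)\<^sup>2) / 2 \<partial>M)"
      by (rule integral_mono) (use integrable_mult_L2[OF that(1-4)] that p in auto)
    also have "\<dots> = ((\<integral>x. (a x)\<^sup>2 \<partial>M) / h + h * (\<integral>x. (b x)\<^sup>2 \<partial>M)) / 2"
      using that by simp
    also have "\<dots> \<le> (h\<^sup>2 / h + h * U) / 2"
      using that h by (intro divide_right_mono add_mono mult_left_mono) auto
    also have "h\<^sup>2 / h = h" using h by (simp add: power2_eq_square)
    finally show ?thesis .
  qed
  have close: "\<bar>(\<integral>x. u ((S ^^ m) x) * u x \<partial>M) - (\<integral>x. ?w ((S ^^ m) x) * ?w x \<partial>M)\<bar> \<le> h + h * U" for m
  proof -
    have i1: "integrable M (\<lambda>x. ?r x * u ((S ^^ m) x))" 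
      by (rule integrable_mult_L2) (use ir iS[OF um sq] in auto)
    have i2: "integrable M (\<lambda>x. ?r ((S ^^ m) x) * ?w x)"
      by (rule integrable_mult_L2) (use iS[of ?r] ir iw in auto)
    have i3: "integrable M (\<lambda>x. u ((S ^^ m) x) * u x)"
      by (rule integrable_mult_L2) (use iS[OF um sq] sq in auto)
    have i4: "integrable M (\<lambda>x. ?w ((S ^^ m) x) * ?w x)"
      by (rule integrable_mult_L2) (use iS[of ?w] iw in auto)
    have "(\<integral>x. u ((S ^^ m) x) * u x \<partial>M) - (\<integral>x. ?w ((S ^^ m) x) * ?w x \<partial>M)
      = (\<integral>x. u ((S ^^ m) x) * u x - ?w ((S ^^ m) x) * ?w x \<partial>M)"
      using i3 i4 by simp
    also have "\<dots> = (\<integral>x. ?r x * u ((S ^^ m) x) + ?r ((S ^^ m) x) * ?w x \<partial>M)"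
      by (intro Bochner_Integration.integral_cong) (auto simp: algebra_simps)
    also have "\<dots> = (\<integral>x. ?r x * u ((S ^^ m) x) \<partial>M) + (\<integral>x. ?r ((S ^^ m) x) * ?w x \<partial>M)"
      using i1 i2 by (rule Bochner_Integration.integral_add)
    finally have eq: "(\<integral>x. u ((S ^^ m) x) * u x \<partial>M) - (\<integral>x. ?w ((S ^^ m) x) * ?w x \<partial>M)
      = (\<integral>x. ?r x * u ((S ^^ m) x) \<partial>M) + (\<integral>x. ?r ((S ^^ m) x) * ?w x \<partial>M)" .
    have "\<bar>\<integral>x. ?r x * u ((S ^^ m) x) \<partial>M\<bar> \<le> (h + h * U) / 2"
      by (rule young) (use ir iS[OF um sq] IS[OF um sq] K in \<open>auto simp: U_def\<close>)
    moreover have "\<bar>\<integral>x. ?r ((S ^^ m) x) * ?w x \<partial>M\<bar> \<le> (h + h * U) / 2"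
    proof (rule young)
      show "(\<integral>x. (?r ((S ^^ m) x))\<^sup>2 \<partial>M) \<le> h\<^sup>2" using IS[of ?r m] ir K by simp
      show "integrable M (\<lambda>x. (?r ((S ^^ m) x))\<^sup>2)" using iS[of ?r m] ir by simp
    qed (use iw w_U in auto)
    ultimately have "\<bar>(\<integral>x. ?r x * u ((S ^^ m) x) \<partial>M) + (\<integral>x. ?r ((S ^^ m) x) * ?w x \<partial>M)\<bar>
        \<le> (h + h * U) / 2 + (h + h * U) / 2"
      by (intro order_trans[OF abs_triangle_ineq] add_mono)
    then show ?thesis unfolding eq by simp
  qed
  have mean_w: "(\<integral>x. ?w x \<partial>M)\<^sup>2 \<le> h"
  proof -
    have irr: "integrable M ?r" by (rule square_integrable_imp_integrable[OF _ ir]) simp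
    have "(\<integral>x. ?r x \<partial>M)\<^sup>2 \<le> (\<integral>x. (?r x)\<^sup>2 \<partial>M)"
      using variance_positive[of ?r] variance_eq[OF irr ir] by linarith
    moreover have "integrable M ?w"
      by (rule square_integrable_imp_integrable[OF _ iw]) simp
    then have "(\<integral>x. ?r x \<partial>M) = - (\<integral>x. ?w x \<partial>M)" using iu mean by simp
    ultimately have "(\<integral>x. ?w x \<partial>M)\<^sup>2 \<le> h\<^sup>2" using K by simp
    also have "h\<^sup>2 \<le> h" using h by (simp add: power2_eq_square)
    finally show ?thesis .
  qed
  have "(\<lambda>N. (\<Sum>m=1..N. \<integral>x. ?w ((S ^^ m) x) * ?w x \<partial>M) / real N) \<longlonglongrightarrow> (\<integral>x. ?w x \<partial>M)\<^sup>2"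
    by (rule correlation_bounded[OF S erg, of _ "real K"]) (auto simp: w_def)
  from LIMSEQ_D[OF this h(1)] obtain N0 where
    N0: "\<And>N. N \<ge> N0 \<Longrightarrow> \<bar>(\<Sum>m=1..N. \<integral>x. ?w ((S ^^ m) x) * ?w x \<partial>M) / real N - (\<integral>x. ?w x \<partial>M)\<^sup>2\<bar> < h"
    by auto
  have "\<bar>(\<Sum>m=1..N. \<integral>x. u ((S ^^ m) x) * u x \<partial>M) / real N\<bar> < e" if "N \<ge> N0" for N
  proof -
    let ?a = "\<lambda>m. \<integral>x. u ((S ^^ m) x) * u x \<partial>M" and ?b = "\<lambda>m. \<integral>x. ?w ((S ^^ m) x) * ?w x \<partial>M"
    have "\<bar>(\<Sum>m=1..N. ?a m) - (\<Sum>m=1..N. ?b m)\<bar> \<le> (\<Sum>m=1..N. h + h * U)"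
      unfolding sum_subtractf[symmetric] by (rule order_trans[OF sum_abs]) (intro sum_mono close)
    then have "\<bar>(\<Sum>m=1..N. ?a m) / real N - (\<Sum>m=1..N. ?b m) / real N\<bar> \<le> h + h * U"
      using h U by (cases "N = 0") (auto simp: diff_divide_distrib[symmetric] field_simps)
    then have "\<bar>(\<Sum>m=1..N. ?a m) / real N\<bar> < h + h * U + (h + h)"
      using N0[OF that] mean_w zero_le_power2[of "\<integral>x. ?w x \<partial>M"] by linarith
    also have "\<dots> = h * (U + 3)" by (simp add: algebra_simps)
    also have "\<dots> < e" using hU e by simp
    finally show ?thesis .
  qed
  then show "\<exists>no. \<forall>N\<ge>no. norm ((\<Sum>m=1..N. \<integral>x. u ((S ^^ m) x) * u x \<partial>M) / real N - 0) < e"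
    by (intro exI[of _ N0]) auto
qed

section \<open>The Turan-Kubilius inequality\<close>

text \<open>
  The null sets of the arguments below: the exceptional sets of primes in every application of the
  Turan-Kubilius inequality have a convergent sum of reciprocals.
\<close>

definition thin :: "nat set \<Rightarrow> bool" where
  "thin P \<longleftrightarrow> (\<lambda>p. 1 / real p) summable_on P"

lemma thin_subset: "thin Q \<Longrightarrow> P \<subseteq> Q \<Longrightarrow> thin P"
  unfolding thin_def by (rule summable_on_subset_banach)

lemma thin_Un: "thin P \<Longrightarrow> thin Q \<Longrightarrow> thin (P \<union> Q)"
proof -
  assume "thin P" "thin Q"
  then have "thin P" "thin (Q - P)" by (auto intro: thin_subset)
  then have "thin (P \<union> (Q - P))" unfolding thin_def by (intro summable_on_Un_disjoint) auto
  then show ?thesis by simp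
qed

lemma thin_empty [simp]: "thin {}"
  by (simp add: thin_def)

lemma thin_UN: "finite I \<Longrightarrow> (\<And>i. i \<in> I \<Longrightarrow> thin (P i)) \<Longrightarrow> thin (\<Union>i\<in>I. P i)"
  by (induction I rule: finite_induct) (auto intro: thin_Un)

lemma thin_imp_bounded:
  assumes "thin P"
  obtains C where "\<And>F. finite F \<Longrightarrow> F \<subseteq> P \<Longrightarrow> (\<Sum>p\<in>F. 1 / real p) \<le> C"
proof
  fix F assume "finite F" "F \<subseteq> P"
  then show "(\<Sum>p\<in>F. 1 / real p) \<le> infsum (\<lambda>p. 1 / real p) P"
    using assms unfolding thin_def by (intro finite_sum_le_infsum) auto
qed

lemma not_thin_imp_unbounded:
  assumes "\<not> thin P"
  obtains F where "finite F" "F \<subseteq> P" "C \<le> (\<Sum>p\<in>F. 1 / real p)"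
proof (rule ccontr)
  assume "\<not> thesis"
  then have "\<And>F. finite F \<Longrightarrow> F \<subseteq> P \<Longrightarrow> (\<Sum>p\<in>F. 1 / real p) \<le> C"
    using that by (meson le_cases)
  then have "thin P" unfolding thin_def
    by (intro nonneg_bounded_partial_sums_imp_summable_on[where C = C]) (auto simp: eventually_finite_subsets_at_top)
  with assms show False by simp
qed

lemma not_thin_Diff: "\<not> thin P \<Longrightarrow> thin Z \<Longrightarrow> \<not> thin (P - Z)"
  using thin_Un[of "P - Z" Z] thin_subset[of "P - Z \<union> Z" P] by blast

lemma multiplicative_prime:
  assumes "multiplicative f" "prime p" "m > 0" "\<not> p dvd m"
  shows "f (p * m) = f p * f m"
  using assms prime_imp_coprime[OF assms(2,4)] prime_gt_0_nat[OF assms(2)] unfolding multiplicative_def by blast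

lemma sum_inverse_squares_le: "(\<Sum>k=1..K. 1 / (real k)\<^sup>2) \<le> 2"
proof -
  have "(\<Sum>k=1..K. 1 / (real k)\<^sup>2) \<le> 2 - 1 / real K" if "K \<ge> 1" for K
    using that
  proof (induction K rule: nat_induct_at_least)
    case (Suc K)
    have "1 / (real (Suc K))\<^sup>2 \<le> 1 / real K - 1 / real (Suc K)"
    proof -
      have "1 / (real (Suc K))\<^sup>2 \<le> 1 / (real K * real (Suc K))"
        using Suc by (intro divide_left_mono) (auto simp: power2_eq_square)
      also have "\<dots> = 1 / real K - 1 / real (Suc K)"
        using Suc by (simp add: field_simps)
      finally show ?thesis .
    qed
    then show ?case using Suc by simp
  qed simp
  then have "(\<Sum>k=1..K. 1 / (real k)\<^sup>2) \<le> 2 - 1 / real K" if "K \<ge> 1" using that by blast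
  then show ?thesis by (cases "K \<ge> 1") (auto intro: order_trans simp del: One_nat_def)
qed

lemma sum_inverse_squares_le_finite:
  assumes "finite F" "0 \<notin> F"
  shows "(\<Sum>k\<in>F. 1 / (real k)\<^sup>2) \<le> 2"
proof -
  have "F \<subseteq> {1..Max F}" if "F \<noteq> {}" using assms that by (auto simp: Suc_le_eq intro!: gr0I)
  then have "(\<Sum>k\<in>F. 1 / (real k)\<^sup>2) \<le> (\<Sum>k=1..Max F. 1 / (real k)\<^sup>2)"
    by (cases "F = {}") (auto intro!: sum_mono2 sum_nonneg)
  then show ?thesis using sum_inverse_squares_le[of "Max F"] by linarith
qed

definition recip_sum :: "nat set \<Rightarrow> real" where "recip_sum P = (\<Sum>p\<in>P. 1 / real p)"

definition omega_in :: "nat set \<Rightarrow> nat \<Rightarrow> real" where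
  "omega_in P n = (\<Sum>p\<in>P. of_bool (p dvd n))"

text \<open>
  The multiples of \<open>k\<close> carry the share \<open>1 / k\<close> of the total weight, up to an error of \<open>1\<close>.
  This is all that the Turan-Kubilius inequality needs to know about a weight, and it holds both for
  the constant weight and for \<open>1 / n\<close>.
\<close>

definition balanced :: "(nat \<Rightarrow> real) \<Rightarrow> nat \<Rightarrow> bool" where
  "balanced w N \<longleftrightarrow> (\<forall>n. 0 \<le> w n) \<and> (\<forall>k\<ge>1.
     (\<Sum>n=1..N. w n) / real k - 1 \<le> (\<Sum>n=1..N. w n * of_bool (k dvd n)) \<and>
     (\<Sum>n=1..N. w n * of_bool (k dvd n)) \<le> (\<Sum>n=1..N. w n) / real k)"

lemma recip_sum_nonneg: "0 \<le> recip_sum P"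
  unfolding recip_sum_def by (rule sum_nonneg) simp

text \<open>
  The second moment is expanded. For distinct primes divisibility by both is divisibility by the
  product, so that the main terms of order \<open>W * (recip_sum P)\<^sup>2\<close> cancel and only the diagonal remains.
\<close>

lemma turan_kubilius:
  assumes fin: "finite P" and pr: "\<And>p. p \<in> P \<Longrightarrow> prime p" and w: "balanced w N"
  defines "W \<equiv> \<Sum>n=1..N. w n"
  shows "(\<Sum>n=1..N. w n * (omega_in P n - recip_sum P)\<^sup>2)
    \<le> W * recip_sum P + 2 * recip_sum P * real (card P)"
proof -
  let ?L = "recip_sum P"
  define D where "D k = (\<Sum>n=1..N. w n * of_bool (k dvd n))" for k
  have w0: "0 \<le> w n" for n using w by (simp add: balanced_def)
  have W: "0 \<le> W" unfolding W_def by (rule sum_nonneg) (use w0 in simp)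
  have D: "W / real k - 1 \<le> D k" "D k \<le> W / real k" if "k \<ge> 1" for k
    using w that by (auto simp: balanced_def D_def W_def)
  have L: "0 \<le> ?L" by (rule recip_sum_nonneg)
  have p1: "p \<ge> 1" if "p \<in> P" for p using pr[OF that] prime_ge_1_nat by blast
  have omega1: "(\<Sum>n=1..N. w n * omega_in P n) = (\<Sum>p\<in>P. D p)"
    unfolding omega_in_def D_def by (simp only: sum_distrib_left) (rule sum.swap)
  have "(\<Sum>n=1..N. w n * (omega_in P n)\<^sup>2)
      = (\<Sum>n=1..N. \<Sum>p\<in>P. \<Sum>q\<in>P. w n * (of_bool (p dvd n) * of_bool (q dvd n)))"
    unfolding omega_in_def power2_eq_square sum_product by (simp only: sum_distrib_left)
  also have "\<dots> = (\<Sum>p\<in>P. \<Sum>q\<in>P. \<Sum>n=1..N. w n * (of_bool (p dvd n) * of_bool (q dvd n)))"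
    by (subst sum.swap, rule sum.cong[OF refl], rule sum.swap)
  also have "\<dots> \<le> (\<Sum>p\<in>P. \<Sum>q\<in>P. W * (1 / real p) * (1 / real q) + (if q = p then W / real p else 0))"
  proof (intro sum_mono)
    fix p q assume pq: "p \<in> P" "q \<in> P"
    show "(\<Sum>n=1..N. w n * (of_bool (p dvd n) * of_bool (q dvd n)))
      \<le> W * (1 / real p) * (1 / real q) + (if q = p then W / real p else 0)"
    proof (cases "q = p")
      case True
      then have "(\<Sum>n=1..N. w n * (of_bool (p dvd n) * of_bool (q dvd n))) = D p"
        unfolding D_def by (intro sum.cong) auto
      moreover have "0 \<le> W * (1 / real p) * (1 / real q)" using W by simp
      ultimately show ?thesis using D(2)[OF p1[OF pq(1)]] True by simp
    next
      case False
      then have "coprime p q" using pr pq by (simp add: primes_coprime)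
      then have "(\<Sum>n=1..N. w n * (of_bool (p dvd n) * of_bool (q dvd n))) = D (p * q)"
        unfolding D_def using divides_mult[of p _ q] by (intro sum.cong) (auto simp: dest: dvd_mult_left dvd_mult_right)
      also have "\<dots> \<le> W / real (p * q)" using D(2)[of "p * q"] p1 pq by (simp add: Suc_le_eq)
      finally show ?thesis using False by simp
    qed
  qed
  also have "\<dots> = W * ?L\<^sup>2 + W * ?L"
  proof -
    have "(\<Sum>p\<in>P. \<Sum>q\<in>P. W * (1 / real p) * (1 / real q)) = W * ?L\<^sup>2"
      unfolding recip_sum_def power2_eq_square sum_product by (simp only: sum_distrib_left mult.assoc)
    moreover have "(\<Sum>p\<in>P. \<Sum>q\<in>P. if q = p then W / real p else 0) = W * ?L"
      unfolding recip_sum_def using fin by (simp add: sum_distrib_left)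
    ultimately show ?thesis by (simp add: sum.distrib)
  qed
  finally have sq: "(\<Sum>n=1..N. w n * (omega_in P n)\<^sup>2) \<le> W * ?L\<^sup>2 + W * ?L" .
  have "W * ?L - real (card P) = (\<Sum>p\<in>P. W / real p - 1)"
    by (simp add: sum_subtractf recip_sum_def sum_distrib_left)
  also have "\<dots> \<le> (\<Sum>p\<in>P. D p)" by (rule sum_mono) (use D p1 in blast)
  finally have "W * ?L - real (card P) \<le> (\<Sum>n=1..N. w n * omega_in P n)" by (simp only: omega1)
  then have om: "2 * ?L * (W * ?L - real (card P)) \<le> 2 * ?L * (\<Sum>n=1..N. w n * omega_in P n)"
    by (rule mult_left_mono) (use L in simp)
  have "(\<Sum>n=1..N. w n * (omega_in P n - ?L)\<^sup>2)
    = (\<Sum>n=1..N. w n * (omega_in P n)\<^sup>2 - 2 * ?L * (w n * omega_in P n) + ?L\<^sup>2 * w n)"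
    by (intro sum.cong) (auto simp: power2_eq_square algebra_simps)
  also have "\<dots> = (\<Sum>n=1..N. w n * (omega_in P n)\<^sup>2) - 2 * ?L * (\<Sum>n=1..N. w n * omega_in P n) + ?L\<^sup>2 * W"
    by (simp add: sum.distrib sum_subtractf sum_distrib_left W_def)
  also have "\<dots> \<le> (W * ?L\<^sup>2 + W * ?L) - 2 * ?L * (W * ?L - real (card P)) + ?L\<^sup>2 * W"
    using sq om by linarith
  also have "\<dots> = W * ?L + 2 * ?L * real (card P)" by (simp add: power2_eq_square algebra_simps)
  finally show ?thesis .
qed

text \<open>
  The dual form: for bounded \<open>F\<close> the total over all \<open>n\<close> is recovered, with relative error of order
  \<open>1 / sqrt (recip_sum P)\<close>, from the totals over the multiples of the primes in \<open>P\<close>.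
\<close>

lemma turan_kubilius_sum:
  assumes fin: "finite P" and pr: "\<And>p. p \<in> P \<Longrightarrow> prime p" and w: "balanced w N"
    and F: "\<And>n. \<bar>F n\<bar> \<le> 1"
  defines "W \<equiv> \<Sum>n=1..N. w n"
  shows "\<bar>(\<Sum>p\<in>P. \<Sum>n=1..N. w n * of_bool (p dvd n) * F n) - recip_sum P * (\<Sum>n=1..N. w n * F n)\<bar>
    \<le> sqrt (W * (W * recip_sum P + 2 * recip_sum P * real (card P)))"
proof -
  let ?L = "recip_sum P"
  have w0: "0 \<le> w n" for n using w by (simp add: balanced_def)
  have F2: "(F n)\<^sup>2 \<le> 1" for n using F[of n] by (simp add: abs_square_le_1)
  have aux: "(sqrt (w n) * F n) * (sqrt (w n) * (omega_in P n - ?L)) = w n * F n * omega_in P n - ?L * (w n * F n)" for n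
  proof -
    have "(sqrt (w n) * F n) * (sqrt (w n) * (omega_in P n - ?L)) = (sqrt (w n) * sqrt (w n)) * (F n * (omega_in P n - ?L))"
      by (simp only: mult_ac)
    then show ?thesis using w0[of n] by (simp add: algebra_simps)
  qed
  have "(\<Sum>p\<in>P. \<Sum>n=1..N. w n * of_bool (p dvd n) * F n) = (\<Sum>n=1..N. w n * F n * omega_in P n)"
    unfolding omega_in_def sum_distrib_left by (subst sum.swap) (simp add: mult_ac)
  then have "(\<Sum>p\<in>P. \<Sum>n=1..N. w n * of_bool (p dvd n) * F n) - ?L * (\<Sum>n=1..N. w n * F n)
     = (\<Sum>n=1..N. (sqrt (w n) * F n) * (sqrt (w n) * (omega_in P n - ?L)))"
    unfolding sum_distrib_left by (simp add: sum_subtractf[symmetric] aux)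
  also have "\<bar>\<dots>\<bar> \<le> sqrt ((\<Sum>n=1..N. (sqrt (w n) * F n)\<^sup>2) * (\<Sum>n=1..N. (sqrt (w n) * (omega_in P n - ?L))\<^sup>2))"
    by (rule real_le_rsqrt) (simp only: power2_abs Cauchy_Schwarz_ineq_sum)
  also have "\<dots> \<le> sqrt (W * (W * ?L + 2 * ?L * real (card P)))"
  proof (rule real_sqrt_le_mono, rule mult_mono)
    show "(\<Sum>n=1..N. (sqrt (w n) * F n)\<^sup>2) \<le> W"
      unfolding W_def using F2 w0 by (intro sum_mono) (simp add: power_mult_distrib mult_left_le)
    show "(\<Sum>n=1..N. (sqrt (w n) * (omega_in P n - ?L))\<^sup>2) \<le> W * ?L + 2 * ?L * real (card P)"
      using turan_kubilius[OF fin pr w] w0 by (simp add: power_mult_distrib W_def)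
    show "0 \<le> W" unfolding W_def by (rule sum_nonneg) (use w0 in simp)
  qed (rule sum_nonneg, simp)
  finally show ?thesis .
qed

lemma sum_multiples:
  fixes h :: "nat \<Rightarrow> 'b :: semiring_1"
  assumes "k \<ge> 1"
  shows "(\<Sum>n=1..N. h n * of_bool (k dvd n)) = (\<Sum>m=1..N div k. h (k * m))"
proof -
  have "(\<Sum>n=1..N. h n * of_bool (k dvd n)) = (\<Sum>n\<in>{n\<in>{1..N}. k dvd n}. h n)"
    unfolding sum.inter_filter[OF finite_atLeastAtMost] by (intro sum.cong) auto
  also have "\<dots> = (\<Sum>m=1..N div k. h (k * m))"
    by (rule sum.reindex_bij_witness[of _ "\<lambda>m. k * m" "\<lambda>n. n div k"])
      (use assms in \<open>auto simp: less_eq_div_iff_mult_less_eq mult.commute Suc_le_eq div_greater_zero_iff dvd_imp_le div_le_mono\<close>)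
  finally show ?thesis .
qed

lemma real_div_le: "real (N div k) \<le> real N / real k"
proof (cases "k = 0")
  case False
  have "real (N div k) * real k \<le> real N"
    unfolding of_nat_mult[symmetric] of_nat_le_iff by simp
  then show ?thesis using False by (simp add: field_simps)
qed simp

lemma balanced_1: "balanced (\<lambda>_. 1) N"
  unfolding balanced_def
proof (intro conjI allI impI)
  fix k :: nat assume k: "k \<ge> 1"
  have eq: "(\<Sum>n=1..N. 1 * of_bool (k dvd n)) = real (N div k)"
    using sum_multiples[OF k, of "\<lambda>_. 1::real" N] by simp
  have "N \<le> k * (N div k) + k"
    using k mult_div_mod_eq[of k N] mod_less_divisor[of k N] by linarith
  then have up: "real N \<le> real k * real (N div k) + real k"
    unfolding of_nat_mult[symmetric] of_nat_add[symmetric] of_nat_le_iff .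
  show "(\<Sum>n=1..N. 1 * of_bool (k dvd n)) \<le> (\<Sum>n=1..N. 1) / real k"
    unfolding eq using real_div_le[of N k] by simp
  show "(\<Sum>n=1..N. 1) / real k - 1 \<le> (\<Sum>n=1..N. 1 * of_bool (k dvd n))"
    unfolding eq using up k by (simp add: field_simps)
qed simp

text \<open>
  The sum of \<open>1 / n\<close> over the multiples of \<open>k\<close> is \<open>1 / k\<close> times the harmonic sum up to \<open>N div k\<close>. The terms
  between \<open>N div k\<close> and \<open>N\<close> that are missing add up to at most \<open>k\<close>, each of them being at most \<open>k / N\<close>.
\<close>

lemma balanced_log: "balanced (\<lambda>n. 1 / real n) N"
  unfolding balanced_def
proof (intro conjI allI impI)
  fix k :: nat assume k: "k \<ge> 1"
  let ?H = "\<lambda>N. \<Sum>m=1..N. 1 / real m"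
  have eq: "(\<Sum>n=1..N. 1 / real n * of_bool (k dvd n)) = ?H (N div k) / real k"
    using sum_multiples[OF k, of "\<lambda>n. 1 / real n" N] k
    by (simp add: sum_divide_distrib mult.commute)
  have le: "N div k \<le> N" by simp
  have split: "?H N = ?H (N div k) + (\<Sum>m\<in>{N div k<..N}. 1 / real m)"
    by (subst sum.union_disjoint[symmetric]) (auto intro!: sum.cong intro: order_trans[OF _ le])
  show "(\<Sum>n=1..N. 1 / real n * of_bool (k dvd n)) \<le> ?H N / real k"
    unfolding eq split by (intro divide_right_mono) (auto intro: sum_nonneg)
  have "(\<Sum>m\<in>{N div k<..N}. 1 / real m) \<le> (\<Sum>m\<in>{N div k<..N}. real k / real N)"
  proof (rule sum_mono)
    fix m assume m: "m \<in> {N div k<..N}"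
    then have "N \<le> m * k" using k by (simp add: div_less_iff_less_mult)
    then have "real N \<le> real m * real k" by (metis of_nat_le_iff of_nat_mult)
    then show "1 / real m \<le> real k / real N" using m by (simp add: field_simps)
  qed
  also have "\<dots> = real (N - N div k) * (real k / real N)" by simp
  also have "\<dots> \<le> real N * (real k / real N)" by (intro mult_right_mono) auto
  also have "\<dots> \<le> real k" by simp
  finally have "?H N / real k \<le> (?H (N div k) + real k) / real k"
    unfolding split by (intro divide_right_mono) auto
  then show "?H N / real k - 1 \<le> (\<Sum>n=1..N. 1 / real n * of_bool (k dvd n))"
    unfolding eq using k by (simp add: add_divide_distrib)
qed simp

section \<open>An orthogonality criterion in the mean square\<close>

text \<open>
  Stability under sieving by primes: \<open>E'\<close> is the common value of the sections \<open>{m. p * m \<in> E}\<close> and \<open>B\<close> the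
  exceptional set. Multiples of \<open>p\<close> are left out because a multiplicative function says nothing there.
\<close>

definition sieve_stable :: "nat set \<Rightarrow> bool" where
  "sieve_stable E \<longleftrightarrow> (\<forall>\<epsilon>>0. \<exists>Q E' B. Q \<subseteq> {p. prime p} \<and> \<not> thin Q \<and>
     (\<forall>p\<in>Q. \<forall>m>0. \<not> p dvd m \<longrightarrow> m \<notin> B \<longrightarrow> (p * m \<in> E \<longleftrightarrow> m \<in> E')) \<and>
     (\<forall>\<^sub>F N in sequentially. real (card (B \<inter> {1..N})) \<le> \<epsilon> * real N))"

lemma square_sum3: "(a + b + c)\<^sup>2 \<le> 3 * (a\<^sup>2 + b\<^sup>2 + c\<^sup>2)" for a b c :: real
proof -
  have "0 \<le> (a - b)\<^sup>2 + (b - c)\<^sup>2 + (a - c)\<^sup>2" by simp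
  then show ?thesis by (simp add: power2_eq_square algebra_simps)
qed

lemma atLeastAtMost_div: "k \<ge> 1 \<Longrightarrow> {1..N div k} = {m\<in>{1..N}. k * m \<le> (N::nat)}"
proof -
  assume k: "k \<ge> 1"
  have "m \<le> N" if "k * m \<le> N" for m using that k mult_le_mono1[OF k, of m] by linarith
  moreover have "m \<le> N div k \<longleftrightarrow> k * m \<le> N" for m
    using k by (simp add: less_eq_div_iff_mult_less_eq mult.commute)
  ultimately show ?thesis by auto
qed

lemma sum_atLeastAtMost_div:
  fixes h :: "nat \<Rightarrow> real"
  assumes "k \<ge> 1"
  shows "(\<Sum>m=1..N div k. h m) = (\<Sum>m=1..N. of_bool (k * m \<le> N) * h m)"
  unfolding atLeastAtMost_div[OF assms] sum.inter_filter[OF finite_atLeastAtMost]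
  by (intro sum.cong) auto

text \<open>
  The inequality behind the orthogonality criterion, for the values \<open>b n\<close> of a sequence of functions
  at one point. The right-hand side contains only squares and products of two terms, so that it can
  be integrated.
\<close>

lemma katai_pointwise:
  fixes b :: "nat \<Rightarrow> real" and N :: nat
  assumes fin: "finite P" and pr: "\<And>p. p \<in> P \<Longrightarrow> prime p"
    and st: "\<And>p m. p \<in> P \<Longrightarrow> m > 0 \<Longrightarrow> \<not> p dvd m \<Longrightarrow> m \<notin> B \<Longrightarrow> p * m \<in> E \<longleftrightarrow> m \<in> E'"
  defines "L \<equiv> recip_sum P"
  defines "X \<equiv> \<Sum>p\<in>P. real (card {m\<in>{1..N div p}. m \<in> B \<or> p dvd m})"
  shows "(L * (\<Sum>n\<in>E \<inter> {1..N}. b n))\<^sup>2 \<le> 3 *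
    ((real N * L + 2 * L * real (card P)) * (\<Sum>n=1..N. (b n)\<^sup>2)
     + X * (\<Sum>p\<in>P. \<Sum>m=1..N div p. (b (p * m))\<^sup>2)
     + real N * (\<Sum>m=1..N. (\<Sum>p\<in>P. of_bool (p * m \<le> N) * b (p * m))\<^sup>2))"
proof -
  define e where "e n = (of_bool (n \<in> E) :: real)" for n
  define e' where "e' n = (of_bool (n \<in> E') :: real)" for n
  have p1: "p \<ge> 1" if "p \<in> P" for p using pr[OF that] prime_ge_1_nat by blast
  \<comment> \<open>\<open>T1\<close> is the error of the Turan-Kubilius approximation, \<open>T2\<close> comes from replacing the sections of \<open>E\<close> by
    the common set \<open>E'\<close>, and in \<open>T3\<close> the sum over \<open>p\<close> has been moved inside.\<close>
  define T1 where "T1 = (\<Sum>n=1..N. (e n * (L - omega_in P n)) * b n)"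
  define T2 where "T2 = (\<Sum>p\<in>P. \<Sum>m=1..N div p. (e (p * m) - e' m) * b (p * m))"
  define T3 where "T3 = (\<Sum>m=1..N. e' m * (\<Sum>p\<in>P. of_bool (p * m \<le> N) * b (p * m)))"
  have "L * (\<Sum>n\<in>E \<inter> {1..N}. b n) = L * (\<Sum>n=1..N. e n * b n)"
    unfolding e_def by (intro arg_cong[where f = "(*) L"]) (simp add: Int_commute flip: sum.inter_restrict)
  also have "\<dots> = T1 + (\<Sum>n=1..N. e n * b n * omega_in P n)"
    unfolding T1_def by (simp add: sum_distrib_left sum.distrib[symmetric] algebra_simps)
  also have "(\<Sum>n=1..N. e n * b n * omega_in P n) = (\<Sum>p\<in>P. \<Sum>n=1..N. e n * b n * of_bool (p dvd n))"
    unfolding omega_in_def by (simp only: sum_distrib_left) (rule sum.swap)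
  also have "\<dots> = (\<Sum>p\<in>P. \<Sum>m=1..N div p. e (p * m) * b (p * m))"
    using p1 by (intro sum.cong refl sum_multiples) auto
  also have "\<dots> = T2 + (\<Sum>p\<in>P. \<Sum>m=1..N div p. e' m * b (p * m))"
    unfolding T2_def by (simp add: sum.distrib[symmetric] algebra_simps)
  also have "(\<Sum>p\<in>P. \<Sum>m=1..N div p. e' m * b (p * m))
      = (\<Sum>p\<in>P. \<Sum>m=1..N. e' m * (of_bool (p * m \<le> N) * b (p * m)))"
  proof (rule sum.cong[OF refl])
    fix p assume p: "p \<in> P"
    show "(\<Sum>m=1..N div p. e' m * b (p * m)) = (\<Sum>m=1..N. e' m * (of_bool (p * m \<le> N) * b (p * m)))"
      unfolding sum_atLeastAtMost_div[OF p1[OF p]] by (intro sum.cong refl) (simp only: mult_ac)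
  qed
  also have "\<dots> = T3" unfolding T3_def by (subst sum.swap) (simp add: sum_distrib_left)
  finally have split: "L * (\<Sum>n\<in>E \<inter> {1..N}. b n) = T1 + T2 + T3" by simp
  have "T1\<^sup>2 \<le> (\<Sum>n=1..N. (e n * (L - omega_in P n))\<^sup>2) * (\<Sum>n=1..N. (b n)\<^sup>2)"
    unfolding T1_def by (rule Cauchy_Schwarz_ineq_sum)
  also have "\<dots> \<le> (real N * L + 2 * L * real (card P)) * (\<Sum>n=1..N. (b n)\<^sup>2)"
  proof (rule mult_right_mono)
    have "(\<Sum>n=1..N. (e n * (L - omega_in P n))\<^sup>2) \<le> (\<Sum>n=1..N. 1 * (omega_in P n - L)\<^sup>2)"
      by (rule sum_mono) (auto simp: e_def power2_commute)
    also have "\<dots> \<le> real N * L + 2 * L * real (card P)"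
      using turan_kubilius[OF fin pr balanced_1[of N]] by (simp add: L_def)
    finally show "(\<Sum>n=1..N. (e n * (L - omega_in P n))\<^sup>2) \<le> real N * L + 2 * L * real (card P)" .
  qed (rule sum_nonneg, simp)
  finally have T1: "T1\<^sup>2 \<le> (real N * L + 2 * L * real (card P)) * (\<Sum>n=1..N. (b n)\<^sup>2)" .
  let ?S = "Sigma P (\<lambda>p. {1..N div p})"
  have "T2 = (\<Sum>(p, m)\<in>?S. (e (p * m) - e' m) * b (p * m))"
    unfolding T2_def by (rule sum.Sigma) (use fin in auto)
  then have "T2\<^sup>2 = (\<Sum>x\<in>?S. (e (fst x * snd x) - e' (snd x)) * b (fst x * snd x))\<^sup>2"
    by (simp add: case_prod_unfold)
  also have "\<dots> \<le> (\<Sum>x\<in>?S. (e (fst x * snd x) - e' (snd x))\<^sup>2) * (\<Sum>x\<in>?S. (b (fst x * snd x))\<^sup>2)"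
    by (rule Cauchy_Schwarz_ineq_sum)
  also have "(\<Sum>x\<in>?S. (b (fst x * snd x))\<^sup>2) = (\<Sum>p\<in>P. \<Sum>m=1..N div p. (b (p * m))\<^sup>2)"
    using fin by (subst sum.Sigma) (auto simp: case_prod_unfold)
  also have "(\<Sum>x\<in>?S. (e (fst x * snd x) - e' (snd x))\<^sup>2) = (\<Sum>p\<in>P. \<Sum>m=1..N div p. (e (p * m) - e' m)\<^sup>2)"
    using fin by (subst sum.Sigma) (auto simp: case_prod_unfold)
  also have "\<dots> * (\<Sum>p\<in>P. \<Sum>m=1..N div p. (b (p * m))\<^sup>2)
     \<le> X * (\<Sum>p\<in>P. \<Sum>m=1..N div p. (b (p * m))\<^sup>2)"
  proof (rule mult_right_mono)
    show "(\<Sum>p\<in>P. \<Sum>m=1..N div p. (e (p * m) - e' m)\<^sup>2) \<le> X"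
      unfolding X_def
    proof (rule sum_mono)
      fix p assume p: "p \<in> P"
      have "(\<Sum>m=1..N div p. (e (p * m) - e' m)\<^sup>2) \<le> (\<Sum>m=1..N div p. if m \<in> B \<or> p dvd m then 1 else 0)"
        using st[OF p] by (intro sum_mono) (auto simp: e_def e'_def)
      also have "\<dots> = real (card {m\<in>{1..N div p}. m \<in> B \<or> p dvd m})"
        by (subst sum.inter_filter[symmetric]) auto
      finally show "(\<Sum>m=1..N div p. (e (p * m) - e' m)\<^sup>2) \<le> real (card {m\<in>{1..N div p}. m \<in> B \<or> p dvd m})" .
    qed
  qed (intro sum_nonneg, simp)
  finally have T2: "T2\<^sup>2 \<le> X * (\<Sum>p\<in>P. \<Sum>m=1..N div p. (b (p * m))\<^sup>2)" .
  have "T3\<^sup>2 \<le> (\<Sum>m=1..N. (e' m)\<^sup>2) * (\<Sum>m=1..N. (\<Sum>p\<in>P. of_bool (p * m \<le> N) * b (p * m))\<^sup>2)"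
    unfolding T3_def by (rule Cauchy_Schwarz_ineq_sum)
  also have "\<dots> \<le> real N * (\<Sum>m=1..N. (\<Sum>p\<in>P. of_bool (p * m \<le> N) * b (p * m))\<^sup>2)"
  proof (rule mult_right_mono)
    have "(\<Sum>m=1..N. (e' m)\<^sup>2) \<le> (\<Sum>m=1..N. 1)" by (rule sum_mono) (auto simp: e'_def)
    then show "(\<Sum>m=1..N. (e' m)\<^sup>2) \<le> real N" by simp
  qed (intro sum_nonneg, simp)
  finally have T3: "T3\<^sup>2 \<le> real N * (\<Sum>m=1..N. (\<Sum>p\<in>P. of_bool (p * m \<le> N) * b (p * m))\<^sup>2)" .
  show ?thesis unfolding split using square_sum3[of T1 T2 T3] T1 T2 T3 by argo
qed

lemma filterlim_div: "k \<ge> 1 \<Longrightarrow> filterlim (\<lambda>N. N div k) sequentially sequentially"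
  unfolding filterlim_at_top eventually_sequentially
  by (meson less_eq_div_iff_mult_less_eq less_le_trans zero_less_one)

lemma average_subseq_div:
  fixes a :: "nat \<Rightarrow> real"
  assumes "(\<lambda>N. a N / real N) \<longlonglongrightarrow> 0" and k: "k \<ge> 1"
  shows "(\<lambda>N. a (N div k) / real N) \<longlonglongrightarrow> 0"
proof -
  have "filterlim (\<lambda>N. N div k) sequentially sequentially" by (rule filterlim_div[OF k])
  then have "(\<lambda>N. a (N div k) / real (N div k)) \<longlonglongrightarrow> 0"
    by (rule filterlim_compose[OF assms(1)])
  then have lim: "(\<lambda>N. \<bar>a (N div k) / real (N div k)\<bar> + \<bar>a 0\<bar> / real N) \<longlonglongrightarrow> \<bar>0\<bar> + 0"
    by (intro tendsto_add tendsto_rabs tendsto_divide_0[OF tendsto_const] filterlim_real_sequentially filterlim_at_top_imp_at_infinity)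
  show ?thesis
  proof (rule tendsto_rabs_zero_cancel, rule tendsto_sandwich[OF _ _ tendsto_const lim[simplified]])
    show "\<forall>\<^sub>F N in sequentially. \<bar>a (N div k) / real N\<bar> \<le> \<bar>a (N div k)\<bar> / real (N div k) + \<bar>a 0\<bar> / real N"
    proof (intro always_eventually allI)
      fix N
      show "\<bar>a (N div k) / real N\<bar> \<le> \<bar>a (N div k)\<bar> / real (N div k) + \<bar>a 0\<bar> / real N"
      proof (cases "N div k = 0")
        case False
        then have "\<bar>a (N div k)\<bar> / real N \<le> \<bar>a (N div k)\<bar> / real (N div k)"
          by (intro divide_left_mono) (auto intro!: Nat.gr0I mult_pos_pos)
        then show ?thesis by (simp add: add_increasing2)
      qed simp
    qed
  qed auto
qed

lemma card_multiples: "k \<ge> 1 \<Longrightarrow> real (card {m\<in>{1..N}. k dvd m}) \<le> real N / real k"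
proof -
  assume k: "k \<ge> 1"
  have "real (card {m\<in>{1..N}. k dvd m}) = (\<Sum>m=1..N. 1 * of_bool (k dvd m))"
    unfolding card_eq_sum of_nat_sum sum.inter_filter[OF finite_atLeastAtMost] by (intro sum.cong) auto
  also have "\<dots> \<le> (\<Sum>m=1..N. 1) / real k"
    using balanced_1[of N] k unfolding balanced_def by blast
  finally show ?thesis by simp
qed

text \<open>
  Integration of the pointwise inequality. With \<open>L = recip_sum P\<close>, the three terms contribute at most
  \<open>V / L\<close>, \<open>V * (\<epsilon> + 2 / L)\<close> and \<open>V / L\<close> plus a multiple of the averaged correlations, up to constants.
  For a fixed finite \<open>P\<close> the correlations disappear in the limit.
\<close>

lemma katai_L2:
  fixes v :: "nat \<Rightarrow> 'a \<Rightarrow> real"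
  assumes E: "sieve_stable E"
    and meas: "\<And>n. v n \<in> borel_measurable M"
    and sq: "\<And>n. integrable M (\<lambda>x. (v n x)\<^sup>2)" and V: "\<And>n. (\<integral>x. (v n x)\<^sup>2 \<partial>M) \<le> V"
    and corr: "\<And>p q. prime p \<Longrightarrow> prime q \<Longrightarrow> p \<noteq> q \<Longrightarrow>
      (\<lambda>N. (\<Sum>m=1..N. \<integral>x. v (p * m) x * v (q * m) x \<partial>M) / real N) \<longlonglongrightarrow> 0"
  shows "(\<lambda>N. (\<integral>x. (\<Sum>n\<in>E \<inter> {1..N}. v n x)\<^sup>2 \<partial>M) / (real N)\<^sup>2) \<longlonglongrightarrow> 0"
proof (rule LIMSEQ_I)
  fix r :: real assume r: "r > 0"
  note meas[measurable]
  have V0: "0 \<le> V" using V[of 0] by (rule order_trans[rotated]) simp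
  \<comment> \<open>The total bound is \<open>15 * V / L + 3 * \<epsilon> * V + r / 4\<close>; \<open>\<epsilon>\<close> here and \<open>C \<le> L\<close> below make each of the first two
    summands at most \<open>r / 4\<close>.\<close>
  define \<epsilon> where "\<epsilon> = r / (12 * (V + 1))"
  have \<epsilon>: "\<epsilon> > 0" using r V0 by (simp add: \<epsilon>_def)
  from E[unfolded sieve_stable_def, rule_format, OF \<epsilon>] obtain Q E' B where
    QE: "Q \<subseteq> {p. prime p} \<and> \<not> thin Q \<and>
      (\<forall>p\<in>Q. \<forall>m>0. \<not> p dvd m \<longrightarrow> m \<notin> B \<longrightarrow> (p * m \<in> E \<longleftrightarrow> m \<in> E')) \<and>
      (\<forall>\<^sub>F N in sequentially. real (card (B \<inter> {1..N})) \<le> \<epsilon> * real N)" by (elim exE)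
  then have Q: "Q \<subseteq> {p. prime p}" "\<not> thin Q"
    and dens: "\<forall>\<^sub>F N in sequentially. real (card (B \<inter> {1..N})) \<le> \<epsilon> * real N"
    by simp_all
  have st: "p * m \<in> E \<longleftrightarrow> m \<in> E'" if "p \<in> Q" "m > 0" "\<not> p dvd m" "m \<notin> B" for p m
    using QE that by simp
  define C where "C = max 1 (60 * (V + 1) / r)"
  from not_thin_imp_unbounded[OF Q(2)] obtain P where fin: "finite P" and PQ: "P \<subseteq> Q"
    and "C \<le> (\<Sum>p\<in>P. 1 / real p)" by metis
  define L where "L = recip_sum P"
  have L: "C \<le> L" using \<open>C \<le> _\<close> by (simp add: L_def recip_sum_def)
  then have L1: "L \<ge> 1" "60 * (V + 1) / r \<le> L" by (auto simp: C_def)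
  have pr: "prime p" if "p \<in> P" for p using that PQ Q by auto
  have p1: "p \<ge> 1" if "p \<in> P" for p using pr[OF that] prime_ge_1_nat by blast
  define G where "G p q N = (\<Sum>m=1..N. \<integral>x. v (p * m) x * v (q * m) x \<partial>M)" for p q N
  define X where "X N = (\<Sum>p\<in>P. real (card {m\<in>{1..N div p}. m \<in> B \<or> p dvd m}))" for N
  define R where "R N = (\<Sum>p\<in>P. \<Sum>q\<in>P - {p}. \<bar>G p q (N div max p q)\<bar>)" for N
  have int_prod: "integrable M (\<lambda>x. v i x * v j x)" for i j
    by (rule integrable_mult_L2[OF meas meas sq sq])
  have int_sum_sq: "integrable M (\<lambda>x. (\<Sum>i\<in>I. c i * v (g i) x)\<^sup>2)" for I :: "nat set" and c g
  proof -
    have eq: "(\<Sum>i\<in>I. c i * v (g i) x)\<^sup>2 = (\<Sum>i\<in>I. \<Sum>j\<in>I. (c i * c j) * (v (g i) x * v (g j) x))" for x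
      unfolding power2_eq_square sum_product by (intro sum.cong refl) (simp only: mult_ac)
    show ?thesis unfolding eq
      by (intro Bochner_Integration.integrable_sum integrable_mult_right int_prod)
  qed
  have "X N \<ge> 0" for N unfolding X_def by (simp add: sum_nonneg)
  have main: "L\<^sup>2 * (\<integral>x. (\<Sum>n\<in>E \<inter> {1..N}. v n x)\<^sup>2 \<partial>M)
     \<le> 3 * ((real N * L + 2 * L * real (card P)) * (real N * V) + X N * (real N * L * V)
       + real N * (real N * L * V + R N))" for N
  proof -
    have "L\<^sup>2 * (\<integral>x. (\<Sum>n\<in>E \<inter> {1..N}. v n x)\<^sup>2 \<partial>M) = (\<integral>x. (L * (\<Sum>n\<in>E \<inter> {1..N}. v n x))\<^sup>2 \<partial>M)"
      by (simp add: power_mult_distrib)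
    also have "\<dots> \<le> (\<integral>x. 3 *
      ((real N * L + 2 * L * real (card P)) * (\<Sum>n=1..N. (v n x)\<^sup>2)
       + X N * (\<Sum>p\<in>P. \<Sum>m=1..N div p. (v (p * m) x)\<^sup>2)
       + real N * (\<Sum>m=1..N. (\<Sum>p\<in>P. of_bool (p * m \<le> N) * v (p * m) x)\<^sup>2)) \<partial>M)"
    proof (rule integral_mono)
      show "integrable M (\<lambda>x. (L * (\<Sum>n\<in>E \<inter> {1..N}. v n x))\<^sup>2)"
        using int_sum_sq[of "\<lambda>_. 1" id "E \<inter> {1..N}"] by (simp add: power_mult_distrib)
      show "integrable M (\<lambda>x. 3 *
        ((real N * L + 2 * L * real (card P)) * (\<Sum>n=1..N. (v n x)\<^sup>2)
         + X N * (\<Sum>p\<in>P. \<Sum>m=1..N div p. (v (p * m) x)\<^sup>2)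
         + real N * (\<Sum>m=1..N. (\<Sum>p\<in>P. of_bool (p * m \<le> N) * v (p * m) x)\<^sup>2)))"
        by (intro integrable_mult_right Bochner_Integration.integrable_add Bochner_Integration.integrable_sum sq int_sum_sq)
    qed (unfold L_def X_def, rule katai_pointwise[OF fin pr, where B = B and E' = E'], use st PQ in auto)
    also have "\<dots> = 3 *
      ((real N * L + 2 * L * real (card P)) * (\<Sum>n=1..N. \<integral>x. (v n x)\<^sup>2 \<partial>M)
       + X N * (\<Sum>p\<in>P. \<Sum>m=1..N div p. \<integral>x. (v (p * m) x)\<^sup>2 \<partial>M)
       + real N * (\<Sum>m=1..N. \<integral>x. (\<Sum>p\<in>P. of_bool (p * m \<le> N) * v (p * m) x)\<^sup>2 \<partial>M))"
      by (simp add: sq int_sum_sq)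
    also have "\<dots> \<le> 3 * ((real N * L + 2 * L * real (card P)) * (real N * V) + X N * (real N * L * V)
       + real N * (real N * L * V + R N))"
    proof (intro mult_left_mono add_mono)
      have "(\<Sum>n=1..N. \<integral>x. (v n x)\<^sup>2 \<partial>M) \<le> (\<Sum>n=1..N. V)" by (intro sum_mono V)
      then show "(\<Sum>n=1..N. \<integral>x. (v n x)\<^sup>2 \<partial>M) \<le> real N * V" by simp
      have part: "(\<Sum>p\<in>P. \<Sum>m=1..N div p. \<integral>x. (v (p * m) x)\<^sup>2 \<partial>M) \<le> real N * L * V"
      proof -
        have "(\<Sum>p\<in>P. \<Sum>m=1..N div p. \<integral>x. (v (p * m) x)\<^sup>2 \<partial>M) \<le> (\<Sum>p\<in>P. real N / real p * V)"
        proof (rule sum_mono)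
          fix p assume "p \<in> P"
          have "(\<Sum>m=1..N div p. \<integral>x. (v (p * m) x)\<^sup>2 \<partial>M) \<le> (\<Sum>m=1..N div p. V)" by (intro sum_mono V)
          also have "\<dots> = real (N div p) * V" by simp
          also have "\<dots> \<le> real N / real p * V"
            using V0 by (intro mult_right_mono) (simp add: real_div_le)
          finally show "(\<Sum>m=1..N div p. \<integral>x. (v (p * m) x)\<^sup>2 \<partial>M) \<le> real N / real p * V" .
        qed
        also have "\<dots> = real N * L * V"
          by (simp add: L_def recip_sum_def sum_distrib_left sum_distrib_right)
        finally show ?thesis .
      qed
      show "(\<Sum>p\<in>P. \<Sum>m=1..N div p. \<integral>x. (v (p * m) x)\<^sup>2 \<partial>M) \<le> real N * L * V" by (rule part)
      have "(\<Sum>m=1..N. \<integral>x. (\<Sum>p\<in>P. of_bool (p * m \<le> N) * v (p * m) x)\<^sup>2 \<partial>M)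
        = (\<Sum>m=1..N. \<Sum>p\<in>P. \<Sum>q\<in>P. of_bool (p * m \<le> N) * of_bool (q * m \<le> N) * (\<integral>x. v (p * m) x * v (q * m) x \<partial>M))"
      proof (rule sum.cong[OF refl])
        fix m
        have "(\<integral>x. (\<Sum>p\<in>P. of_bool (p * m \<le> N) * v (p * m) x)\<^sup>2 \<partial>M)
          = (\<integral>x. (\<Sum>p\<in>P. \<Sum>q\<in>P. of_bool (p * m \<le> N) * of_bool (q * m \<le> N) * (v (p * m) x * v (q * m) x)) \<partial>M)"
          unfolding power2_eq_square sum_product
          by (intro Bochner_Integration.integral_cong sum.cong refl) (simp only: mult_ac)
        also have "\<dots> = (\<Sum>p\<in>P. \<Sum>q\<in>P. of_bool (p * m \<le> N) * of_bool (q * m \<le> N) * (\<integral>x. v (p * m) x * v (q * m) x \<partial>M))"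
          using int_prod by simp
        finally show "(\<integral>x. (\<Sum>p\<in>P. of_bool (p * m \<le> N) * v (p * m) x)\<^sup>2 \<partial>M)
          = (\<Sum>p\<in>P. \<Sum>q\<in>P. of_bool (p * m \<le> N) * of_bool (q * m \<le> N) * (\<integral>x. v (p * m) x * v (q * m) x \<partial>M))" .
      qed
      also have "\<dots> = (\<Sum>p\<in>P. \<Sum>q\<in>P. \<Sum>m=1..N. of_bool (p * m \<le> N) * of_bool (q * m \<le> N) * (\<integral>x. v (p * m) x * v (q * m) x \<partial>M))"
        by (subst sum.swap, rule sum.cong[OF refl], rule sum.swap)
      also have "\<dots> = (\<Sum>p\<in>P. \<Sum>q\<in>P. G p q (N div max p q))"
      proof (intro sum.cong refl)
        fix p q assume pq: "p \<in> P" "q \<in> P"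
        have "1 \<le> max p q" using p1[OF pq(1)] by simp
        then show "(\<Sum>m=1..N. of_bool (p * m \<le> N) * of_bool (q * m \<le> N) * (\<integral>x. v (p * m) x * v (q * m) x \<partial>M))
          = G p q (N div max p q)"
          unfolding G_def by (simp only: sum_atLeastAtMost_div nat_mult_max_left max.bounded_iff of_bool_conj)
      qed
      also have "\<dots> \<le> (\<Sum>p\<in>P. (\<Sum>m=1..N div p. \<integral>x. (v (p * m) x)\<^sup>2 \<partial>M) + (\<Sum>q\<in>P - {p}. \<bar>G p q (N div max p q)\<bar>))"
      proof (rule sum_mono)
        fix p assume p: "p \<in> P"
        have "(\<Sum>q\<in>P. G p q (N div max p q)) = G p p (N div p) + (\<Sum>q\<in>P - {p}. G p q (N div max p q))"
          using sum.remove[OF fin p, of "\<lambda>q. G p q (N div max p q)"] by simp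
        also have "G p p (N div p) = (\<Sum>m=1..N div p. \<integral>x. (v (p * m) x)\<^sup>2 \<partial>M)"
          by (simp add: G_def power2_eq_square)
        finally show "(\<Sum>q\<in>P. G p q (N div max p q)) \<le> (\<Sum>m=1..N div p. \<integral>x. (v (p * m) x)\<^sup>2 \<partial>M) + (\<Sum>q\<in>P - {p}. \<bar>G p q (N div max p q)\<bar>)"
          by (simp add: sum_mono)
      qed
      also have "\<dots> \<le> real N * L * V + R N"
        unfolding R_def using part by (simp add: sum.distrib)
      finally show "(\<Sum>m=1..N. \<integral>x. (\<Sum>p\<in>P. of_bool (p * m \<le> N) * v (p * m) x)\<^sup>2 \<partial>M) \<le> real N * L * V + R N" .
    qed (use \<open>X N \<ge> 0\<close> L1 in auto)
    finally show ?thesis .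
  qed
  have "(\<lambda>N. R N / real N) \<longlonglongrightarrow> 0"
  proof -
    have "(\<lambda>N. \<Sum>p\<in>P. \<Sum>q\<in>P - {p}. \<bar>G p q (N div max p q) / real N\<bar>) \<longlonglongrightarrow> (\<Sum>p\<in>P. \<Sum>q\<in>P - {p}. \<bar>0\<bar>)"
    proof (intro tendsto_sum tendsto_rabs)
      fix p q assume pq: "p \<in> P" "q \<in> P - {p}"
      have "(\<lambda>N. G p q N / real N) \<longlonglongrightarrow> 0" unfolding G_def using pq pr by (intro corr) auto
      then show "(\<lambda>N. G p q (N div max p q) / real N) \<longlonglongrightarrow> 0"
        using p1 pq by (intro average_subseq_div) (auto simp: max_def)
    qed
    then show ?thesis by (simp add: R_def sum_divide_distrib)
  qed
  then have evR: "\<forall>\<^sub>F N in sequentially. \<bar>R N / real N\<bar> < r / 12"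
    using LIMSEQ_D[of "\<lambda>N. R N / real N" 0 "r / 12"] r by (auto simp: eventually_sequentially)
  have evX: "\<forall>\<^sub>F N in sequentially. X N \<le> (\<epsilon> * L + 2) * real N"
  proof -
    have "\<forall>\<^sub>F N in sequentially. \<forall>p\<in>P. real (card (B \<inter> {1..N div p})) \<le> \<epsilon> * real (N div p)"
    proof (subst eventually_ball_finite_distrib[OF fin], rule ballI)
      fix p assume p: "p \<in> P"
      have "filterlim (\<lambda>N. N div p) sequentially sequentially" by (rule filterlim_div[OF p1[OF p]])
      then show "\<forall>\<^sub>F N in sequentially. real (card (B \<inter> {1..N div p})) \<le> \<epsilon> * real (N div p)"
        using dens unfolding filterlim_iff by fast
    qed
    then show ?thesis
    proof eventually_elim
      case (elim N)
      have "X N \<le> (\<Sum>p\<in>P. \<epsilon> * real N * (1 / real p) + real N * (1 / (real p)\<^sup>2))"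
        unfolding X_def
      proof (rule sum_mono)
        fix p assume p: "p \<in> P"
        have eq: "{m\<in>{1..N div p}. m \<in> B \<or> p dvd m} = (B \<inter> {1..N div p}) \<union> {m\<in>{1..N div p}. p dvd m}" by auto
        have "real (card {m\<in>{1..N div p}. m \<in> B \<or> p dvd m})
          \<le> real (card (B \<inter> {1..N div p})) + real (card {m\<in>{1..N div p}. p dvd m})"
          unfolding eq of_nat_add[symmetric] of_nat_le_iff by (rule card_Un_le)
        also have "\<dots> \<le> \<epsilon> * real (N div p) + real (N div p) / real p"
          using elim p card_multiples[OF p1[OF p]] by (intro add_mono) auto
        also have "\<dots> \<le> \<epsilon> * (real N / real p) + (real N / real p) / real p"
          using \<epsilon> real_div_le[of N p] by (intro add_mono mult_left_mono divide_right_mono) auto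
        finally show "real (card {m\<in>{1..N div p}. m \<in> B \<or> p dvd m})
          \<le> \<epsilon> * real N * (1 / real p) + real N * (1 / (real p)\<^sup>2)" by (simp add: power2_eq_square)
      qed
      also have "\<dots> = \<epsilon> * real N * L + real N * (\<Sum>p\<in>P. 1 / (real p)\<^sup>2)"
        by (simp add: sum.distrib sum_distrib_left L_def recip_sum_def)
      also have "\<dots> \<le> \<epsilon> * real N * L + real N * 2"
        using p1 by (intro add_left_mono mult_left_mono sum_inverse_squares_le_finite[OF fin]) force+
      finally show ?case by (simp add: algebra_simps)
    qed
  qed
  have "\<forall>\<^sub>F N in sequentially. norm ((\<integral>x. (\<Sum>n\<in>E \<inter> {1..N}. v n x)\<^sup>2 \<partial>M) / (real N)\<^sup>2 - 0) < r"
    using evR evX eventually_gt_at_top[of 0] eventually_ge_at_top[of "2 * card P"]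
  proof eventually_elim
    case (elim N)
    let ?I = "\<integral>x. (\<Sum>n\<in>E \<inter> {1..N}. v n x)\<^sup>2 \<partial>M"
    have N: "real N > 0" using elim by simp
    have P: "2 * real (card P) \<le> real N" using elim by linarith
    have RN: "R N \<le> r / 12 * real N" using elim(1) N by (simp add: abs_less_iff field_simps)
    have "L\<^sup>2 * ?I \<le> 3 * ((real N * L + 2 * L * real (card P)) * (real N * V) + X N * (real N * L * V)
       + real N * (real N * L * V + R N))" by (rule main)
    also have "\<dots> \<le> 3 * ((real N * L + L * real N) * (real N * V) + ((\<epsilon> * L + 2) * real N) * (real N * L * V)
       + real N * (real N * L * V + r / 12 * real N))"
      using P elim(2) RN L1 V0 N
      by (intro mult_left_mono add_mono mult_right_mono order_refl) (auto simp: mult.commute mult.left_commute)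
    also have "\<dots> = (real N)\<^sup>2 * (15 * L * V + 3 * \<epsilon> * L\<^sup>2 * V + r / 4)"
      by (simp add: power2_eq_square algebra_simps)
    also have "\<dots> \<le> (real N)\<^sup>2 * (r / 4 * L\<^sup>2 + r / 4 * L\<^sup>2 + r / 4 * L\<^sup>2)"
    proof (intro mult_left_mono add_mono)
      have "60 * V \<le> r * L" using L1(2) r V0 by (simp add: field_simps)
      then have "15 * V * L \<le> r / 4 * L * L" using L1 by (intro mult_right_mono) auto
      then show "15 * L * V \<le> r / 4 * L\<^sup>2" by (simp add: power2_eq_square mult_ac)
      have "3 * \<epsilon> * V \<le> r / 4" using V0 r by (simp add: \<epsilon>_def field_simps)
      then have "3 * \<epsilon> * V * L\<^sup>2 \<le> r / 4 * L\<^sup>2" by (rule mult_right_mono) simp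
      then show "3 * \<epsilon> * L\<^sup>2 * V \<le> r / 4 * L\<^sup>2" by (simp add: mult_ac)
      have "1 \<le> L\<^sup>2" using L1 by (simp add: one_le_power)
      then show "r / 4 \<le> r / 4 * L\<^sup>2" using r by simp
    qed simp
    also have "\<dots> = L\<^sup>2 * ((real N)\<^sup>2 * (3 * r / 4))" by (simp add: algebra_simps)
    finally have "?I \<le> (real N)\<^sup>2 * (3 * r / 4)" using L1 by (simp add: mult_le_cancel_left_pos)
    then have "?I / (real N)\<^sup>2 \<le> 3 * r / 4" using N by (simp add: field_simps)
    moreover have "0 \<le> ?I / (real N)\<^sup>2" by simp
    ultimately show ?case using r unfolding diff_0_right real_norm_def by linarith
  qed
  then show "\<exists>no. \<forall>N\<ge>no. norm ((\<integral>x. (\<Sum>n\<in>E \<inter> {1..N}. v n x)\<^sup>2 \<partial>M) / (real N)\<^sup>2 - 0) < r"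
    by (simp add: eventually_sequentially)
qed

section \<open>Ratios of prime numbers\<close>

lemma square_times_primes:
  "n \<ge> 1 \<Longrightarrow> \<exists>k S. k \<ge> 1 \<and> finite S \<and> (\<forall>p\<in>S. prime p \<and> p dvd n) \<and> n = k\<^sup>2 * \<Prod>S" for n :: nat
proof (induction n rule: less_induct)
  case (less n)
  show ?case
  proof (cases "n = 1")
    case True
    then show ?thesis by (intro exI[of _ 1] exI[of _ "{}"]) auto
  next
    case False
    then obtain p where p: "prime p" "p dvd n" using prime_factor_nat by blast
    then obtain m where m: "n = p * m" by blast
    then have "m \<ge> 1" "m < n" using less.prems p prime_gt_1_nat[of p] by auto
    then obtain k S where k: "k \<ge> 1" "finite S" "\<forall>q\<in>S. prime q \<and> q dvd m" "m = k\<^sup>2 * \<Prod>S"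
      using less.IH[of m] by auto
    show ?thesis
    proof (cases "p \<in> S")
      case True
      then have "\<Prod>S = p * \<Prod>(S - {p})" using k by (simp add: prod.remove)
      then have "n = (p * k)\<^sup>2 * \<Prod>(S - {p})" using m k by (simp add: power2_eq_square algebra_simps)
      then show ?thesis using k p m prime_gt_0_nat[of p]
        by (intro exI[of _ "p * k"] exI[of _ "S - {p}"]) (auto simp: Suc_le_eq)
    next
      case False
      then have "n = k\<^sup>2 * \<Prod>(insert p S)" using m k by simp
      then show ?thesis using k p m by (intro exI[of _ k] exI[of _ "insert p S"]) auto
    qed
  qed
qed

text \<open>
  Every \<open>n \<le> N\<close> is a square times a product of distinct primes up to \<open>N\<close>. So the harmonic sum is at most
  the sum of the inverse squares times \<open>\<Prod>(1 + 1 / p)\<close>, and \<open>1 + x \<le> exp x\<close>.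
\<close>

lemma sum_recip_primes_ge:
  assumes N: "N \<ge> 2"
  shows "ln (ln (real N)) - ln 2 \<le> (\<Sum>p | prime p \<and> p \<le> N. 1 / real p)"
proof -
  let ?P = "{p. prime p \<and> p \<le> N}"
  have fin: "finite ?P" by simp
  let ?f = "\<lambda>(k, S). k\<^sup>2 * \<Prod>S :: nat"
  let ?A = "{1..N} \<times> Pow ?P"
  have finA: "finite ?A" by simp
  have sub: "{1..N} \<subseteq> ?f ` ?A"
  proof
    fix n assume n: "n \<in> {1..N}"
    then obtain k S where k: "k \<ge> 1" "finite S" "\<forall>p\<in>S. prime p \<and> p dvd n" "n = k\<^sup>2 * \<Prod>S"
      using square_times_primes[of n] by auto
    have nN: "n > 0" "n \<le> N" using n by simp_all
    have "k dvd n" using k(4) by (simp add: power2_eq_square)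
    then have "k \<le> n" using nN by (intro dvd_imp_le)
    then have kA: "k \<in> {1..N}" using nN k(1) by simp
    have "S \<subseteq> ?P"
    proof
      fix p assume "p \<in> S"
      then have "prime p" "p dvd n" using k(3) by blast+
      then have "p \<le> n" using nN by (intro dvd_imp_le)
      with \<open>prime p\<close> nN show "p \<in> ?P" by simp
    qed
    then have "S \<in> Pow ?P" by (rule PowI)
    with kA have "(k, S) \<in> ?A" by (rule SigmaI)
    moreover have "n = ?f (k, S)" using k(4) by simp
    ultimately show "n \<in> ?f ` ?A" by (rule rev_image_eqI)
  qed
  have "ln (real N) \<le> ln (real N + 1)" using N by simp
  also have "\<dots> \<le> harm N" by (rule ln_le_harm)
  also have "harm N = (\<Sum>n=1..N. 1 / real n)" by (simp add: harm_def inverse_eq_divide)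
  also have "\<dots> \<le> (\<Sum>n\<in>?f ` ?A. 1 / real n)" using finA sub by (intro sum_mono2) auto
  also have "\<dots> \<le> (\<Sum>x\<in>?A. 1 / real (?f x))"
    using sum_image_le[OF finA, of "\<lambda>n. 1 / real n" ?f] by (simp add: comp_def)
  also have "\<dots> = (\<Sum>k=1..N. \<Sum>S\<in>Pow ?P. 1 / (real k)\<^sup>2 * (\<Prod>p\<in>S. 1 / real p))"
    by (simp add: sum.cartesian_product case_prod_unfold prod_dividef)
  also have "\<dots> = (\<Sum>k=1..N. 1 / (real k)\<^sup>2) * (\<Sum>S\<in>Pow ?P. \<Prod>p\<in>S. 1 / real p)"
    by (simp only: sum_product)
  also have "\<dots> \<le> 2 * (\<Sum>S\<in>Pow ?P. \<Prod>p\<in>S. 1 / real p)"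
    by (intro mult_right_mono sum_inverse_squares_le sum_nonneg prod_nonneg) auto
  also have "(\<Sum>S\<in>Pow ?P. \<Prod>p\<in>S. 1 / real p) = (\<Prod>p\<in>?P. 1 / real p + 1)"
    by (subst prod_add[OF fin]) simp
  also have "2 * \<dots> \<le> 2 * (\<Prod>p\<in>?P. exp (1 / real p))"
    by (intro mult_left_mono prod_mono) (auto simp: add.commute intro: exp_ge_add_one_self)
  also have "\<dots> = 2 * exp (\<Sum>p\<in>?P. 1 / real p)" by (simp add: exp_sum fin)
  finally have "ln (ln (real N)) \<le> ln (2 * exp (\<Sum>p\<in>?P. 1 / real p))"
    using N by (subst ln_le_cancel_iff) auto
  then show ?thesis by (simp add: ln_mult)
qed

lemma primes_not_thin: "\<not> thin {p. prime p}"
proof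
  assume "thin {p. prime p}"
  then obtain C where C: "\<And>F. finite F \<Longrightarrow> F \<subseteq> {p. prime p} \<Longrightarrow> (\<Sum>p\<in>F. 1 / real p) \<le> C"
    by (rule thin_imp_bounded) blast
  have "filterlim (\<lambda>N. ln (ln (real N)) - ln 2) at_top sequentially" by real_asymp
  then have "\<forall>\<^sub>F N in sequentially. C < ln (ln (real N)) - ln 2" by (simp add: filterlim_at_top_dense)
  then have "\<forall>\<^sub>F N in sequentially. False" using eventually_ge_at_top[of 2]
  proof eventually_elim
    case (elim N)
    have "(\<Sum>p | prime p \<and> p \<le> N. 1 / real p) \<le> C" by (rule C) auto
    then show ?case using elim sum_recip_primes_ge[of N] by linarith
  qed
  then show False by simp
qed

text \<open>
  Chebyshev's argument: the primes in \<open>{y<..y + h}\<close> divide the binomial coefficient \<open>(y + h) choose h\<close>,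
  as they divide the factorial of \<open>y + h\<close> and exceed both \<open>y\<close> and \<open>h\<close>.
\<close>

lemma card_primes_interval:
  assumes h: "1 \<le> h" "h \<le> y"
  shows "real (card {p. prime p \<and> y < p \<and> p \<le> y + h}) * ln (real y) \<le> real h * (1 + ln (1 + real y / real h))"
proof -
  let ?P = "{p. prime p \<and> y < p \<and> p \<le> y + h}"
  have fin: "finite ?P" by (rule finite_subset[of _ "{..y + h}"]) auto
  have dvd: "p dvd ((y + h) choose h)" if p: "p \<in> ?P" for p
  proof -
    have "p dvd fact (y + h)" using p by (simp add: prime_dvd_fact_iff)
    also have "fact (y + h) = fact h * fact y * ((y + h) choose h)"
      using binomial_fact_lemma[of h "y + h"] by simp
    finally show ?thesis using p h by (simp add: prime_dvd_mult_iff prime_dvd_fact_iff)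
  qed
  have "\<Prod>S dvd ((y + h) choose h)" if "S \<subseteq> ?P" for S
    using finite_subset[OF that fin] that
  proof (induction S rule: finite_induct)
    case (insert p S)
    have "coprime p (\<Prod>S)"
      using insert by (intro prod_coprime_right) (auto intro!: primes_coprime)
    then show ?case using insert dvd[of p] by (auto intro!: divides_mult)
  qed simp
  from this[OF subset_refl] have le: "\<Prod>?P \<le> ((y + h) choose h)"
    by (rule dvd_imp_le) simp
  have "y ^ card ?P = (\<Prod>p\<in>?P. y)" by simp
  also have "\<dots> \<le> \<Prod>?P" by (rule prod_mono) auto
  finally have "y ^ card ?P * fact h \<le> (y + h) ^ h"
    using le binomial_fact_pow[of "y + h" h] by (meson le_trans mult_le_mono1)
  then have "real (y ^ card ?P * fact h) \<le> real ((y + h) ^ h)" by (rule of_nat_mono)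
  then have 1: "real y ^ card ?P * fact h \<le> (real y + real h) ^ h" by simp
  have "real h ^ h / fact h \<le> exp (real h)"
  proof -
    have "(\<lambda>n. real h ^ n /\<^sub>R fact n) sums exp (real h)" by (rule exp_converges)
    then have "sum (\<lambda>n. real h ^ n /\<^sub>R fact n) {h} \<le> exp (real h)"
      using sum_le_suminf[of "\<lambda>n. real h ^ n /\<^sub>R fact n" "{h}"] by (simp add: sums_iff)
    then show ?thesis by (simp add: field_simps)
  qed
  then have 2: "real h ^ h \<le> exp (real h) * fact h" by (simp add: field_simps)
  have "real y ^ card ?P * fact h * real h ^ h \<le> (real y + real h) ^ h * (exp (real h) * fact h)"
    by (rule mult_mono[OF 1 2]) auto
  then have "real y ^ card ?P * real h ^ h \<le> (real y + real h) ^ h * exp (real h)"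
    by (simp add: mult.assoc mult.left_commute[of _ "fact h"] mult_le_cancel_left_pos mult.commute[of "fact h"])
  then have "ln (real y ^ card ?P * real h ^ h) \<le> ln ((real y + real h) ^ h * exp (real h))"
    using h by (subst ln_le_cancel_iff) (auto intro!: mult_pos_pos add_pos_pos)
  then have "real (card ?P) * ln (real y) + real h * ln (real h) \<le> real h * ln (real y + real h) + real h"
    using h by (simp add: ln_mult ln_realpow)
  moreover have eq: "ln (1 + real y / real h) = ln (real y + real h) - ln (real h)"
  proof -
    have "1 + real y / real h = (real y + real h) / real h" using h by (simp add: field_simps)
    then show ?thesis using h ln_div[of "real y + real h" "real h"] by simp
  qed
  ultimately show ?thesis unfolding eq by (simp add: algebra_simps)
qed

text \<open>
  The number of primes is bounded by \<open>p / ln p\<close> times a factor that tends to \<open>0\<close> with the relative length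
  \<open>\<kappa>\<close> of the interval. This factor exceeds the expected \<open>\<kappa>\<close> by a logarithm, which is harmless as \<open>\<kappa>\<close> tends
  to \<open>0\<close>.
\<close>

lemma card_primes_cluster:
  assumes k: "0 < \<kappa>" "\<kappa> \<le> 1/2" and p: "real p \<ge> 1 / \<kappa>"
  shows "real (card {q. prime q \<and> p \<le> q \<and> real q \<le> (1 + \<kappa>) * real p})
    \<le> 1 + 2 * \<kappa> * (1 + ln (1 + 1 / \<kappa>)) * real p / ln (real p)"
proof -
  let ?P = "{q. prime q \<and> p \<le> q \<and> real q \<le> (1 + \<kappa>) * real p}"
  define h where "h = nat \<lceil>\<kappa> * real p\<rceil>"
  have "1 / \<kappa> \<ge> 2" using k by (simp add: field_simps)
  then have p2: "real p \<ge> 2" using p by linarith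
  have kp: "1 \<le> \<kappa> * real p" using p k by (simp add: field_simps)
  then have "0 < \<kappa> * real p" by linarith
  then have h_ge: "\<kappa> * real p \<le> real h" and "real h < \<kappa> * real p + 1" unfolding h_def by linarith+
  then have h_le: "real h \<le> 2 * \<kappa> * real p" using kp by linarith
  have h1: "1 \<le> h" using h_ge kp by linarith
  have "2 * \<kappa> * real p \<le> 1 * real p" using k by (intro mult_right_mono) auto
  then have hp: "h \<le> p" using h_le by linarith
  let ?Q = "{q. prime q \<and> p < q \<and> q \<le> p + h}"
  have finQ: "finite ?Q" by (rule finite_subset[of _ "{..p + h}"]) auto
  have "?P \<subseteq> insert p ?Q"
  proof
    fix q assume q: "q \<in> ?P"
    then have "real q \<le> real p + \<kappa> * real p" by (simp add: algebra_simps)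
    then have "q \<le> p + h" using h_ge by linarith
    then show "q \<in> insert p ?Q" using q by auto
  qed
  then have "card ?P \<le> card (insert p ?Q)" using finQ by (intro card_mono) auto
  also have "\<dots> \<le> Suc (card ?Q)" by (rule card_insert_le_m1) (use finQ in auto)
  finally have "real (card ?P) \<le> 1 + real (card ?Q)" by linarith
  moreover have "real (card ?Q) \<le> 2 * \<kappa> * (1 + ln (1 + 1 / \<kappa>)) * real p / ln (real p)"
  proof -
    have lnp: "ln (real p) > 0" using p2 by simp
    have "real p / real h \<le> 1 / \<kappa>" using h_ge h1 k by (simp add: field_simps)
    then have "ln (1 + real p / real h) \<le> ln (1 + 1 / \<kappa>)"
      using k p2 h1 by (subst ln_le_cancel_iff) (auto intro!: add_pos_pos)
    moreover have "0 \<le> ln (1 + real p / real h)" by (rule ln_ge_zero) simp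
    ultimately have "real h * (1 + ln (1 + real p / real h)) \<le> 2 * \<kappa> * real p * (1 + ln (1 + 1 / \<kappa>))"
      using h_le k by (intro mult_mono) auto
    then have "real (card ?Q) * ln (real p) \<le> 2 * \<kappa> * (1 + ln (1 + 1 / \<kappa>)) * real p"
      using card_primes_interval[OF h1 hp] by (simp add: mult_ac)
    then show ?thesis using lnp by (simp add: pos_le_divide_eq)
  qed
  ultimately show ?thesis by linarith
qed

lemma sum_Un_le:
  fixes f :: "'b \<Rightarrow> real"
  assumes "finite S" "finite T" "\<And>x. 0 \<le> f x"
  shows "sum f (S \<union> T) \<le> sum f S + sum f T"
  using sum.union_inter[OF assms(1,2), of f] sum_nonneg[of "S \<inter> T" f] assms(3) by simp

lemma sum_UN_le:
  fixes f :: "'b \<Rightarrow> real"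
  assumes "finite I" "\<And>i. i \<in> I \<Longrightarrow> finite (A i)" "\<And>x. 0 \<le> f x"
  shows "sum f (\<Union>i\<in>I. A i) \<le> (\<Sum>i\<in>I. sum f (A i))"
  using assms(1,2)
proof (induction I rule: finite_induct)
  case (insert i I)
  have "sum f (A i \<union> (\<Union>i\<in>I. A i)) \<le> sum f (A i) + sum f (\<Union>i\<in>I. A i)"
    by (rule sum_Un_le) (use insert assms(3) in auto)
  then show ?case using insert by simp
qed simp

text \<open>
  If the assertion failed, then in every interval of ratio \<open>1 + \<kappa>\<close> the primes outside \<open>Z\<close> would lie in a
  cluster of ratio \<open>1 + \<kappa>'\<close>. A bounded number of such intervals covers \<open>{2 ^ j..<2 ^ Suc j}\<close>, and each
  cluster contains few primes. This contradicts the divergence rate of the sum of \<open>1 / p\<close>.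
\<close>

lemma prime_ratio:
  assumes k: "0 < \<kappa>"
  shows "\<exists>\<kappa>'>0. \<kappa>' < \<kappa> \<and> (\<forall>Z. thin Z \<longrightarrow> (\<exists>p q. prime p \<and> prime q \<and> p \<notin> Z \<and> q \<notin> Z \<and>
       (1 + \<kappa>') * real p \<le> real q \<and> real q \<le> (1 + \<kappa>) * real p))"
proof -
  obtain K where K: "2 < (1 + \<kappa>) ^ K" using real_arch_pow[of "1 + \<kappa>" 2] k by auto
  \<comment> \<open>\<open>K\<close> intervals of ratio \<open>1 + \<kappa>\<close> cover a dyadic one, and \<open>t\<close> will be \<open>\<kappa>'\<close>. The bound on \<open>?\<beta> t\<close> makes the
    reciprocals in \<open>G j\<close> add up to little more than \<open>1 / (2 * j)\<close>, so that the sum over all \<open>j \<le> J\<close> grows only like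
    \<open>ln J / 2\<close>.\<close>
  let ?\<beta> = "\<lambda>t :: real. 2 * t * (1 + ln (1 + 1 / t))"
  have "(?\<beta> \<longlongrightarrow> 0) (at_right 0)" by real_asymp
  then have "\<forall>\<^sub>F t in at_right 0. ?\<beta> t < ln 2 / (4 * (real K + 1))"
    by (rule order_tendstoD) simp
  moreover have "\<forall>\<^sub>F t :: real in at_right 0. t < min \<kappa> (1/2)"
    using k eventually_at_right_real[of 0 "min \<kappa> (1/2)"] by (auto elim: eventually_mono)
  moreover have "\<forall>\<^sub>F t :: real in at_right 0. t > 0" by (rule eventually_at_right_less)
  ultimately have "\<forall>\<^sub>F t in at_right 0. ?\<beta> t < ln 2 / (4 * (real K + 1)) \<and> t < min \<kappa> (1/2) \<and> t > 0"
    by eventually_elim simp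
  then obtain t where t: "?\<beta> t < ln 2 / (4 * (real K + 1))" "t < \<kappa>" "t < 1/2" "t > 0"
    using eventually_happens trivial_limit_at_right_real by fastforce
  have "\<exists>p q. prime p \<and> prime q \<and> p \<notin> Z \<and> q \<notin> Z \<and>
       (1 + t) * real p \<le> real q \<and> real q \<le> (1 + \<kappa>) * real p" if Z: "thin Z" for Z
  proof (rule ccontr)
    assume no: "\<not> ?thesis"
    have no': "real q < (1 + t) * real p"
      if "prime p" "prime q" "p \<notin> Z" "q \<notin> Z" "real q \<le> (1 + \<kappa>) * real p" for p q
      using no that by (meson not_le)
    obtain C where C: "\<And>F. finite F \<Longrightarrow> F \<subseteq> Z \<Longrightarrow> (\<Sum>p\<in>F. 1 / real p) \<le> C"
      using thin_imp_bounded[OF Z] by blast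
    define G where "G j = {p. prime p \<and> p \<notin> Z \<and> 2 ^ j \<le> p \<and> p < 2 ^ Suc j}" for j
    have finG: "finite (G j)" for j by (rule finite_subset[of _ "{..<2 ^ Suc j}"]) (auto simp: G_def)
    obtain J0 where J0: "1 / t < 2 ^ J0" using real_arch_pow[of 2 "1 / t"] by auto
    have Gsum: "(\<Sum>p\<in>G j. 1 / real p) \<le> real K / 2 ^ j + 1/2 * (1 / real j)" if j: "j \<ge> J0" "j \<ge> 1" for j
    proof -
      define W where "W i = {p \<in> G j. 2 ^ j * (1 + \<kappa>) ^ i \<le> real p \<and> real p < 2 ^ j * (1 + \<kappa>) ^ Suc i}" for i
      have lnj: "0 < real j * ln 2" using j by simp
      have cover: "G j \<subseteq> (\<Union>i<K. W i)"
      proof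
        fix p assume p: "p \<in> G j"
        define i where "i = (LEAST i. real p < 2 ^ j * (1 + \<kappa>) ^ Suc i)"
        have "real p < 2 * 2 ^ j" using p unfolding G_def
          by (metis (mono_tags, lifting) mem_Collect_eq of_nat_less_iff of_nat_numeral of_nat_power power_Suc)
        also have "\<dots> \<le> 2 ^ j * (1 + \<kappa>) ^ K" using K by simp
        finally have lt: "real p < 2 ^ j * (1 + \<kappa>) ^ K" .
        have pj: "2 ^ j \<le> real p" using p unfolding G_def
          by (metis (mono_tags, lifting) mem_Collect_eq of_nat_le_iff of_nat_numeral of_nat_power)
        have "K \<noteq> 0" using lt pj by (intro notI) simp
        then obtain K' where K': "K = Suc K'" by (cases K) auto
        have i1: "real p < 2 ^ j * (1 + \<kappa>) ^ Suc i" unfolding i_def by (rule LeastI[of _ K']) (use lt K' in simp)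
        have i2: "i \<le> K'" unfolding i_def by (rule Least_le) (use lt K' in simp)
        have "2 ^ j * (1 + \<kappa>) ^ i \<le> real p"
        proof (cases i)
          case (Suc i')
          have "\<not> real p < 2 ^ j * (1 + \<kappa>) ^ Suc i'"
            by (rule not_less_Least) (use Suc in \<open>simp add: i_def\<close>)
          then show ?thesis using Suc by simp
        qed (use pj in simp)
        then show "p \<in> (\<Union>i<K. W i)" using i1 i2 p K' by (auto simp: W_def intro!: bexI[of _ i])
      qed
      have Wsum: "(\<Sum>p\<in>W i. 1 / real p) \<le> 1 / 2 ^ j + ?\<beta> t * 2 / (real j * ln 2)" for i
      proof (cases "W i = {}")
        case True
        then show ?thesis using t lnj by (auto intro!: add_nonneg_nonneg divide_nonneg_nonneg mult_nonneg_nonneg)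
      next
        case False
        have finW: "finite (W i)" using finG by (simp add: W_def)
        define p where "p = Min (W i)"
        have pW: "p \<in> W i" unfolding p_def using finW False by (rule Min_in)
        then have p: "prime p" "p \<notin> Z" "2 ^ j \<le> p" "p < 2 ^ Suc j" by (auto simp: W_def G_def)
        have pj: "2 ^ j \<le> real p" using p(3) by (metis of_nat_le_iff of_nat_numeral of_nat_power)
        have pj': "real p \<le> 2 * 2 ^ j" using p(4) by (metis less_imp_le of_nat_less_iff of_nat_numeral of_nat_power power_Suc)
        have "(2::real) ^ J0 \<le> 2 ^ j" using j by (intro power_increasing) auto
        then have pt: "1 / t \<le> real p" using J0 pj by linarith
        have "W i \<subseteq> {q. prime q \<and> p \<le> q \<and> real q \<le> (1 + t) * real p}"
        proof
          fix q assume q: "q \<in> W i"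
          then have q': "prime q" "q \<notin> Z" by (auto simp: W_def G_def)
          have "real q \<le> (1 + \<kappa>) * (2 ^ j * (1 + \<kappa>) ^ i)"
            using q by (simp add: W_def mult.left_commute)
          also have "\<dots> \<le> (1 + \<kappa>) * real p" using pW k by (intro mult_left_mono) (auto simp: W_def)
          finally have "real q < (1 + t) * real p" using no' p q' by blast
          moreover have "p \<le> q" unfolding p_def using finW q by simp
          ultimately show "q \<in> {q. prime q \<and> p \<le> q \<and> real q \<le> (1 + t) * real p}" using q' by simp
        qed
        then have "card (W i) \<le> card {q. prime q \<and> p \<le> q \<and> real q \<le> (1 + t) * real p}"
        proof (rule card_mono[rotated])
          show "finite {q. prime q \<and> p \<le> q \<and> real q \<le> (1 + t) * real p}"
            by (rule finite_subset[of _ "{..nat \<lfloor>(1 + t) * real p\<rfloor>}"]) (auto simp: le_nat_floor)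
        qed
        then have "real (card (W i)) \<le> 1 + ?\<beta> t * real p / ln (real p)"
          using card_primes_cluster[of t p] t pt by linarith
        also have "?\<beta> t * real p / ln (real p) \<le> ?\<beta> t * (2 * 2 ^ j) / (real j * ln 2)"
        proof (rule frac_le)
          have "real j * ln 2 = ln (2 ^ j)" by (simp add: ln_realpow)
          also have "\<dots> \<le> ln (real p)" using pj by (intro ln_mono) simp_all
          finally show "real j * ln 2 \<le> ln (real p)" .
          show "?\<beta> t * real p \<le> ?\<beta> t * (2 * 2 ^ j)" using t pj' by (intro mult_left_mono) auto
        qed (use t lnj in auto)
        finally have cW: "real (card (W i)) \<le> 1 + ?\<beta> t * (2 * 2 ^ j) / (real j * ln 2)" by simp
        have "(\<Sum>q\<in>W i. 1 / real q) \<le> (\<Sum>q\<in>W i. 1 / 2 ^ j)"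
        proof (rule sum_mono)
          fix q assume "q \<in> W i"
          then have "2 ^ j \<le> q" by (simp add: W_def G_def)
          then have "2 ^ j \<le> real q" by (metis of_nat_le_iff of_nat_numeral of_nat_power)
          then show "1 / real q \<le> 1 / 2 ^ j" by (intro frac_le) simp_all
        qed
        also have "\<dots> = real (card (W i)) / 2 ^ j" by simp
        also have "\<dots> \<le> (1 + ?\<beta> t * (2 * 2 ^ j) / (real j * ln 2)) / 2 ^ j"
          by (rule divide_right_mono[OF cW]) simp
        also have "\<dots> = 1 / 2 ^ j + ?\<beta> t * 2 / (real j * ln 2)" by (simp add: field_simps)
        finally show ?thesis .
      qed
      have "(\<Sum>p\<in>G j. 1 / real p) \<le> (\<Sum>p\<in>(\<Union>i<K. W i). 1 / real p)"
        using cover finG by (intro sum_mono2) (auto simp: W_def)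
      also have "\<dots> = (\<Sum>i<K. \<Sum>p\<in>W i. 1 / real p)"
      proof (rule sum.UNION_disjoint)
        have "W i \<inter> W l = {}" if "i < l" for i l
        proof -
          have "(1 + \<kappa>) ^ Suc i \<le> (1 + \<kappa>) ^ l" using that k by (intro power_increasing) auto
          then have "2 ^ j * (1 + \<kappa>) ^ Suc i \<le> 2 ^ j * (1 + \<kappa>) ^ l" by simp
          then have "x \<notin> W l" if "x \<in> W i" for x
            using that unfolding W_def mem_Collect_eq by linarith
          then show ?thesis by blast
        qed
        then have "W i \<inter> W l = {}" if "i \<noteq> l" for i l
          using that by (cases i l rule: linorder_cases) (auto simp: Int_commute)
        then show "\<forall>i\<in>{..<K}. \<forall>l\<in>{..<K}. i \<noteq> l \<longrightarrow> W i \<inter> W l = {}" by simp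
      qed (use finG in \<open>auto simp: W_def\<close>)
      also have "\<dots> \<le> (\<Sum>i<K. 1 / 2 ^ j + ?\<beta> t * 2 / (real j * ln 2))" by (rule sum_mono) (rule Wsum)
      also have "\<dots> = real K / 2 ^ j + (real K * ?\<beta> t * 2 / ln 2) * (1 / real j)"
        by (simp add: field_simps)
      also have "(real K * ?\<beta> t * 2 / ln 2) * (1 / real j) \<le> 1/2 * (1 / real j)"
      proof (rule mult_right_mono)
        have b0: "0 \<le> ?\<beta> t" using t by (intro mult_nonneg_nonneg) auto
        have "real K * ?\<beta> t \<le> (real K + 1) * (ln 2 / (4 * (real K + 1)))"
          using t b0 by (intro mult_mono) auto
        also have "\<dots> = ln 2 / 4" by (simp add: field_simps)
        finally show "real K * ?\<beta> t * 2 / ln 2 \<le> 1/2" by (simp add: field_simps)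
      qed simp
      finally show ?thesis by simp
    qed
    define J1 where "J1 = Suc J0"
    define D where "D = (\<Sum>p | prime p \<and> p \<le> 2 ^ J1. 1 / real p)"
    have bound: "(\<Sum>p | prime p \<and> p \<le> 2 ^ J. 1 / real p) \<le> C + D + 2 * real K + 1/2 * harm J + 1/2" for J
    proof -
      let ?A = "{p :: nat. prime p \<and> p \<le> 2 ^ J}"
      have finA: "finite ?A" by simp
      have "?A \<subseteq> (?A \<inter> Z) \<union> {p. prime p \<and> p \<le> 2 ^ J1} \<union> (\<Union>j\<in>{J1..J}. G j)"
      proof
        fix p assume p: "p \<in> ?A"
        show "p \<in> (?A \<inter> Z) \<union> {p. prime p \<and> p \<le> 2 ^ J1} \<union> (\<Union>j\<in>{J1..J}. G j)"
        proof (cases "p \<in> Z \<or> p \<le> 2 ^ J1")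
          case False
          have "p \<ge> 1" using p prime_ge_1_nat by blast
          then obtain j where j: "2 ^ j \<le> p" "p < 2 ^ Suc j" using ex_power_ivl1[of 2 p] by auto
          have "(2::nat) ^ J1 < 2 ^ Suc j" using False j by linarith
          then have J1j: "J1 < Suc j" using power_less_imp_less_exp[of "2::nat" J1 "Suc j"] by simp
          have "p \<le> 2 ^ J" using p by simp
          with j(1) have "(2::nat) ^ j \<le> 2 ^ J" by (rule le_trans)
          then have "j \<le> J" using power_le_imp_le_exp[of "2::nat" j J] by simp
          then have "j \<in> {J1..J}" using J1j by simp
          moreover have "p \<in> G j" using j p False by (simp add: G_def)
          ultimately show ?thesis by blast
        qed (use p in auto)
      qed
      then have "(\<Sum>p\<in>?A. 1 / real p) \<le> (\<Sum>p\<in>(?A \<inter> Z) \<union> {p. prime p \<and> p \<le> 2 ^ J1} \<union> (\<Union>j\<in>{J1..J}. G j). 1 / real p)"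
        using finA finG by (intro sum_mono2) auto
      also have "\<dots> \<le> (\<Sum>p\<in>?A \<inter> Z. 1 / real p) + D + (\<Sum>p\<in>(\<Union>j\<in>{J1..J}. G j). 1 / real p)"
      proof -
        have "(\<Sum>p\<in>(?A \<inter> Z) \<union> {p. prime p \<and> p \<le> 2 ^ J1} \<union> (\<Union>j\<in>{J1..J}. G j). 1 / real p)
          \<le> (\<Sum>p\<in>(?A \<inter> Z) \<union> {p. prime p \<and> p \<le> 2 ^ J1}. 1 / real p) + (\<Sum>p\<in>(\<Union>j\<in>{J1..J}. G j). 1 / real p)"
          by (rule sum_Un_le) (use finA finG in auto)
        also have "(\<Sum>p\<in>(?A \<inter> Z) \<union> {p. prime p \<and> p \<le> 2 ^ J1}. 1 / real p)
          \<le> (\<Sum>p\<in>?A \<inter> Z. 1 / real p) + D"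
          unfolding D_def by (rule sum_Un_le) (use finA in auto)
        finally show ?thesis by simp
      qed
      also have "(\<Sum>p\<in>?A \<inter> Z. 1 / real p) \<le> C" by (rule C) (use finA in auto)
      also have "(\<Sum>p\<in>(\<Union>j\<in>{J1..J}. G j). 1 / real p) \<le> (\<Sum>j\<in>{J1..J}. \<Sum>p\<in>G j. 1 / real p)"
        by (rule sum_UN_le) (use finG in auto)
      also have "\<dots> \<le> (\<Sum>j\<in>{J1..J}. real K / 2 ^ j + 1/2 * (1 / real j))"
        by (intro sum_mono Gsum) (auto simp: J1_def)
      also have "\<dots> = real K * (\<Sum>j\<in>{J1..J}. (1/2) ^ j) + 1/2 * (\<Sum>j\<in>{J1..J}. 1 / real j)"
        by (simp add: sum.distrib sum_distrib_left power_one_over)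
      finally have total: "(\<Sum>p\<in>?A. 1 / real p)
        \<le> C + D + (real K * (\<Sum>j\<in>{J1..J}. (1/2) ^ j) + 1/2 * (\<Sum>j\<in>{J1..J}. 1 / real j))" by simp
      have "(\<Sum>j\<in>{J1..J}. (1/2) ^ j) \<le> (\<Sum>j. (1/2 :: real) ^ j)"
        by (rule sum_le_suminf) auto
      then have "(\<Sum>j\<in>{J1..J}. (1/2) ^ j) \<le> (2 :: real)" by (simp add: suminf_geometric)
      then have "real K * (\<Sum>j\<in>{J1..J}. (1/2) ^ j) \<le> real K * 2" by (rule mult_left_mono) simp
      moreover have "(\<Sum>j\<in>{J1..J}. 1 / real j) \<le> harm J"
        unfolding harm_def inverse_eq_divide by (rule sum_mono2) (auto simp: J1_def)
      ultimately show ?thesis using total by linarith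
    qed
    have "filterlim (\<lambda>J. ln (real J) / 2 + ln (ln 2) - ln 2 - (C + D + 2 * real K + 1)) at_top sequentially"
      by real_asymp
    then have "\<forall>\<^sub>F J in sequentially. 0 < ln (real J) / 2 + ln (ln 2) - ln 2 - (C + D + 2 * real K + 1)"
      unfolding filterlim_at_top_dense by (rule spec)
    then have "\<forall>\<^sub>F J in sequentially. False" using eventually_ge_at_top[of 2]
    proof eventually_elim
      case (elim J)
      have "ln (ln (real (2 ^ J))) = ln (real J) + ln (ln 2)"
        using elim by (simp add: ln_realpow ln_mult)
      moreover have "2 \<le> (2::nat) ^ J" using power_increasing[of 1 J "2::nat"] elim by simp
      then have "ln (ln (real (2 ^ J))) - ln 2 \<le> (\<Sum>p | prime p \<and> p \<le> 2 ^ J. 1 / real p)"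
        by (rule sum_recip_primes_ge)
      moreover have "harm J \<le> ln (real J) + 1" 
        using decseqD[OF decseq_harm_diff_ln, of 0 "J - 1"] elim by (simp add: harm_Suc harm_expand)
      ultimately show ?case using bound[of J] elim by linarith
    qed
    then show False by simp
  qed
  then show ?thesis using t(2,4) by (intro exI[of _ t]) simp
qed

section \<open>Densities along an ultrafilter\<close>

text \<open>
  Zorn's lemma for the reverse inclusion of proper filters. A minimal one decides
  every predicate, as it could be refined by a predicate whose negation does not hold eventually.
\<close>

lemma ultrafilter_below:
  fixes F0 :: "'a filter"
  assumes "F0 \<noteq> bot"
  shows "\<exists>F\<le>F0. F \<noteq> bot \<and> (\<forall>P. eventually P F \<or> eventually (\<lambda>x. \<not> P x) F)"
proof -
  define A where "A = {F. F \<le> F0 \<and> F \<noteq> bot}"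
  have "\<exists>m\<in>A. \<forall>a\<in>A. a \<le> m \<longrightarrow> a = m"
  proof (rule predicate_Zorn)
    show "partial_order_on A (relation_of (\<lambda>F G. G \<le> F) A)"
      by (rule partial_order_on_relation_ofI) auto
    fix C assume "C \<in> Chains (relation_of (\<lambda>F G. G \<le> F) A)"
    then have C: "C \<subseteq> A" "\<And>F G. F \<in> C \<Longrightarrow> G \<in> C \<Longrightarrow> F \<le> G \<or> G \<le> F"
      unfolding Chains_def relation_of_def by auto
    show "\<exists>u\<in>A. \<forall>a\<in>C. u \<le> a"
    proof (cases "C = {}")
      case True
      then show ?thesis using assms by (auto simp: A_def)
    next
      case False
      have "eventually (\<lambda>x. False) (Inf C) \<longleftrightarrow> (\<exists>b\<in>C. eventually (\<lambda>x. False) b)"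
      proof (rule eventually_Inf_base[OF False])
        fix F G assume "F \<in> C" "G \<in> C"
        then show "\<exists>x\<in>C. x \<le> inf F G" using C(2)[of F G] by (auto simp: le_inf_iff)
      qed
      then have "Inf C \<noteq> bot"
        using C(1) by (auto simp: A_def trivial_limit_def[symmetric] eventually_False)
      moreover have "Inf C \<le> F0"
        using False C(1) by (metis (no_types, lifting) A_def Inf_lower2 equals0I mem_Collect_eq subsetD)
      ultimately show ?thesis by (intro bexI[of _ "Inf C"]) (auto simp: A_def Inf_lower)
    qed
  qed
  then obtain F where F: "F \<le> F0" "F \<noteq> bot" and min: "\<And>G. G \<le> F0 \<Longrightarrow> G \<noteq> bot \<Longrightarrow> G \<le> F \<Longrightarrow> G = F"
    unfolding A_def by auto
  have "eventually P F \<or> eventually (\<lambda>x. \<not> P x) F" for P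
  proof (cases "eventually (\<lambda>x. \<not> P x) F")
    case False
    let ?G = "inf F (principal {x. P x})"
    have "?G \<noteq> bot"
      using False by (simp add: trivial_limit_def eventually_inf_principal)
    then have "?G = F" using F by (intro min) (auto intro: le_infI1)
    moreover have "eventually P ?G" by (simp add: eventually_inf_principal)
    ultimately show ?thesis by simp
  qed simp
  with F show ?thesis by (intro exI[of _ F]) simp
qed

lemma card_Int_interval: "real (card (A \<inter> {1..n::nat})) = (\<Sum>m=1..n. of_bool (m \<in> A))"
proof -
  have "real (card (A \<inter> {1..n})) = (\<Sum>m\<in>{1..n} \<inter> A. 1)" by (simp add: Int_commute)
  also have "\<dots> = (\<Sum>m=1..n. of_bool (m \<in> A))"
    by (subst sum.inter_restrict) (simp_all add: of_bool_def)
  finally show ?thesis .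
qed

locale ultra =
  fixes F :: "nat filter"
  assumes below_sequentially: "F \<le> sequentially" and nontrivial: "F \<noteq> bot"
    and decides: "eventually P F \<or> eventually (\<lambda>x. \<not> P x) F"
begin

lemma bounded_convergent:
  fixes a :: "nat \<Rightarrow> real"
  assumes "\<And>n. \<bar>a n\<bar> \<le> C"
  shows "\<exists>l. (a \<longlongrightarrow> l) F"
proof -
  have "compact {-C..C}" by simp
  moreover have "filtermap a F \<noteq> bot" using nontrivial by (simp add: filtermap_bot_iff)
  moreover have "eventually (\<lambda>x. x \<in> {-C..C}) (filtermap a F)"
    using assms by (auto simp: eventually_filtermap abs_le_iff intro!: always_eventually; smt (verit))
  ultimately obtain l where l: "inf (nhds l) (filtermap a F) \<noteq> bot"
    unfolding compact_filter by blast
  have "(a \<longlongrightarrow> l) F"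
  proof (rule topological_tendstoI)
    fix S assume S: "open S" "l \<in> S"
    show "eventually (\<lambda>x. a x \<in> S) F"
    proof (rule ccontr)
      assume "\<not> ?thesis"
      then have "eventually (\<lambda>x. a x \<notin> S) F" using decides[of "\<lambda>x. a x \<in> S"] by blast
      then have "eventually (\<lambda>y. y \<notin> S) (filtermap a F)" by (simp add: eventually_filtermap)
      moreover have "eventually (\<lambda>y. y \<in> S) (nhds l)" using S by (rule eventually_nhds_in_open)
      ultimately have "eventually (\<lambda>_. False) (inf (nhds l) (filtermap a F))"
        unfolding eventually_inf by (intro exI[of _ "\<lambda>y. y \<in> S"] exI[of _ "\<lambda>y. y \<notin> S"]) auto
      then show False using l by (simp add: eventually_False)
    qed
  qed
  then show ?thesis ..
qed

definition ulim :: "(nat \<Rightarrow> real) \<Rightarrow> real" where "ulim a = Lim F a"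

lemma tendsto_ulim:
  assumes "\<And>n. \<bar>a n\<bar> \<le> C"
  shows "(a \<longlongrightarrow> ulim a) F"
proof -
  obtain l where l: "(a \<longlongrightarrow> l) F" using bounded_convergent[of a C] assms by blast
  then show ?thesis unfolding ulim_def using tendsto_Lim[OF nontrivial l] by simp
qed

lemma ulim_eqI: "(a \<longlongrightarrow> l) F \<Longrightarrow> ulim a = l"
  unfolding ulim_def by (rule tendsto_Lim[OF nontrivial])

lemma seq_imp: "(a \<longlonglongrightarrow> l) \<Longrightarrow> (a \<longlongrightarrow> l) F"
  by (rule tendsto_mono[OF below_sequentially])

text \<open>
  The Turan-Kubilius inequality for a finitely additive mean \<open>\<mu>\<close> that is a limit of weighted counts. The
  error terms that depend on the number of primes disappear in the limit; it is used for natural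
  densities at a scale \<open>s\<close> and for logarithmic densities.
\<close>

lemma turan_kubilius_limit:
  assumes P: "finite P" "\<And>p. p \<in> P \<Longrightarrow> prime p"
    and bal: "\<And>N. balanced w (M N)"
    and C: "\<And>A N. C A N = (\<Sum>n=1..M N. w n * of_bool (n \<in> A))"
    and r: "\<forall>\<^sub>F N in F. 0 < r N" "((\<lambda>N. 1 / r N) \<longlongrightarrow> 0) F"
    and s: "0 < s" "\<And>N. C UNIV N \<le> s * r N"
    and lim: "\<And>A. ((\<lambda>N. C A N / r N) \<longlongrightarrow> \<mu> A) F"
  shows "\<bar>(\<Sum>p\<in>P. \<mu> {n \<in> A. p dvd n}) - recip_sum P * \<mu> A\<bar> \<le> s * sqrt (recip_sum P)"
proof -
  let ?L = "recip_sum P"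
  have L0: "0 \<le> ?L" by (rule recip_sum_nonneg)
  have lim1: "((\<lambda>N. \<bar>(\<Sum>p\<in>P. C {n \<in> A. p dvd n} N / r N) - ?L * (C A N / r N)\<bar>)
      \<longlongrightarrow> \<bar>(\<Sum>p\<in>P. \<mu> {n \<in> A. p dvd n}) - ?L * \<mu> A\<bar>) F"
    by (intro tendsto_intros lim)
  have lim2: "((\<lambda>N. sqrt (s * (s * ?L + 2 * ?L * real (card P) * (1 / r N)))) \<longlongrightarrow> sqrt (s * (s * ?L + 2 * ?L * real (card P) * 0))) F"
    by (intro tendsto_intros r)
  have "\<bar>(\<Sum>p\<in>P. \<mu> {n \<in> A. p dvd n}) - ?L * \<mu> A\<bar> \<le> sqrt (s * (s * ?L + 2 * ?L * real (card P) * 0))"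
  proof (rule tendsto_le[OF nontrivial lim2 lim1])
    show "\<forall>\<^sub>F N in F. \<bar>(\<Sum>p\<in>P. C {n \<in> A. p dvd n} N / r N) - ?L * (C A N / r N)\<bar>
      \<le> sqrt (s * (s * ?L + 2 * ?L * real (card P) * (1 / r N)))"
      using r(1)
    proof eventually_elim
      case (elim N)
      have multiples: "(\<Sum>n=1..M N. w n * of_bool (p dvd n) * of_bool (n \<in> A)) = C {n \<in> A. p dvd n} N" for p
        unfolding C by (intro sum.cong) auto
      have W: "(\<Sum>n=1..M N. w n) = C UNIV N" unfolding C by simp
      have W0: "0 \<le> C UNIV N" unfolding C by (rule sum_nonneg) (use bal[of N] in \<open>auto simp: balanced_def\<close>)
      have "\<bar>(\<Sum>p\<in>P. C {n \<in> A. p dvd n} N) - ?L * C A N\<bar>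
        \<le> sqrt (C UNIV N * (C UNIV N * ?L + 2 * ?L * real (card P)))"
        using turan_kubilius_sum[OF P bal[of N], of "\<lambda>n. of_bool (n \<in> A)"]
        unfolding multiples W C[symmetric] by simp
      also have "\<dots> \<le> sqrt ((s * r N) * ((s * r N) * ?L + 2 * ?L * real (card P)))"
        using s L0 W0 by (intro real_sqrt_le_mono mult_mono add_mono mult_right_mono order_refl)
          (auto intro!: add_nonneg_nonneg intro: order_trans[OF W0])
      also have "(s * r N) * ((s * r N) * ?L + 2 * ?L * real (card P))
        = (r N)\<^sup>2 * (s * (s * ?L + 2 * ?L * real (card P) * (1 / r N)))"
        using elim by (simp add: power2_eq_square field_simps)
      also have "sqrt \<dots> = r N * sqrt (s * (s * ?L + 2 * ?L * real (card P) * (1 / r N)))"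
        using elim by (simp add: real_sqrt_mult)
      finally have "\<bar>(\<Sum>p\<in>P. C {n \<in> A. p dvd n} N) - ?L * C A N\<bar> / r N
        \<le> sqrt (s * (s * ?L + 2 * ?L * real (card P) * (1 / r N)))"
        using elim by (simp add: divide_le_eq mult.commute)
      moreover have "(\<Sum>p\<in>P. C {n \<in> A. p dvd n} N / r N) - ?L * (C A N / r N)
        = ((\<Sum>p\<in>P. C {n \<in> A. p dvd n} N) - ?L * C A N) / r N"
        by (simp add: diff_divide_distrib sum_divide_distrib)
      ultimately show ?case using elim by (simp add: abs_divide)
    qed
  qed
  also have "\<dots> = s * sqrt ?L" using s by (simp add: real_sqrt_mult mult.assoc[symmetric] power2_eq_square[symmetric])
  finally show ?thesis .
qed

text \<open>
  Numbers up to \<open>s * N\<close> are counted, but the count is divided by \<open>N\<close>. With this normalisation \<open>dens s A\<close> is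
  nondecreasing and 1-Lipschitz in the scale \<open>s\<close>, and multiples of \<open>k\<close> correspond to the scale \<open>s / k\<close>.
\<close>

definition cnt :: "real \<Rightarrow> nat set \<Rightarrow> nat \<Rightarrow> nat" where
  "cnt s A N = card (A \<inter> {1..nat \<lfloor>s * real N\<rfloor>})"

definition dens :: "real \<Rightarrow> nat set \<Rightarrow> real" where
  "dens s A = ulim (\<lambda>N. real (cnt s A N) / real N)"

lemma floor_frac_le: "0 \<le> s \<Longrightarrow> real (nat \<lfloor>s * real N\<rfloor>) / real N \<le> s"
  by (cases "N = 0") (simp_all add: divide_le_eq)

lemma cnt_le: "0 \<le> s \<Longrightarrow> real (cnt s A N) / real N \<le> s"
proof -
  assume s: "0 \<le> s"
  have "cnt s A N \<le> card {1..nat \<lfloor>s * real N\<rfloor>}" unfolding cnt_def by (intro card_mono) auto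
  then have "real (cnt s A N) / real N \<le> real (nat \<lfloor>s * real N\<rfloor>) / real N"
    by (intro divide_right_mono) auto
  then show ?thesis using floor_frac_le[OF s, of N] by linarith
qed

lemma dens_tendsto:
  assumes "0 \<le> s"
  shows "((\<lambda>N. real (cnt s A N) / real N) \<longlongrightarrow> dens s A) F"
  unfolding dens_def by (rule tendsto_ulim[where C = s]) (use cnt_le[OF assms] in simp)

lemma dens_nonneg: "0 \<le> s \<Longrightarrow> 0 \<le> dens s A"
  by (rule tendsto_lowerbound[OF dens_tendsto _ nontrivial]) auto

lemma dens_le: "0 \<le> s \<Longrightarrow> dens s A \<le> s"
  by (rule tendsto_upperbound[OF dens_tendsto _ nontrivial]) (auto intro: always_eventually cnt_le)

lemma dens_mono: "0 \<le> s \<Longrightarrow> A \<subseteq> B \<Longrightarrow> dens s A \<le> dens s B"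
  by (rule tendsto_le[OF nontrivial dens_tendsto dens_tendsto])
    (auto intro!: always_eventually divide_right_mono card_mono simp: cnt_def)

lemma dens_Un: "0 \<le> s \<Longrightarrow> A \<inter> B = {} \<Longrightarrow> dens s (A \<union> B) = dens s A + dens s B"
proof -
  assume s: "0 \<le> s" and AB: "A \<inter> B = {}"
  have "cnt s (A \<union> B) N = cnt s A N + cnt s B N" for N
    unfolding cnt_def using AB by (subst card_Un_disjoint[symmetric]) (auto intro!: arg_cong[where f = card])
  then have "((\<lambda>N. real (cnt s (A \<union> B) N) / real N) \<longlongrightarrow> dens s A + dens s B) F"
    using tendsto_add[OF dens_tendsto[OF s, of A] dens_tendsto[OF s, of B]] by (simp add: add_divide_distrib)
  then show ?thesis unfolding dens_def[of s "A \<union> B"] by (rule ulim_eqI)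
qed

lemma dens_subadd: "0 \<le> s \<Longrightarrow> A \<subseteq> B \<union> C \<Longrightarrow> dens s A \<le> dens s B + dens s C"
proof -
  assume s: "0 \<le> s" and A: "A \<subseteq> B \<union> C"
  have "dens s A \<le> dens s (B \<union> (C - B))" using A s by (intro dens_mono) auto
  also have "\<dots> = dens s B + dens s (C - B)" using s by (intro dens_Un) auto
  also have "dens s (C - B) \<le> dens s C" using s by (intro dens_mono) auto
  finally show ?thesis by simp
qed

lemma dens_diff:
  assumes "0 \<le> s" "s \<le> t"
  shows "dens s A \<le> dens t A" "dens t A \<le> dens s A + (t - s)"
proof -
  have fl: "nat \<lfloor>s * real N\<rfloor> \<le> nat \<lfloor>t * real N\<rfloor>" for N
    using assms by (intro nat_mono floor_mono mult_right_mono) auto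
  show "dens s A \<le> dens t A"
  proof (rule tendsto_le[OF nontrivial dens_tendsto dens_tendsto])
    show "\<forall>\<^sub>F N in F. real (cnt s A N) / real N \<le> real (cnt t A N) / real N"
      using fl unfolding cnt_def
      by (intro always_eventually allI divide_right_mono of_nat_mono card_mono Int_mono order_refl)
        (simp_all add: fl)
  qed (use assms in auto)
  have "((\<lambda>N. real (cnt s A N) / real N + (t - s) + 1 / real N) \<longlongrightarrow> dens s A + (t - s) + 0) F"
    using assms by (intro tendsto_intros dens_tendsto seq_imp lim_1_over_n)
  moreover have "((\<lambda>N. real (cnt t A N) / real N) \<longlongrightarrow> dens t A) F"
    using assms by (intro dens_tendsto) auto
  moreover have "real (cnt t A N) / real N \<le> real (cnt s A N) / real N + (t - s) + 1 / real N" if "N > 0" for N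
  proof -
    let ?s = "nat \<lfloor>s * real N\<rfloor>" and ?t = "nat \<lfloor>t * real N\<rfloor>"
    have "A \<inter> {1..?t} \<subseteq> (A \<inter> {1..?s}) \<union> {?s<..?t}" by auto
    then have "cnt t A N \<le> card ((A \<inter> {1..?s}) \<union> {?s<..?t})" unfolding cnt_def by (intro card_mono) auto
    also have "\<dots> \<le> cnt s A N + (?t - ?s)" unfolding cnt_def by (rule order_trans[OF card_Un_le]) simp
    finally have "real (cnt t A N) \<le> real (cnt s A N) + (real ?t - real ?s)" using fl[of N] by linarith
    moreover have "real ?t \<le> t * real N" using assms by simp
    moreover have "s * real N - 1 \<le> real ?s" by linarith
    ultimately have "real (cnt t A N) \<le> real (cnt s A N) + (t - s) * real N + 1" by (simp add: algebra_simps)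
    then have "real (cnt t A N) / real N \<le> (real (cnt s A N) + (t - s) * real N + 1) / real N"
      by (rule divide_right_mono) simp
    then show ?thesis using that by (simp add: add_divide_distrib)
  qed
  moreover have "eventually (\<lambda>N. N > 0) F"
    using below_sequentially eventually_gt_at_top[of 0] by (rule filter_leD)
  ultimately show "dens t A \<le> dens s A + (t - s)"
    by (intro tendsto_le[OF nontrivial, where x = "dens s A + (t - s)"]) (auto elim: eventually_mono)
qed

lemma dens_multiples:
  assumes s: "0 \<le> s" and k: "k \<ge> 1"
  shows "dens s {n \<in> A. k dvd n} = dens (s / real k) {m. k * m \<in> A}"
proof -
  have "cnt s {n \<in> A. k dvd n} N = cnt (s / real k) {m. k * m \<in> A} N" for N
  proof -
    have eq: "nat \<lfloor>s / real k * real N\<rfloor> = nat \<lfloor>s * real N\<rfloor> div k"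
    proof -
      have "\<lfloor>s / real k * real N\<rfloor> = \<lfloor>s * real N / real_of_int (int k)\<rfloor>" by simp
      also have "\<dots> = \<lfloor>s * real N\<rfloor> div int k" by (rule floor_divide_real_eq_div) simp
      finally show ?thesis by (simp add: nat_div_distrib s)
    qed
    show ?thesis unfolding cnt_def eq
      by (rule bij_betw_same_card[of "\<lambda>n. n div k"], rule bij_betw_byWitness[where f' = "\<lambda>m. k * m"])
        (use k in \<open>auto simp: less_eq_div_iff_mult_less_eq mult.commute Suc_le_eq div_greater_zero_iff dvd_imp_le div_le_mono\<close>)
  qed
  then show ?thesis by (simp add: dens_def)
qed

lemma dens_UNIV: "0 \<le> s \<Longrightarrow> dens s {n. k dvd n} \<le> s / real k" if "k \<ge> 1"
  using dens_multiples[of s k UNIV] that dens_le[of "s / real k" UNIV] by simp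

lemma dens_turan_kubilius:
  assumes s: "0 < s" and P: "finite P" "\<And>p. p \<in> P \<Longrightarrow> prime p"
  shows "\<bar>\<Sum>p\<in>P. (real p * dens (s / real p) {m. p * m \<in> A} - dens s A) / real p\<bar> \<le> s * sqrt (recip_sum P)"
proof -
  let ?L = "recip_sum P"
  have p1: "p \<ge> 1" if "p \<in> P" for p using P(2)[OF that] prime_ge_1_nat by blast
  have "\<bar>(\<Sum>p\<in>P. dens s {n \<in> A. p dvd n}) - ?L * dens s A\<bar> \<le> s * sqrt ?L"
  proof (rule turan_kubilius_limit[OF P, where w = "\<lambda>_. 1" and M = "\<lambda>N. nat \<lfloor>s * real N\<rfloor>" and r = real
      and C = "\<lambda>A N. real (cnt s A N)" and \<mu> = "dens s"])
    show "real (cnt s A N) = (\<Sum>n=1..nat \<lfloor>s * real N\<rfloor>. 1 * of_bool (n \<in> A))" for A N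
      unfolding cnt_def card_Int_interval by simp
    show "\<forall>\<^sub>F N in F. 0 < real N"
      using filter_leD[OF below_sequentially eventually_gt_at_top[of 0]] by simp
    show "real (cnt s UNIV N) \<le> s * real N" for N using s by (simp add: cnt_def)
  qed (use s balanced_1 seq_imp[OF lim_1_over_n] dens_tendsto in auto)
  moreover have "(\<Sum>p\<in>P. dens s {n \<in> A. p dvd n}) - ?L * dens s A
    = (\<Sum>p\<in>P. (real p * dens (s / real p) {m. p * m \<in> A} - dens s A) / real p)"
  proof -
    have "(\<Sum>p\<in>P. dens s {n \<in> A. p dvd n}) = (\<Sum>p\<in>P. dens (s / real p) {m. p * m \<in> A})"
      using s p1 by (intro sum.cong refl dens_multiples) auto
    moreover have "(\<Sum>p\<in>P. dens (s / real p) {m. p * m \<in> A}) - ?L * dens s A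
      = (\<Sum>p\<in>P. dens (s / real p) {m. p * m \<in> A} - 1 / real p * dens s A)"
      by (simp add: sum_subtractf recip_sum_def sum_distrib_right)
    moreover have "\<dots> = (\<Sum>p\<in>P. (real p * dens (s / real p) {m. p * m \<in> A} - dens s A) / real p)"
      using p1 by (intro sum.cong refl) (force simp: diff_divide_distrib)
    ultimately show ?thesis by simp
  qed
  ultimately show ?thesis by simp
qed

end

text \<open>
  The form in which the Turan-Kubilius inequality is exploited: a sum of deviations that grows only
  like the square root of the sum of reciprocals forces almost all deviations to be small.
\<close>

lemma thin_if_sqrt_bound:
  fixes h :: "nat \<Rightarrow> real"
  assumes Q: "\<And>P. finite P \<Longrightarrow> P \<subseteq> Q \<Longrightarrow> \<bar>\<Sum>p\<in>P. h p / real p\<bar> \<le> C * (sqrt (recip_sum P) + 1)"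
    and e: "e > 0"
  shows "thin {p\<in>Q. \<bar>h p\<bar> > e}"
proof -
  have C: "0 \<le> C" using Q[of "{}"] by (simp add: recip_sum_def)
  have one_sided: "thin {p\<in>Q. \<sigma> * h p > e}" if sg: "\<sigma> = 1 \<or> \<sigma> = - 1" for \<sigma> :: real
  proof (rule ccontr)
    assume "\<not> ?thesis"
    then obtain P where P: "finite P" "P \<subseteq> {p\<in>Q. \<sigma> * h p > e}" and "max 1 ((2 * C / e)\<^sup>2 + 1) \<le> (\<Sum>p\<in>P. 1 / real p)"
      by (rule not_thin_imp_unbounded[where C = "max 1 ((2 * C / e)\<^sup>2 + 1)"])
    then have L: "1 \<le> recip_sum P" "(2 * C / e)\<^sup>2 < recip_sum P" unfolding recip_sum_def by linarith+
    have "e * recip_sum P = (\<Sum>p\<in>P. e / real p)" by (simp add: recip_sum_def sum_distrib_left)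
    also have "\<dots> \<le> (\<Sum>p\<in>P. \<sigma> * h p / real p)"
      using P by (intro sum_mono divide_right_mono) (auto simp: less_imp_le)
    also have "\<dots> = \<sigma> * (\<Sum>p\<in>P. h p / real p)" by (simp add: sum_distrib_left)
    also have "\<dots> \<le> \<bar>\<Sum>p\<in>P. h p / real p\<bar>" using sg by auto
    also have "\<dots> \<le> C * (sqrt (recip_sum P) + 1)" using P by (intro Q) auto
    also have "\<dots> \<le> C * (2 * sqrt (recip_sum P))" using L C by (intro mult_left_mono) auto
    finally have 1: "e * recip_sum P \<le> 2 * C * sqrt (recip_sum P)" by simp
    have sq: "sqrt (recip_sum P) > 0" using L by simp
    have "recip_sum P = sqrt (recip_sum P) * sqrt (recip_sum P)" using L by simp
    then have "(e * sqrt (recip_sum P)) * sqrt (recip_sum P) \<le> 2 * C * sqrt (recip_sum P)" using 1 by (simp add: mult.assoc)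
    then have "e * sqrt (recip_sum P) \<le> 2 * C" using sq by simp
    then have "sqrt (recip_sum P) \<le> 2 * C / e" using e by (simp add: field_simps)
    moreover have "2 * C / e < sqrt (recip_sum P)" using L(2) by (rule real_less_rsqrt)
    ultimately show False by simp
  qed
  have "{p\<in>Q. \<bar>h p\<bar> > e} \<subseteq> {p\<in>Q. 1 * h p > e} \<union> {p\<in>Q. - 1 * h p > e}" by auto
  then show ?thesis using thin_subset thin_Un one_sided by blast
qed

section \<open>Level sets of multiplicative functions\<close>

lemma sieve_stable_exactI:
  assumes "Q \<subseteq> {p. prime p}" "\<not> thin Q"
    and "\<And>p m. p \<in> Q \<Longrightarrow> m > 0 \<Longrightarrow> \<not> p dvd m \<Longrightarrow> p * m \<in> E \<longleftrightarrow> m \<in> E'"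
  shows "sieve_stable E"
  unfolding sieve_stable_def
proof (intro allI impI)
  fix \<epsilon> :: real assume e: "\<epsilon> > 0"
  have "\<forall>\<^sub>F N in sequentially. real (card ({} \<inter> {1..N})) \<le> \<epsilon> * real N"
    using e by (intro always_eventually) simp
  then show "\<exists>Q E' B. Q \<subseteq> {p. prime p} \<and> \<not> thin Q \<and>
     (\<forall>p\<in>Q. \<forall>m>0. \<not> p dvd m \<longrightarrow> m \<notin> B \<longrightarrow> (p * m \<in> E \<longleftrightarrow> m \<in> E')) \<and>
     (\<forall>\<^sub>F N in sequentially. real (card (B \<inter> {1..N})) \<le> \<epsilon> * real N)"
    using assms by (intro exI[of _ Q] exI[of _ E'] exI[of _ "{}"]) simp
qed

lemma concentration_not_thin:
  assumes "concentration_point f z"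
  shows "\<not> thin {p. prime p \<and> f p = z}"
proof
  assume "thin {p. prime p \<and> f p = z}"
  then obtain C where C: "\<And>F. finite F \<Longrightarrow> F \<subseteq> {p. prime p \<and> f p = z} \<Longrightarrow> (\<Sum>p\<in>F. 1 / real p) \<le> C"
    by (rule thin_imp_bounded) blast
  have "(\<Sum>\<^sub>\<infinity>p\<in>{p. prime p \<and> f p = z}. ennreal (1 / real p))
    = (SUP F\<in>{F. finite F \<and> F \<subseteq> {p. prime p \<and> f p = z}}. \<Sum>p\<in>F. ennreal (1 / real p))"
    by (rule nonneg_infsum_complete) simp
  also have "\<dots> \<le> ennreal C"
  proof (rule SUP_least)
    fix F assume "F \<in> {F. finite F \<and> F \<subseteq> {p. prime p \<and> f p = z}}"
    then have "(\<Sum>p\<in>F. 1 / real p) \<le> C" by (intro C) auto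
    then show "(\<Sum>p\<in>F. ennreal (1 / real p)) \<le> ennreal C" by (simp add: sum_ennreal ennreal_leI)
  qed
  finally show False using assms by (simp add: concentration_point_def top_unique)
qed

text \<open>
  For the primes with \<open>f p = z\<close> all sections are equal to \<open>{m. z * f m \<in> K}\<close>, without exceptions.
\<close>

lemma concentration_sieve_stable:
  assumes f: "multiplicative f" and z: "concentration_point f z"
  shows "sieve_stable {n. 0 < n \<and> f n \<in> K}"
proof (rule sieve_stable_exactI)
  show "\<not> thin {p. prime p \<and> f p = z}" by (rule concentration_not_thin[OF z])
  fix p m assume "p \<in> {p. prime p \<and> f p = z}" "m > 0" "\<not> p dvd m"
  then show "p * m \<in> {n. 0 < n \<and> f n \<in> K} \<longleftrightarrow> m \<in> {m. z * f m \<in> K}"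
    using multiplicative_prime[OF f, of p m] prime_gt_0_nat[of p] by auto
qed auto

abbreviation harmonic :: "nat \<Rightarrow> real" where "harmonic \<equiv> harm"

lemma harmonic_eq: "harmonic N = (\<Sum>n=1..N. 1 / real n)"
  by (simp add: harm_def inverse_eq_divide)

definition log_count :: "nat set \<Rightarrow> nat \<Rightarrow> real" where
  "log_count A N = (\<Sum>n=1..N. 1 / real n * of_bool (n \<in> A))"

lemma log_count_bounds: "0 \<le> log_count A N" "log_count A N \<le> harmonic N"
  unfolding log_count_def harmonic_eq by (auto intro!: sum_nonneg sum_mono)

lemma log_count_multiples:
  assumes k: "k \<ge> 1"
  shows "\<bar>real k * log_count {n \<in> A. k dvd n} N - log_count {m. k * m \<in> A} N\<bar> \<le> real k"
proof -
  let ?h = "\<lambda>m. 1 / real m * of_bool (k * m \<in> A) :: real"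
  have "log_count {n \<in> A. k dvd n} N = (\<Sum>n=1..N. (1 / real n * of_bool (n \<in> A)) * of_bool (k dvd n))"
    unfolding log_count_def by (intro sum.cong) auto
  also have "\<dots> = (\<Sum>m=1..N div k. 1 / real (k * m) * of_bool (k * m \<in> A))"
    by (rule sum_multiples[OF k])
  also have "real k * \<dots> = (\<Sum>m=1..N div k. ?h m)"
    unfolding sum_distrib_left using k by (intro sum.cong) auto
  finally have 1: "real k * log_count {n \<in> A. k dvd n} N = (\<Sum>m=1..N div k. ?h m)" .
  have "{1..N} = {1..N div k} \<union> {N div k<..N}" by (auto intro: le_trans[OF _ div_le_dividend])
  then have 2: "log_count {m. k * m \<in> A} N = (\<Sum>m=1..N div k. ?h m) + (\<Sum>m\<in>{N div k<..N}. ?h m)"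
    unfolding log_count_def by (simp only: mem_Collect_eq) (subst sum.union_disjoint, auto)
  have "(\<Sum>m\<in>{N div k<..N}. ?h m) \<le> (\<Sum>m\<in>{N div k<..N}. 1 / real m)" by (intro sum_mono) auto
  also have "\<dots> = harmonic N - harmonic (N div k)"
  proof -
    have "{1..N} = {1..N div k} \<union> {N div k<..N}" by (auto intro: le_trans[OF _ div_le_dividend])
    then show ?thesis unfolding harmonic_eq by (simp only:) (subst sum.union_disjoint, auto)
  qed
  also have "\<dots> \<le> real k"
  proof -
    have "harmonic N / real k - 1 \<le> (\<Sum>n=1..N. 1 / real n * of_bool (k dvd n))"
      using balanced_log[of N] k unfolding balanced_def harmonic_eq by blast
    also have "\<dots> = (\<Sum>m=1..N div k. 1 / real (k * m))" by (rule sum_multiples[OF k])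
    also have "\<dots> = harmonic (N div k) / real k"
      unfolding harmonic_eq sum_divide_distrib by (simp add: mult.commute)
    finally have "real k * (harmonic N / real k - 1) \<le> real k * (harmonic (N div k) / real k)"
      by (rule mult_left_mono) simp
    then show ?thesis using k by (simp add: right_diff_distrib)
  qed
  finally have "(\<Sum>m\<in>{N div k<..N}. ?h m) \<le> real k" .
  moreover have "0 \<le> (\<Sum>m\<in>{N div k<..N}. ?h m)" by (intro sum_nonneg) auto
  ultimately show ?thesis unfolding 1 2 by simp
qed

text \<open>
  Partial summation against the natural counting function. The constant \<open>1 / 4\<close> leaves room for replacing
  \<open>d\<close> by \<open>d / 2\<close> and for discarding the initial terms.
\<close>

lemma log_count_lower:
  assumes d: "has_natural_density E d" "d > 0"
  shows "\<forall>\<^sub>F N in sequentially. d / 4 * harmonic N \<le> log_count E N"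
proof -
  let ?A = "\<lambda>N. real (card (E \<inter> {1..N}))"
  have frac: "x / a = x / (a + 1) + x * (1 / (a * (a + 1)))" if "a > 0" for x a :: real
  proof -
    have "x / (a + 1) + x * (1 / (a * (a + 1))) = (x * a + x) / (a * (a + 1))"
      using that by (simp add: add_divide_distrib)
    also have "x * a + x = x * (a + 1)" by (simp add: distrib_left)
    also have "x * (a + 1) / (a * (a + 1)) = x / a" using that by simp
    finally show ?thesis by simp
  qed
  have abel: "log_count E N = ?A N / real (Suc N) + (\<Sum>n=1..N. ?A n * (1 / (real n * real (Suc n))))" for N
  proof (induction N)
    case (Suc N)
    have A: "?A (Suc N) = ?A N + of_bool (Suc N \<in> E)" unfolding card_Int_interval by simp
    have "log_count E (Suc N) = log_count E N + 1 / real (Suc N) * of_bool (Suc N \<in> E)"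
      by (simp add: log_count_def)
    also have "\<dots> = (?A N + of_bool (Suc N \<in> E)) / real (Suc N) + (\<Sum>n=1..N. ?A n * (1 / (real n * real (Suc n))))"
      unfolding Suc by (simp add: add_divide_distrib)
    also have "\<dots> = ?A (Suc N) / real (Suc (Suc N)) + ?A (Suc N) * (1 / (real (Suc N) * real (Suc (Suc N))))
      + (\<Sum>n=1..N. ?A n * (1 / (real n * real (Suc n))))"
      unfolding A[symmetric] using frac[of "real (Suc N)" "?A (Suc N)"] by (simp add: add.commute)
    also have "\<dots> = ?A (Suc N) / real (Suc (Suc N)) + (\<Sum>n=1..Suc N. ?A n * (1 / (real n * real (Suc n))))"
      by simp
    finally show ?case .
  qed (simp add: log_count_def)
  have "\<forall>\<^sub>F N in sequentially. d / 2 < ?A N / real N"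
    by (rule order_tendstoD(1)[OF d(1)[unfolded has_natural_density_def]]) (use d in simp)
  then obtain n0 where n0: "\<And>n. n \<ge> n0 \<Longrightarrow> d / 2 < ?A n / real n" unfolding eventually_sequentially by blast
  define m where "m = Suc n0"
  have m: "d / 2 * real n \<le> ?A n" if "n \<ge> m" for n
    using n0[of n] that by (simp add: m_def less_divide_eq)
  have lower: "d / 2 * (harmonic (Suc N) - harmonic m) \<le> log_count E N" if N: "N \<ge> m" for N
  proof -
    have "d / 2 * (harmonic (Suc N) - harmonic m) = (\<Sum>n\<in>{m..N}. d / 2 * (1 / real (Suc n)))"
    proof -
      have "{1..Suc N} = {1..m} \<union> {Suc m..Suc N}" using N by auto
      then have "harmonic (Suc N) = harmonic m + (\<Sum>n\<in>{Suc m..Suc N}. 1 / real n)"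
        unfolding harmonic_eq by (simp only:) (subst sum.union_disjoint, auto)
      then have "harmonic (Suc N) - harmonic m = (\<Sum>n\<in>{m..N}. 1 / real (Suc n))"
        by (simp add: sum.atLeast_Suc_atMost_Suc_shift comp_def del: sum.cl_ivl_Suc)
      then show ?thesis by (simp only: sum_distrib_left)
    qed
    also have "\<dots> \<le> (\<Sum>n\<in>{m..N}. ?A n * (1 / (real n * real (Suc n))))"
    proof (rule sum_mono)
      fix n assume n: "n \<in> {m..N}"
      then have "n > 0" by (simp add: m_def)
      have "d / 2 * real n * (1 / (real n * real (Suc n))) \<le> ?A n * (1 / (real n * real (Suc n)))"
        using m n by (intro mult_right_mono) auto
      then show "d / 2 * (1 / real (Suc n)) \<le> ?A n * (1 / (real n * real (Suc n)))" using \<open>n > 0\<close> by simp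
    qed
    also have "\<dots> \<le> (\<Sum>n=1..N. ?A n * (1 / (real n * real (Suc n))))"
      by (rule sum_mono2) (auto simp: m_def)
    also have "\<dots> \<le> log_count E N" unfolding abel by simp
    finally show ?thesis .
  qed
  have "\<forall>\<^sub>F N in sequentially. 2 * harmonic m \<le> harmonic N"
    using harm_at_top unfolding filterlim_at_top by blast
  then show ?thesis using eventually_ge_at_top[of m]
  proof eventually_elim
    case (elim N)
    have "harmonic N \<le> harmonic (Suc N)" by (simp add: harmonic_eq)
    then have "d / 2 * (harmonic N / 2) \<le> d / 2 * (harmonic (Suc N) - harmonic m)"
      using elim d by (intro mult_left_mono) auto
    then show ?case using lower[OF elim(2)] by simp
  qed
qed

context ultra
begin

definition log_dens :: "nat set \<Rightarrow> real" where
  "log_dens A = ulim (\<lambda>N. log_count A N / harmonic N)"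

lemma log_dens_tendsto: "((\<lambda>N. log_count A N / harmonic N) \<longlongrightarrow> log_dens A) F"
  unfolding log_dens_def
proof (rule tendsto_ulim[where C = 1])
  fix N
  show "\<bar>log_count A N / harmonic N\<bar> \<le> 1"
    using log_count_bounds[of A N] by (auto simp: divide_le_eq_1 simp del: harm_pos_iff)
qed

lemma ev_harmonic: "\<forall>\<^sub>F N in F. 0 < harmonic N"
  using filter_leD[OF below_sequentially] harm_at_top unfolding filterlim_at_top_dense by blast

lemma log_dens_sum_le_1:
  assumes "finite I" and disj: "\<And>i j. i \<in> I \<Longrightarrow> j \<in> I \<Longrightarrow> i \<noteq> j \<Longrightarrow> A i \<inter> A j = {}"
  shows "(\<Sum>i\<in>I. log_dens (A i)) \<le> 1"
proof (rule tendsto_upperbound[OF _ _ nontrivial])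
  show "((\<lambda>N. \<Sum>i\<in>I. log_count (A i) N / harmonic N) \<longlongrightarrow> (\<Sum>i\<in>I. log_dens (A i))) F"
    by (intro tendsto_sum log_dens_tendsto)
  have "(\<Sum>i\<in>I. log_count (A i) N) \<le> harmonic N" for N
  proof -
    have "(\<Sum>i\<in>I. of_bool (n \<in> A i)) \<le> (1::real)" for n
    proof (cases "\<exists>i\<in>I. n \<in> A i")
      case True
      then obtain i where i: "i \<in> I" "n \<in> A i" by blast
      have "(\<Sum>j\<in>I. of_bool (n \<in> A j)) = (\<Sum>j\<in>I. if j = i then 1 else (0::real))"
        using disj i by (intro sum.cong) auto
      then show ?thesis using assms(1) by simp
    qed simp
    then have "(\<Sum>n=1..N. 1 / real n * (\<Sum>i\<in>I. of_bool (n \<in> A i))) \<le> harmonic N"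
      unfolding harmonic_eq by (intro sum_mono) (simp add: divide_right_mono)
    then show ?thesis unfolding log_count_def sum_distrib_left by (subst sum.swap)
  qed
  then have "(\<Sum>i\<in>I. log_count (A i) N / harmonic N) \<le> 1" if "0 < harmonic N" for N
    using that by (simp add: sum_divide_distrib[symmetric] divide_le_eq)
  then show "\<forall>\<^sub>F N in F. (\<Sum>i\<in>I. log_count (A i) N / harmonic N) \<le> 1"
    using ev_harmonic by (auto elim: eventually_mono)
qed

lemma inverse_harmonic_tendsto: "((\<lambda>N. c / harmonic N) \<longlongrightarrow> 0) F"
  by (rule tendsto_mono[OF below_sequentially])
    (intro tendsto_divide_0[OF tendsto_const] filterlim_at_top_imp_at_infinity harm_at_top)

text \<open>
  Logarithmic density is the same at all scales: on the right the numbers up to \<open>N\<close> are counted, on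
  the left those up to \<open>N div k\<close> would do.
\<close>

lemma log_dens_multiples:
  assumes k: "k \<ge> 1"
  shows "log_dens {m. k * m \<in> A} = real k * log_dens {n \<in> A. k dvd n}"
proof -
  have "((\<lambda>N. real k * (log_count {n \<in> A. k dvd n} N / harmonic N) - log_count {m. k * m \<in> A} N / harmonic N)
     \<longlongrightarrow> real k * log_dens {n \<in> A. k dvd n} - log_dens {m. k * m \<in> A}) F"
    by (intro tendsto_intros log_dens_tendsto)
  moreover have "((\<lambda>N. real k * (log_count {n \<in> A. k dvd n} N / harmonic N) - log_count {m. k * m \<in> A} N / harmonic N)
     \<longlongrightarrow> 0) F"
  proof (rule Lim_null_comparison[OF _ inverse_harmonic_tendsto[of "real k"]])
    show "\<forall>\<^sub>F N in F. norm (real k * (log_count {n \<in> A. k dvd n} N / harmonic N) - log_count {m. k * m \<in> A} N / harmonic N)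
      \<le> real k / harmonic N"
      using ev_harmonic
    proof eventually_elim
      case (elim N)
      have "real k * (log_count {n \<in> A. k dvd n} N / harmonic N) - log_count {m. k * m \<in> A} N / harmonic N
        = (real k * log_count {n \<in> A. k dvd n} N - log_count {m. k * m \<in> A} N) / harmonic N"
        by (simp add: diff_divide_distrib)
      then show ?case using log_count_multiples[OF k, of A N] elim
        by (simp add: abs_divide divide_right_mono harm_nonneg del: harm_pos_iff)
    qed
  qed
  ultimately have "real k * log_dens {n \<in> A. k dvd n} - log_dens {m. k * m \<in> A} = 0"
    by (rule tendsto_unique[OF nontrivial])
  then show ?thesis by simp
qed

lemma log_dens_subadd: "A \<subseteq> B \<union> C \<Longrightarrow> log_dens A \<le> log_dens B + log_dens C"
proof (rule tendsto_le[OF nontrivial tendsto_add[OF log_dens_tendsto log_dens_tendsto] log_dens_tendsto])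
  assume A: "A \<subseteq> B \<union> C"
  have "log_count A N \<le> log_count B N + log_count C N" for N
    unfolding log_count_def sum.distrib[symmetric] using A by (intro sum_mono) auto
  then show "\<forall>\<^sub>F N in F. log_count A N / harmonic N \<le> log_count B N / harmonic N + log_count C N / harmonic N"
    using ev_harmonic by (auto elim!: eventually_mono simp: add_divide_distrib[symmetric] divide_right_mono harm_nonneg)
qed

lemma log_dens_dvd_le:
  assumes k: "k \<ge> 1"
  shows "log_dens {n. k dvd n} \<le> 1 / real k"
proof -
  have "log_dens {m. k * m \<in> UNIV} \<le> 1" using log_dens_sum_le_1[of "{0::nat}" "\<lambda>_. UNIV"] by simp
  then show ?thesis using log_dens_multiples[OF k, of UNIV] k by (simp add: field_simps)
qed

lemma log_dens_turan_kubilius: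
  assumes P: "finite P" "\<And>p. p \<in> P \<Longrightarrow> prime p"
  shows "\<bar>\<Sum>p\<in>P. (log_dens {m. p * m \<in> A} - log_dens A) / real p\<bar> \<le> sqrt (recip_sum P)"
proof -
  let ?L = "recip_sum P"
  have p1: "p \<ge> 1" if "p \<in> P" for p using P(2)[OF that] prime_ge_1_nat by blast
  have "\<bar>(\<Sum>p\<in>P. log_dens {n \<in> A. p dvd n}) - ?L * log_dens A\<bar> \<le> 1 * sqrt ?L"
  proof (rule turan_kubilius_limit[OF P, where w = "\<lambda>n. 1 / real n" and M = "\<lambda>N. N" and r = harmonic
      and C = log_count and \<mu> = log_dens])
    show "log_count A N = (\<Sum>n=1..N. 1 / real n * of_bool (n \<in> A))" for A N by (simp only: log_count_def)
    show "log_count UNIV N \<le> 1 * harmonic N" for N using log_count_bounds(2)[of UNIV N] by simp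
  qed (use balanced_log ev_harmonic inverse_harmonic_tendsto log_dens_tendsto in auto)
  moreover have "(\<Sum>p\<in>P. log_dens {n \<in> A. p dvd n}) - ?L * log_dens A
    = (\<Sum>p\<in>P. (log_dens {m. p * m \<in> A} - log_dens A) / real p)"
  proof -
    have "log_dens {n \<in> A. p dvd n} = log_dens {m. p * m \<in> A} / real p" if "p \<in> P" for p
      using log_dens_multiples[OF p1[OF that], of A] p1[OF that] by simp
    then have "(\<Sum>p\<in>P. log_dens {n \<in> A. p dvd n}) = (\<Sum>p\<in>P. log_dens {m. p * m \<in> A} / real p)"
      by (intro sum.cong) auto
    then show ?thesis
      by (simp add: recip_sum_def sum_distrib_right sum_subtractf diff_divide_distrib)
  qed
  ultimately show ?thesis by simp
qed

text \<open>
  By the Turan-Kubilius inequality almost all sections have nearly the logarithmic density \<open>c\<close> of \<open>E\<close>.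
  Being pairwise equal or disjoint, only finitely many sets of density at least \<open>c / 2\<close> can occur, and
  they cannot all belong to thin sets of primes.
\<close>

lemma frequent_section:
  assumes d: "has_natural_density E d" "d > 0"
    and Q: "Q \<subseteq> {p. prime p}" "\<not> thin Q"
    and sect: "\<And>p m. p \<in> Q \<Longrightarrow> m > 0 \<Longrightarrow> \<not> p dvd m \<Longrightarrow> p * m \<in> E \<longleftrightarrow> m \<in> S p"
    and disj: "\<And>p q. p \<in> Q \<Longrightarrow> q \<in> Q \<Longrightarrow> S p = S q \<or> S p \<inter> S q = {}"
  shows "\<exists>p\<in>Q. \<not> thin {q \<in> Q. S q = S p}"
proof (rule ccontr)
  assume "\<not> ?thesis"
  then have cls: "thin {q \<in> Q. S q = S p}" if "p \<in> Q" for p using that by blast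
  define c where "c = log_dens E"
  have c: "c > 0"
  proof -
    have "d / 4 \<le> log_dens E"
    proof (rule tendsto_lowerbound[OF log_dens_tendsto _ nontrivial])
      have "\<forall>\<^sub>F N in F. d / 4 * harmonic N \<le> log_count E N"
        using below_sequentially log_count_lower[OF d] by (rule filter_leD)
      then show "\<forall>\<^sub>F N in F. d / 4 \<le> log_count E N / harmonic N"
        using ev_harmonic by eventually_elim (simp add: le_divide_eq)
    qed
    then show ?thesis using d by (simp add: c_def)
  qed
  \<comment> \<open>The sections are only controlled at positive numbers, so \<open>0\<close> is removed.\<close>
  define S' where "S' p = S p - {0}" for p
  have dev: "\<bar>\<Sum>p\<in>P. (log_dens (S' p) - c) / real p\<bar> \<le> 2 * (sqrt (recip_sum P) + 1)"
    if P: "finite P" "P \<subseteq> Q" for P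
  proof -
    have pr: "prime p" if "p \<in> P" for p using that P Q by auto
    have p1: "p \<ge> 1" if "p \<in> P" for p using pr[OF that] prime_ge_1_nat by blast
    let ?a = "\<lambda>p. log_dens {m. p * m \<in> E}"
    have diff: "\<bar>log_dens (S' p) - ?a p\<bar> \<le> 1 / real p" if p: "p \<in> P" for p
    proof -
      have pQ: "p \<in> Q" using p P by auto
      have zero: "log_dens {0} = 0"
        by (rule ulim_eqI[of "\<lambda>N. log_count {0} N / harmonic N" 0, folded log_dens_def]) (simp add: log_count_def)
      have "log_dens (S' p) \<le> ?a p + log_dens {m. p dvd m}"
        using sect[OF pQ] by (intro log_dens_subadd) (auto simp: S'_def)
      moreover have "?a p \<le> log_dens (S' p \<union> {0}) + log_dens {m. p dvd m}"
        using sect[OF pQ] by (intro log_dens_subadd) (auto simp: S'_def)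
      moreover have "log_dens (S' p \<union> {0}) \<le> log_dens (S' p) + log_dens {0}" by (rule log_dens_subadd) simp
      ultimately show ?thesis using log_dens_dvd_le[OF p1[OF p]] zero by linarith
    qed
    have triangle: "\<bar>x\<bar> \<le> 2 * (s + 1)" if "x = y + z" "\<bar>z\<bar> \<le> 2" "\<bar>y\<bar> \<le> s" "0 \<le> s" for x y z s :: real
    proof -
      have "\<bar>x\<bar> \<le> \<bar>y\<bar> + \<bar>z\<bar>" unfolding that(1) by (rule abs_triangle_ineq)
      also have "\<dots> \<le> s + 2" using that by (intro add_mono)
      also have "\<dots> \<le> 2 * (s + 1)" using that by simp
      finally show ?thesis .
    qed
    have "(\<Sum>p\<in>P. (log_dens (S' p) - c) / real p)
      = (\<Sum>p\<in>P. (?a p - c) / real p) + (\<Sum>p\<in>P. (log_dens (S' p) - ?a p) / real p)"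
      by (simp add: sum.distrib[symmetric] diff_divide_distrib)
    moreover have "\<bar>\<Sum>p\<in>P. (log_dens (S' p) - ?a p) / real p\<bar> \<le> 2"
    proof -
      have "\<bar>\<Sum>p\<in>P. (log_dens (S' p) - ?a p) / real p\<bar> \<le> (\<Sum>p\<in>P. 1 / (real p)\<^sup>2)"
      proof (rule order_trans[OF sum_abs], rule sum_mono)
        fix p assume p: "p \<in> P"
        have "\<bar>log_dens (S' p) - ?a p\<bar> / real p \<le> 1 / real p / real p"
          by (rule divide_right_mono[OF diff[OF p]]) simp
        then show "\<bar>(log_dens (S' p) - ?a p) / real p\<bar> \<le> 1 / (real p)\<^sup>2"
          by (simp add: abs_divide power2_eq_square)
      qed
      also have "\<dots> \<le> 2" using p1 by (intro sum_inverse_squares_le_finite[OF P(1)]) force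
      finally show ?thesis .
    qed
    moreover have "\<bar>\<Sum>p\<in>P. (?a p - c) / real p\<bar> \<le> sqrt (recip_sum P)"
      unfolding c_def by (rule log_dens_turan_kubilius[OF P(1) pr])
    moreover have "0 \<le> sqrt (recip_sum P)" using recip_sum_nonneg[of P] by simp
    ultimately show ?thesis by (rule triangle)
  qed
  define Z where "Z = {p \<in> Q. \<bar>log_dens (S' p) - c\<bar> > c / 2}"
  have "thin Z" unfolding Z_def by (rule thin_if_sqrt_bound[OF dev]) (use c in auto)
  have heavy: "c / 2 \<le> log_dens (S' p)" if "p \<in> Q - Z" for p
  proof -
    have "\<bar>log_dens (S' p) - c\<bar> \<le> c / 2" using that unfolding Z_def by (auto simp: not_less)
    from abs_le_D2[OF this] show ?thesis by simp
  qed
  have fin: "finite (S' ` (Q - Z))"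
  proof (rule ccontr)
    assume inf: "infinite (S' ` (Q - Z))"
    have "0 < c / 2" using c by simp
    then obtain n where n: "1 < real n * (c / 2)" using reals_Archimedean3 by blast
    obtain T where T: "T \<subseteq> S' ` (Q - Z)" "finite T" "card T = n"
      using infinite_arbitrarily_large[OF inf] by blast
    have "real n * (c / 2) = (\<Sum>A\<in>T. c / 2)" using T by simp
    also have "\<dots> \<le> (\<Sum>A\<in>T. log_dens A)" using T heavy by (intro sum_mono) auto
    also have "\<dots> \<le> 1"
    proof (rule log_dens_sum_le_1[OF T(2)])
      fix A B assume AB: "A \<in> T" "B \<in> T" "A \<noteq> B"
      then obtain p q where "p \<in> Q" "q \<in> Q" "A = S' p" "B = S' q" using T by blast
      then show "A \<inter> B = {}" using disj[of p q] AB by (auto simp: S'_def)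
    qed
    finally show False using n by simp
  qed
  have same: "S q = S p" if "p \<in> Q - Z" "q \<in> Q - Z" "S' q = S' p" for p q
  proof -
    have "S' p \<noteq> {}"
    proof
      assume "S' p = {}"
      moreover have "log_dens {} = 0"
        by (rule ulim_eqI[of "\<lambda>N. log_count {} N / harmonic N" 0, folded log_dens_def]) (simp add: log_count_def)
      ultimately show False using heavy[OF that(1)] c by simp
    qed
    then have "S q \<inter> S p \<noteq> {}" using that by (auto simp: S'_def)
    then show ?thesis using disj[of q p] that by blast
  qed
  obtain R where R: "R \<subseteq> Q - Z" "finite R" "S' ` (Q - Z) = S' ` R"
    using fin by (meson finite_subset_image order_refl)
  have "thin (\<Union>p\<in>R. {q \<in> Q. S q = S p})" using R cls by (intro thin_UN) auto
  then have "thin ((\<Union>p\<in>R. {q \<in> Q. S q = S p}) \<union> Z)" using \<open>thin Z\<close> by (rule thin_Un)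
  then have "thin Q"
  proof (rule thin_subset, intro subsetI)
    fix q assume q: "q \<in> Q"
    show "q \<in> (\<Union>p\<in>R. {q \<in> Q. S q = S p}) \<union> Z"
    proof (cases "q \<in> Z")
      case False
      then have "S' q \<in> S' ` R" using q R(3) by blast
      then obtain p where p: "p \<in> R" "S' q = S' p" by blast
      then have "S q = S p" using same[of p q] R q False by blast
      then show ?thesis using p q by blast
    qed simp
  qed
  then show False using Q by simp
qed

end

lemma ex_ultra: "\<exists>F. ultra F"
proof -
  from ultrafilter_below[OF trivial_limit_sequentially] obtain F where
    "F \<le> sequentially \<and> F \<noteq> bot \<and> (\<forall>P. eventually P F \<or> eventually (\<lambda>x. \<not> P x) F)" by (rule exE)
  then have "ultra F" by unfold_locales auto
  then show ?thesis ..
qed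

text \<open>
  There are finitely many patterns of zeros of \<open>f i p\<close>, so one of them belongs to a set of primes
  that is not thin. For two primes of this pattern whose sections have a common element \<open>m\<close>, either
  \<open>z i = 0\<close>, and the pattern alone determines the condition on \<open>f i\<close>, or \<open>f i m\<close> is nonzero and \<open>f i p = f i q\<close>.
\<close>

lemma level_set_sieve_stable:
  assumes pr: "\<not> thin {p :: nat. prime p}"
    and I: "finite I" and f: "\<And>i. i \<in> I \<Longrightarrow> multiplicative (f i)"
    and E: "E = {n. 0 < n \<and> (\<forall>i\<in>I. f i n = z i)}"
    and d: "has_natural_density E d" "d > 0"
  shows "sieve_stable E"
proof -
  define zeros where "zeros p = {i \<in> I. f i p = 0}" for p
  have "\<exists>J\<in>Pow I. \<not> thin {p. prime p \<and> zeros p = J}"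
  proof (rule ccontr)
    assume "\<not> ?thesis"
    then have "thin (\<Union>J\<in>Pow I. {p. prime p \<and> zeros p = J})" using I by (intro thin_UN) auto
    then have "thin {p :: nat. prime p}"
    proof (rule thin_subset, intro subsetI)
      fix p :: nat assume "p \<in> {p. prime p}"
      moreover have "zeros p \<in> Pow I" by (auto simp: zeros_def)
      ultimately show "p \<in> (\<Union>J\<in>Pow I. {p. prime p \<and> zeros p = J})" by blast
    qed
    then show False using pr by simp
  qed
  then obtain J where J: "\<not> thin {p. prime p \<and> zeros p = J}" by blast
  define Q where "Q = {p. prime p \<and> zeros p = J}"
  define S where "S p = {m. \<forall>i\<in>I. f i p * f i m = z i}" for p
  have Q: "Q \<subseteq> {p. prime p}" "\<not> thin Q" using J by (auto simp: Q_def)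
  have sec: "p * m \<in> E \<longleftrightarrow> m \<in> S p" if "p \<in> Q" "m > 0" "\<not> p dvd m" for p m
    using that f multiplicative_prime[of _ p m] prime_gt_0_nat[of p] by (auto simp: E S_def Q_def)
  have disj: "S p = S q \<or> S p \<inter> S q = {}" if pq: "p \<in> Q" "q \<in> Q" for p q
  proof (cases "S p \<inter> S q = {}")
    case False
    then obtain m where m: "\<And>i. i \<in> I \<Longrightarrow> f i p * f i m = z i" "\<And>i. i \<in> I \<Longrightarrow> f i q * f i m = z i"
      by (auto simp: S_def)
    have "f i p * f i n = z i \<longleftrightarrow> f i q * f i n = z i" if i: "i \<in> I" for i n
    proof -
      have z0: "f i p = 0 \<longleftrightarrow> f i q = 0"
        using pq i unfolding Q_def zeros_def by blast
      show ?thesis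
      proof (cases "z i = 0")
        case True
        then show ?thesis using z0 by simp
      next
        case False
        then have "f i p = f i q" using m[OF i] by (metis mult_cancel_right mult_zero_right)
        then show ?thesis by simp
      qed
    qed
    then show ?thesis by (auto simp: S_def)
  qed simp
  obtain F where "ultra F" using ex_ultra by blast
  then obtain p where p: "p \<in> Q" "\<not> thin {q \<in> Q. S q = S p}"
    using ultra.frequent_section[OF _ d Q sec disj] by blast
  show ?thesis
    by (rule sieve_stable_exactI[OF _ p(2), of E "S p"]) (use Q sec in auto)
qed

section \<open>Accumulation of the values of a multiplicative function\<close>

definition recurrent :: "real \<Rightarrow> bool" where
  "recurrent r \<longleftrightarrow> (\<forall>Z \<nu>. thin Z \<longrightarrow> 0 < \<nu> \<longrightarrow>
    (\<exists>p q. prime p \<and> prime q \<and> p \<notin> Z \<and> q \<notin> Z \<and> \<bar>real q / real p - r\<bar> < \<nu>))"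

text \<open>
  Compactness turns the interval of ratios from \<open>prime_ratio\<close> into a single ratio: otherwise every
  ratio in the interval would be avoided, with some tolerance, outside a thin set, and finitely many
  of these thin sets would be enough for the whole interval.
\<close>

lemma recurrent_ratio:
  assumes k: "0 < \<kappa>"
  shows "\<exists>r>1. r \<le> 1 + \<kappa> \<and> recurrent r"
proof -
  obtain \<kappa>' where A: "0 < \<kappa>' \<and> \<kappa>' < \<kappa> \<and> (\<forall>Z. thin Z \<longrightarrow> (\<exists>p q. prime p \<and> prime q \<and> p \<notin> Z \<and> q \<notin> Z \<and>
       (1 + \<kappa>') * real p \<le> real q \<and> real q \<le> (1 + \<kappa>) * real p))"
    using prime_ratio[OF k] by (rule exE)
  note k' = A[THEN conjunct1] A[THEN conjunct2, THEN conjunct1]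
    and pq' = A[THEN conjunct2, THEN conjunct2]
  note pq = pq'[rule_format]
  let ?I = "{1 + \<kappa>'..1 + \<kappa>}"
  define hit where "hit r Z \<nu> \<longleftrightarrow> (\<exists>p q. prime p \<and> prime q \<and> p \<notin> Z \<and> q \<notin> Z \<and> \<bar>real q / real p - r\<bar> < \<nu>)" for r Z \<nu>
  have "\<exists>r\<in>?I. \<forall>Z \<nu>. thin Z \<longrightarrow> 0 < \<nu> \<longrightarrow> hit r Z \<nu>"
  proof (rule ccontr)
    assume "\<not> ?thesis"
    then have "\<forall>r. \<exists>Z \<nu>. r \<in> ?I \<longrightarrow> thin Z \<and> 0 < \<nu> \<and> \<not> hit r Z \<nu>" by blast
    then obtain Z \<nu> where "\<forall>r. r \<in> ?I \<longrightarrow> thin (Z r) \<and> 0 < \<nu> r \<and> \<not> hit r (Z r) (\<nu> r)"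
      unfolding choice_iff by (elim exE)
    then have Z: "\<And>r. r \<in> ?I \<Longrightarrow> thin (Z r)" and \<nu>: "\<And>r. r \<in> ?I \<Longrightarrow> 0 < \<nu> r"
      and avoid: "\<And>r. r \<in> ?I \<Longrightarrow> \<not> hit r (Z r) (\<nu> r)" by blast+
    have "compact ?I" by simp
    then obtain C where C: "C \<subseteq> ?I" "finite C" "?I \<subseteq> (\<Union>r\<in>C. ball r (\<nu> r))"
      by (rule compactE_image[of ?I ?I "\<lambda>r. ball r (\<nu> r)"]) (use \<nu> in auto)
    have "thin (\<Union>r\<in>C. Z r)" using C Z by (intro thin_UN) auto
    then obtain p q where p: "prime p" "prime q" "p \<notin> (\<Union>r\<in>C. Z r)" "q \<notin> (\<Union>r\<in>C. Z r)"
      "(1 + \<kappa>') * real p \<le> real q" "real q \<le> (1 + \<kappa>) * real p" using pq by blast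
    have "real p > 0" using p(1) prime_gt_0_nat by simp
    then have "real q / real p \<in> ?I" using p by (simp add: le_divide_eq divide_le_eq)
    then obtain r where r: "r \<in> C" "\<bar>real q / real p - r\<bar> < \<nu> r" using C(3) by (auto simp: dist_real_def abs_minus_commute)
    then have "hit r (Z r) (\<nu> r)" unfolding hit_def using p by (intro exI[of _ p] exI[of _ q]) simp
    then show False using avoid[of r] C(1) r(1) by blast
  qed
  then obtain r where "r \<in> ?I" "\<forall>Z \<nu>. thin Z \<longrightarrow> 0 < \<nu> \<longrightarrow> hit r Z \<nu>" ..
  then show ?thesis using k' unfolding hit_def recurrent_def by (intro exI[of _ r]) simp
qed

locale ultra_multiplicative = ultra +
  fixes g :: "nat \<Rightarrow> complex"
  assumes mult: "multiplicative g" and bd: "\<And>n. n > 0 \<Longrightarrow> cmod (g n) \<le> 1"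
    and nz: "thin {p. prime p \<and> g p = 0}"
begin

text \<open>
  \<open>law s\<close> is the limiting distribution of \<open>g n\<close> for \<open>n \<le> s * N\<close>, a finitely additive measure of total mass \<open>s\<close>.
  An atom is defined through shrinking balls and not as \<open>law s {\<phi>}\<close>, since the values may accumulate at
  \<open>\<phi>\<close> without being equal to it; \<open>mass\<close> is the size of the atom after normalisation to total mass \<open>1\<close>.
\<close>

definition law :: "real \<Rightarrow> complex set \<Rightarrow> real" where
  "law s S = dens s {n. 0 < n \<and> g n \<in> S}"

definition atom :: "real \<Rightarrow> complex \<Rightarrow> real" where
  "atom s \<phi> = (INF \<delta>\<in>{0<..}. law s (ball \<phi> \<delta>))"

definition mass :: "real \<Rightarrow> complex \<Rightarrow> real" where
  "mass s \<phi> = atom s \<phi> / s"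

lemma law_nonneg: "0 \<le> s \<Longrightarrow> 0 \<le> law s S" unfolding law_def by (rule dens_nonneg)

lemma law_le: "0 \<le> s \<Longrightarrow> law s S \<le> s" unfolding law_def by (rule dens_le)

lemma law_mono: "0 \<le> s \<Longrightarrow> S \<subseteq> T \<Longrightarrow> law s S \<le> law s T"
  unfolding law_def by (rule dens_mono) auto

lemma law_Un_le: "0 \<le> s \<Longrightarrow> S \<inter> T = {} \<Longrightarrow> S \<union> T \<subseteq> U \<Longrightarrow> law s S + law s T \<le> law s U"
proof -
  assume s: "0 \<le> s" and ST: "S \<inter> T = {}" and U: "S \<union> T \<subseteq> U"
  have "law s S + law s T = dens s ({n. 0 < n \<and> g n \<in> S} \<union> {n. 0 < n \<and> g n \<in> T})"
    unfolding law_def using s ST by (intro dens_Un[symmetric]) auto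
  also have "\<dots> \<le> law s U" unfolding law_def using s U by (intro dens_mono) auto
  finally show ?thesis .
qed

lemma law_outside: "0 \<le> s \<Longrightarrow> S \<inter> cball 0 1 = {} \<Longrightarrow> law s S = 0"
proof -
  assume s: "0 \<le> s" and S: "S \<inter> cball 0 1 = {}"
  have "{n. 0 < n \<and> g n \<in> S} = {}" using S bd by (auto simp: disjoint_iff)
  moreover have "dens s {} = 0" using dens_Un[OF s, of "{}" "{}"] by simp
  ultimately show ?thesis by (simp only: law_def)
qed

lemma law_turan_kubilius:
  assumes s: "0 < s" and P: "finite P" "\<And>p. p \<in> P \<Longrightarrow> prime p"
  shows "\<bar>\<Sum>p\<in>P. (real p * law (s / real p) {w. g p * w \<in> S} - law s S) / real p\<bar>
    \<le> 2 * s * (sqrt (recip_sum P) + 1)"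
proof -
  let ?A = "{n. 0 < n \<and> g n \<in> S}"
  let ?a = "\<lambda>p. dens (s / real p) {m. p * m \<in> ?A}"
  let ?b = "\<lambda>p. law (s / real p) {w. g p * w \<in> S}"
  have p1: "p \<ge> 1" if "p \<in> P" for p using P(2)[OF that] prime_ge_1_nat by blast
  have diff: "\<bar>?b p - ?a p\<bar> \<le> s * (1 / (real p)\<^sup>2)" if p: "p \<in> P" for p
  proof -
    have prp: "prime p" by (rule P(2)[OF p])
    have gp: "g (p * m) = g p * g m" if "m > 0" "\<not> p dvd m" for m
      by (rule multiplicative_prime[OF mult prp that])
    have sp: "0 \<le> s / real p" using s by simp
    have "?b p \<le> ?a p + dens (s / real p) {m. p dvd m}"
      unfolding law_def using gp p1[OF p] by (intro dens_subadd sp) auto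
    moreover have "?a p \<le> ?b p + dens (s / real p) {m. p dvd m}"
      unfolding law_def using gp by (intro dens_subadd sp) auto
    moreover have "dens (s / real p) {m. p dvd m} \<le> s / real p / real p"
      using p1[OF p] sp by (intro dens_UNIV)
    ultimately show ?thesis by (simp add: power2_eq_square)
  qed
  have "(\<Sum>p\<in>P. (real p * ?b p - law s S) / real p)
    = (\<Sum>p\<in>P. (real p * ?a p - law s S) / real p) + (\<Sum>p\<in>P. ?b p - ?a p)"
    unfolding sum.distrib[symmetric] using p1 by (intro sum.cong refl) (force simp: field_simps)
  moreover have "\<bar>\<Sum>p\<in>P. ?b p - ?a p\<bar> \<le> 2 * s"
  proof -
    have "\<bar>\<Sum>p\<in>P. ?b p - ?a p\<bar> \<le> (\<Sum>p\<in>P. s * (1 / (real p)\<^sup>2))"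
      by (rule order_trans[OF sum_abs]) (rule sum_mono[OF diff])
    also have "\<dots> = s * (\<Sum>p\<in>P. 1 / (real p)\<^sup>2)" by (simp add: sum_distrib_left)
    also have "\<dots> \<le> s * 2"
      using s p1 by (intro mult_left_mono sum_inverse_squares_le_finite[OF P(1)]) force+
    finally show ?thesis by simp
  qed
  moreover have "\<bar>\<Sum>p\<in>P. (real p * ?a p - law s S) / real p\<bar> \<le> s * sqrt (recip_sum P)"
    unfolding law_def by (rule dens_turan_kubilius[OF s P])
  moreover have "0 \<le> s * sqrt (recip_sum P)" using s recip_sum_nonneg[of P] by simp
  ultimately show ?thesis by (simp add: algebra_simps)
qed

lemma law_ball_bdd: "0 \<le> s \<Longrightarrow> bdd_below ((\<lambda>\<delta>. law s (ball \<phi> \<delta>)) ` {0<..})"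
  by (rule bdd_belowI2[of _ 0]) (rule law_nonneg)

lemma atom_le_law: 
  assumes "0 \<le> s" "open S" "\<phi> \<in> S"
  shows "atom s \<phi> \<le> law s S"
proof -
  obtain \<delta> where d: "\<delta> > 0" "ball \<phi> \<delta> \<subseteq> S" using assms openE by blast
  have "atom s \<phi> \<le> law s (ball \<phi> \<delta>)"
    unfolding atom_def using d by (intro cINF_lower law_ball_bdd assms) auto
  also have "\<dots> \<le> law s S" using d assms by (intro law_mono)
  finally show ?thesis .
qed

lemma atom_greatest: "(\<And>\<delta>. 0 < \<delta> \<Longrightarrow> c \<le> law s (ball \<phi> \<delta>)) \<Longrightarrow> c \<le> atom s \<phi>"
  unfolding atom_def by (rule cINF_greatest) auto

lemma atom_nonneg: "0 \<le> s \<Longrightarrow> 0 \<le> atom s \<phi>"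
  by (rule atom_greatest) (rule law_nonneg)

lemma atom_lessD: 
  assumes "0 \<le> s" "atom s \<phi> < c"
  obtains \<delta> where "\<delta> > 0" "law s (ball \<phi> \<delta>) < c"
proof -
  have "\<exists>x\<in>(\<lambda>\<delta>. law s (ball \<phi> \<delta>)) ` {0<..}. x < c"
    by (rule cInf_lessD) (use assms in \<open>auto simp: atom_def\<close>)
  then show thesis using that by auto
qed

lemma atom_tendsto:
  assumes "0 \<le> s"
  shows "((\<lambda>\<delta>. law s (ball \<phi> \<delta>)) \<longlongrightarrow> atom s \<phi>) (at_right 0)"
proof (rule order_tendstoI)
  fix a assume a: "a < atom s \<phi>"
  have "\<forall>\<^sub>F \<delta> in at_right 0. (\<delta>::real) > 0" by (rule eventually_at_right_less)
  then show "\<forall>\<^sub>F \<delta> in at_right 0. a < law s (ball \<phi> \<delta>)"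
  proof eventually_elim
    case (elim \<delta>)
    have "atom s \<phi> \<le> law s (ball \<phi> \<delta>)" using elim assms by (intro atom_le_law) auto
    then show ?case using a by simp
  qed
next
  fix a assume a: "atom s \<phi> < a"
  then obtain d where d: "d > 0" "law s (ball \<phi> d) < a" using atom_lessD[OF assms] by blast
  have "\<forall>\<^sub>F \<delta> in at_right 0. \<delta> \<in> {0<..<d}" using d by (intro eventually_at_right_real)
  then show "\<forall>\<^sub>F \<delta> in at_right 0. law s (ball \<phi> \<delta>) < a"
  proof eventually_elim
    case (elim \<delta>)
    have "law s (ball \<phi> \<delta>) \<le> law s (ball \<phi> d)" using elim assms by (intro law_mono subset_ball) auto
    then show ?case using d by simp
  qed
qed

lemma sum_atom_le_law:
  assumes s: "0 \<le> s" and "finite \<Phi>" "open S" "\<Phi> \<subseteq> S"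
  shows "(\<Sum>\<phi>\<in>\<Phi>. atom s \<phi>) \<le> law s S"
  using assms(2-4)
proof (induction \<Phi> arbitrary: S rule: finite_induct)
  case empty
  then show ?case using law_nonneg[OF s] by simp
next
  case (insert \<phi> \<Phi>)
  have "open (S - \<Phi>)" using insert by (intro open_Diff finite_imp_closed)
  moreover have "\<phi> \<in> S - \<Phi>" using insert by auto
  ultimately obtain d where d: "d > 0" "cball \<phi> d \<subseteq> S - \<Phi>" unfolding open_contains_cball by blast
  have "(\<Sum>\<phi>\<in>\<Phi>. atom s \<phi>) \<le> law s (S - cball \<phi> d)"
    using insert d by (intro insert.IH open_Diff) auto
  moreover have "atom s \<phi> \<le> law s (ball \<phi> d)" using d s by (intro atom_le_law) auto
  moreover have "law s (ball \<phi> d) + law s (S - cball \<phi> d) \<le> law s S"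
  proof (rule law_Un_le[OF s])
    show "ball \<phi> d \<union> (S - cball \<phi> d) \<subseteq> S" using d(2) ball_subset_cball[of \<phi> d] by blast
  qed auto
  ultimately show ?case using insert by simp
qed

lemma atom_diff:
  assumes "0 \<le> s" "s \<le> t"
  shows "atom s \<phi> \<le> atom t \<phi>" "atom t \<phi> \<le> atom s \<phi> + (t - s)"
proof -
  show "atom s \<phi> \<le> atom t \<phi>"
    by (rule tendsto_le[OF _ atom_tendsto atom_tendsto])
      (use assms in \<open>auto intro!: always_eventually dens_diff simp: law_def\<close>)
  have "((\<lambda>\<delta>. law s (ball \<phi> \<delta>) + (t - s)) \<longlongrightarrow> atom s \<phi> + (t - s)) (at_right 0)"
    using assms by (intro tendsto_intros atom_tendsto)
  moreover have "((\<lambda>\<delta>. law t (ball \<phi> \<delta>)) \<longlongrightarrow> atom t \<phi>) (at_right 0)"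
    using assms by (intro atom_tendsto) auto
  moreover have "\<forall>\<^sub>F \<delta> in at_right 0. law t (ball \<phi> \<delta>) \<le> law s (ball \<phi> \<delta>) + (t - s)"
    using assms by (intro always_eventually allI) (simp only: law_def dens_diff(2))
  ultimately show "atom t \<phi> \<le> atom s \<phi> + (t - s)"
    by (rule tendsto_le[OF trivial_limit_at_right_real])
qed

lemma atom_outside: "0 \<le> s \<Longrightarrow> 1 < cmod \<phi> \<Longrightarrow> atom s \<phi> = 0"
proof -
  assume s: "0 \<le> s" and p: "1 < cmod \<phi>"
  have "atom s \<phi> \<le> law s (- cball 0 1)" using p s by (intro atom_le_law) auto
  also have "\<dots> = 0" using s by (intro law_outside) auto
  finally show ?thesis using atom_nonneg[OF s, of \<phi>] by simp
qed

lemma scaled_ball: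
  assumes "c \<noteq> 0"
  shows "{w. c * w \<in> ball \<phi> \<delta>} = ball (\<phi> / c) (\<delta> / cmod c)"
proof -
  have "dist \<phi> (c * w) = cmod c * dist (\<phi> / c) w" for w
  proof -
    have "\<phi> - c * w = c * (\<phi> / c - w)" using assms by (simp add: algebra_simps)
    then show ?thesis by (simp add: dist_norm norm_mult)
  qed
  then show ?thesis using assms by (auto simp: field_simps)
qed

lemma atom_turan_kubilius:
  assumes s: "0 < s" and P: "finite P" "\<And>p. p \<in> P \<Longrightarrow> prime p \<and> g p \<noteq> 0"
  shows "\<bar>\<Sum>p\<in>P. (real p * atom (s / real p) (\<phi> / g p) - atom s \<phi>) / real p\<bar>
    \<le> 2 * s * (sqrt (recip_sum P) + 1)"
proof (rule tendsto_upperbound)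
  have "((\<lambda>\<delta>. law (s / real p) {w. g p * w \<in> ball \<phi> \<delta>}) \<longlongrightarrow> atom (s / real p) (\<phi> / g p)) (at_right 0)"
    if p: "p \<in> P" for p
  proof -
    have gp: "g p \<noteq> 0" and c: "cmod (g p) > 0" using P(2)[OF p] by simp_all
    have "filterlim (\<lambda>\<delta>. \<delta> / cmod (g p)) (at_right 0) (at_right 0)"
    proof (rule filterlim_at_withinI)
      show "((\<lambda>\<delta>. \<delta> / cmod (g p)) \<longlongrightarrow> 0) (at_right 0)"
        using tendsto_divide[OF tendsto_ident_at tendsto_const, of "cmod (g p)" 0 "{0<..}"] c by simp
      show "\<forall>\<^sub>F \<delta> in at_right 0. \<delta> / cmod (g p) \<in> {0<..} - {0}"
        using eventually_at_right_less[of "0::real"] by eventually_elim (use c in simp)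
    qed
    moreover have "((\<lambda>\<delta>. law (s / real p) (ball (\<phi> / g p) \<delta>)) \<longlongrightarrow> atom (s / real p) (\<phi> / g p)) (at_right 0)"
      using s by (intro atom_tendsto) simp
    ultimately show ?thesis unfolding scaled_ball[OF gp] by (rule filterlim_compose[rotated])
  qed
  then show "((\<lambda>\<delta>. \<bar>\<Sum>p\<in>P. (real p * law (s / real p) {w. g p * w \<in> ball \<phi> \<delta>} - law s (ball \<phi> \<delta>)) / real p\<bar>)
    \<longlongrightarrow> \<bar>\<Sum>p\<in>P. (real p * atom (s / real p) (\<phi> / g p) - atom s \<phi>) / real p\<bar>) (at_right 0)"
    using s P(2) by (intro tendsto_intros atom_tendsto) (auto simp: prime_gt_0_nat)
  show "\<forall>\<^sub>F \<delta> in at_right 0. \<bar>\<Sum>p\<in>P. (real p * law (s / real p) {w. g p * w \<in> ball \<phi> \<delta>} - law s (ball \<phi> \<delta>)) / real p\<bar>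
    \<le> 2 * s * (sqrt (recip_sum P) + 1)"
    by (intro always_eventually allI law_turan_kubilius s P) (use P in auto)
qed simp

text \<open>
  For a single \<open>\<phi>\<close> this is the Turan-Kubilius inequality. Uniformity comes from a finite cover of the disc
  by balls that carry little more than the atom at their centre. For almost all \<open>p\<close> this remains
  true at the scale \<open>s / p\<close> after division by \<open>g p\<close>, and then no other point of the ball has room for an
  atom of size \<open>\<epsilon>\<close>.
\<close>

lemma thin_atom_deviation:
  assumes s: "0 < s" and e: "0 < \<epsilon>"
  shows "thin {p. prime p \<and> (g p = 0 \<or> (\<exists>\<phi>. \<bar>real p * atom (s / real p) (\<phi> / g p) - atom s \<phi>\<bar> > \<epsilon>))}"
proof -
  have s0: "0 \<le> s" using s by simp
  let ?Q = "{p. prime p \<and> g p \<noteq> 0}"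
  have "\<exists>\<delta>>0. law s (ball \<phi> \<delta>) < atom s \<phi> + \<epsilon> / 4" for \<phi>
    using atom_lessD[OF s0, of \<phi> "atom s \<phi> + \<epsilon> / 4"] e by auto
  then obtain \<delta> where d: "\<And>\<phi>. \<delta> \<phi> > 0" "\<And>\<phi>. law s (ball \<phi> (\<delta> \<phi>)) < atom s \<phi> + \<epsilon> / 4" by metis
  have "compact (cball (0::complex) 1)" by simp
  then obtain \<Phi> where \<Phi>: "finite \<Phi>" "cball 0 1 \<subseteq> (\<Union>\<phi>\<in>\<Phi>. ball \<phi> (\<delta> \<phi>))"
    by (rule compactE_image[of _ "cball 0 1" "\<lambda>\<phi>. ball \<phi> (\<delta> \<phi>)"]) (use d in auto)
  define Z1 where "Z1 \<phi> = {p\<in>?Q. \<bar>real p * atom (s / real p) (\<phi> / g p) - atom s \<phi>\<bar> > \<epsilon> / 4}" for \<phi>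
  define Z2 where "Z2 \<phi> = {p\<in>?Q. \<bar>real p * law (s / real p) {w. g p * w \<in> ball \<phi> (\<delta> \<phi>)} - law s (ball \<phi> (\<delta> \<phi>))\<bar> > \<epsilon> / 4}" for \<phi>
  have Z1: "thin (Z1 \<phi>)" for \<phi>
    unfolding Z1_def
    by (rule thin_if_sqrt_bound[where C = "2 * s"], rule atom_turan_kubilius[OF s]) (use e in auto)
  have Z2: "thin (Z2 \<phi>)" for \<phi>
    unfolding Z2_def
    by (rule thin_if_sqrt_bound[where C = "2 * s"], rule law_turan_kubilius[OF s]) (use e in auto)
  have "thin ({p. prime p \<and> g p = 0} \<union> (\<Union>\<phi>\<in>\<Phi>. Z1 \<phi>) \<union> (\<Union>\<phi>\<in>\<Phi>. Z2 \<phi>))"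
    using Z1 Z2 nz \<Phi> by (intro thin_Un thin_UN)
  then show ?thesis
  proof (rule thin_subset, safe)
    fix p \<psi>
    assume p: "prime p" and big: "\<epsilon> < \<bar>real p * atom (s / real p) (\<psi> / g p) - atom s \<psi>\<bar>"
      and nZ2: "p \<notin> (\<Union>\<phi>\<in>\<Phi>. Z2 \<phi>)" and nZ1: "p \<notin> (\<Union>\<phi>\<in>\<Phi>. Z1 \<phi>)"
    show "g p = 0"
    proof (rule ccontr)
      assume gp: "g p \<noteq> 0"
      have pp: "real p > 0" using p prime_gt_0_nat by simp
      have sp: "0 \<le> s / real p" using s by simp
      have lp: "cmod (g p) \<le> 1" using bd p prime_gt_0_nat by blast
      let ?A = "\<lambda>\<phi>. real p * atom (s / real p) (\<phi> / g p)"
      have A0: "0 \<le> ?A \<phi>" for \<phi> using atom_nonneg[OF sp] pp by simp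
      have good: "\<bar>?A \<phi> - atom s \<phi>\<bar> \<le> \<epsilon> / 4"
        "\<bar>real p * law (s / real p) {w. g p * w \<in> ball \<phi> (\<delta> \<phi>)} - law s (ball \<phi> (\<delta> \<phi>))\<bar> \<le> \<epsilon> / 4" if "\<phi> \<in> \<Phi>" for \<phi>
        using nZ1 nZ2 that p gp unfolding Z1_def Z2_def by (auto simp: not_less)
      show False
      proof (cases "cmod \<psi> \<le> 1")
        case False
        have "1 < cmod (\<psi> / g p)"
        proof -
          have "cmod \<psi> / 1 \<le> cmod \<psi> / cmod (g p)" using lp gp by (intro divide_left_mono) auto
          then show ?thesis using False by (simp add: norm_divide)
        qed
        then have "atom (s / real p) (\<psi> / g p) = 0" by (intro atom_outside sp)
        moreover have "atom s \<psi> = 0" using False by (intro atom_outside s0) auto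
        ultimately show False using big e by simp
      next
        case True
        then obtain \<phi> where \<phi>: "\<phi> \<in> \<Phi>" "\<psi> \<in> ball \<phi> (\<delta> \<phi>)" using \<Phi>(2) by auto
        show False
        proof (cases "\<psi> = \<phi>")
          case True
          then show False using good(1)[OF \<phi>(1)] big e by simp
        next
          case False
          have two: "atom s \<psi> + atom s \<phi> \<le> law s (ball \<phi> (\<delta> \<phi>))"
            using sum_atom_le_law[OF s0, of "{\<psi>, \<phi>}" "ball \<phi> (\<delta> \<phi>)"] \<phi> d(1) False by simp
          let ?B = "{w. g p * w \<in> ball \<phi> (\<delta> \<phi>)}"
          have "open ?B" unfolding scaled_ball[OF gp] by simp
          moreover have "{\<psi> / g p, \<phi> / g p} \<subseteq> ?B" using \<phi> d(1) gp by simp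
          moreover have "\<psi> / g p \<noteq> \<phi> / g p" using False gp by simp
          ultimately have "atom (s / real p) (\<psi> / g p) + atom (s / real p) (\<phi> / g p) \<le> law (s / real p) ?B"
            using sum_atom_le_law[OF sp, of "{\<psi> / g p, \<phi> / g p}" ?B] by simp
          then have "real p * (atom (s / real p) (\<psi> / g p) + atom (s / real p) (\<phi> / g p)) \<le> real p * law (s / real p) ?B"
            using pp by (intro mult_left_mono) auto
          then have "?A \<psi> + ?A \<phi> \<le> real p * law (s / real p) ?B" by (simp add: distrib_left)
          then have "?A \<psi> \<le> 3 * \<epsilon> / 4" using good[OF \<phi>(1)] d(2)[of \<phi>] by linarith
          moreover have "atom s \<psi> \<le> \<epsilon> / 4" using two d(2)[of \<phi>] by linarith
          ultimately show False using big A0[of \<psi>] atom_nonneg[OF s0, of \<psi>] e by linarith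
        qed
      qed
    qed
  qed
qed

lemma thin_mass_deviation:
  assumes s: "0 < s" and e: "0 < \<epsilon>"
  shows "thin {p. prime p \<and> (g p = 0 \<or> (\<exists>\<phi>. \<bar>mass (s / real p) (\<phi> / g p) - mass s \<phi>\<bar> > \<epsilon>))}"
proof (rule thin_subset[OF thin_atom_deviation[OF s, of "\<epsilon> * s"]])
  show "0 < \<epsilon> * s" using s e by simp
  have key: "\<bar>mass (s / real p) \<psi> - mass s \<phi>\<bar> * s = \<bar>real p * atom (s / real p) \<psi> - atom s \<phi>\<bar>" for p \<psi> \<phi>
  proof -
    have "(mass (s / real p) \<psi> - mass s \<phi>) * s = real p * atom (s / real p) \<psi> - atom s \<phi>"
      using s by (cases "p = 0") (simp_all add: mass_def field_simps)
    then show ?thesis using s abs_mult[of "mass (s / real p) \<psi> - mass s \<phi>" s] by simp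
  qed
  have "\<epsilon> < \<bar>mass (s / real p) \<psi> - mass s \<phi>\<bar> \<longleftrightarrow> \<epsilon> * s < \<bar>real p * atom (s / real p) \<psi> - atom s \<phi>\<bar>" for p \<psi> \<phi>
    unfolding key[symmetric] using s by (rule mult_less_cancel_right_pos[symmetric])
  then show "{p. prime p \<and> (g p = 0 \<or> (\<exists>\<phi>. \<bar>mass (s / real p) (\<phi> / g p) - mass s \<phi>\<bar> > \<epsilon>))}
    \<subseteq> {p. prime p \<and> (g p = 0 \<or> (\<exists>\<phi>. \<bar>real p * atom (s / real p) (\<phi> / g p) - atom s \<phi>\<bar> > \<epsilon> * s))}"
    by (simp only: order_refl)
qed

lemma mass_nonneg: "0 < s \<Longrightarrow> 0 \<le> mass s \<phi>"
  unfolding mass_def using atom_nonneg[of s \<phi>] by simp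

lemma mass_lipschitz:
  assumes "0 < a" "0 < b"
  shows "\<bar>mass a \<phi> - mass b \<phi>\<bar> \<le> \<bar>a - b\<bar> / b"
proof -
  have main: "\<bar>mass a \<phi> - mass b \<phi>\<bar> \<le> (b - a) / b" if "0 < a" "a \<le> b" for a b
  proof -
    have b: "0 < b" using that by simp
    have 1: "atom a \<phi> \<le> atom b \<phi>" "atom b \<phi> \<le> atom a \<phi> + (b - a)" using atom_diff[of a b] that by auto
    have "atom a \<phi> \<le> a"
      using atom_le_law[of a UNIV \<phi>] law_le[of a UNIV] that by simp
    then have "atom a \<phi> * (b - a) \<le> a * (b - a)" using that by (intro mult_right_mono) auto
    moreover have "0 \<le> atom a \<phi> * (b - a)" using that atom_nonneg[of a \<phi>] by simp
    moreover have "a * atom a \<phi> \<le> a * atom b \<phi>" "a * atom b \<phi> \<le> a * (atom a \<phi> + (b - a))"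
      using 1 that by (auto intro: mult_left_mono)
    ultimately have num: "\<bar>b * atom a \<phi> - a * atom b \<phi>\<bar> \<le> a * (b - a)" by (simp add: algebra_simps abs_le_iff)
    have "mass a \<phi> - mass b \<phi> = (b * atom a \<phi> - a * atom b \<phi>) / (a * b)"
      using that b by (simp add: mass_def field_simps)
    then have "\<bar>mass a \<phi> - mass b \<phi>\<bar> = \<bar>b * atom a \<phi> - a * atom b \<phi>\<bar> / (a * b)"
      using that b by (simp add: abs_divide)
    also have "\<dots> \<le> a * (b - a) / (a * b)" using num that b by (intro divide_right_mono) auto
    also have "\<dots> = (b - a) / b" using that by simp
    finally show ?thesis .
  qed
  show ?thesis
  proof (cases "a \<le> b")
    case True
    then show ?thesis using main[of a b] assms by simp
  next
    case False
    then have "\<bar>mass a \<phi> - mass b \<phi>\<bar> \<le> (a - b) / a" using main[of b a] assms by (simp add: abs_minus_commute)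
    also have "\<dots> \<le> (a - b) / b" using False assms by (intro divide_left_mono) auto
    finally show ?thesis using False by simp
  qed
qed

lemma finite_heavy: 
  assumes "0 < c" 
  shows "finite {\<phi>. c \<le> mass 1 \<phi>}"
proof (rule ccontr)
  assume inf: "infinite {\<phi>. c \<le> mass 1 \<phi>}"
  obtain n where n: "1 < real n * c" using reals_Archimedean3[OF assms] by blast
  obtain T where T: "T \<subseteq> {\<phi>. c \<le> mass 1 \<phi>}" "finite T" "card T = n"
    using infinite_arbitrarily_large[OF inf] by blast
  have "real n * c = (\<Sum>\<phi>\<in>T. c)" using T by simp
  also have "\<dots> \<le> (\<Sum>\<phi>\<in>T. atom 1 \<phi>)" using T by (intro sum_mono) (auto simp: mass_def)
  also have "\<dots> \<le> law 1 UNIV" using T by (intro sum_atom_le_law) auto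
  also have "\<dots> \<le> 1" by (rule law_le) simp
  finally show False using n by simp
qed

text \<open>
  Only the masses at the two scales are compared, up to closure. The points that carry the atoms are
  left out on purpose, since they are moved by multiplication with values of \<open>g\<close>.
\<close>

definition masses_near :: "real \<Rightarrow> real \<Rightarrow> bool" where
  "masses_near s t \<longleftrightarrow> (\<forall>\<epsilon>>0. \<forall>\<phi>. \<exists>\<psi>. \<bar>mass s \<phi> - mass t \<psi>\<bar> \<le> \<epsilon>)"

lemma masses_near_trans:
  assumes "masses_near s t" "masses_near t u"
  shows "masses_near s u"
  unfolding masses_near_def
proof (intro allI impI)
  fix \<epsilon> :: real and \<phi> assume e: "\<epsilon> > 0"
  obtain \<psi> where 1: "\<bar>mass s \<phi> - mass t \<psi>\<bar> \<le> \<epsilon> / 2"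
    using assms(1) e unfolding masses_near_def by (metis half_gt_zero)
  obtain \<psi>' where 2: "\<bar>mass t \<psi> - mass u \<psi>'\<bar> \<le> \<epsilon> / 2"
    using assms(2) e unfolding masses_near_def by (metis half_gt_zero)
  have "\<bar>mass s \<phi> - mass u \<psi>'\<bar> \<le> \<epsilon>" using 1 2 by linarith
  then show "\<exists>\<psi>. \<bar>mass s \<phi> - mass u \<psi>\<bar> \<le> \<epsilon>" ..
qed

text \<open>
  For good primes with \<open>q / p \<approx> r\<close> the scales \<open>t / r / p\<close> and \<open>t / q\<close> almost coincide. The atoms there are those of
  the scale \<open>t / r\<close> divided by \<open>g p\<close>, and also those of the scale \<open>t\<close> divided by \<open>g q\<close>.
\<close>

lemma masses_near_ratio:
  assumes t: "0 < t" and r: "1 < r" and rec: "recurrent r"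
  shows "masses_near (t / r) t"
  unfolding masses_near_def
proof (intro allI impI)
  fix \<epsilon> :: real and \<phi> assume e: "\<epsilon> > 0"
  have e3: "0 < \<epsilon> / 3" using e by simp
  have tr: "0 < t / r" using t r by simp
  let ?Z = "\<lambda>s. {p. prime p \<and> (g p = 0 \<or> (\<exists>\<phi>. \<bar>mass (s / real p) (\<phi> / g p) - mass s \<phi>\<bar> > \<epsilon> / 3))}"
  have "thin (?Z (t / r) \<union> ?Z t)" by (intro thin_Un thin_mass_deviation tr t e3)
  then obtain p q where pq: "prime p" "prime q" "p \<notin> ?Z (t / r) \<union> ?Z t" "q \<notin> ?Z (t / r) \<union> ?Z t"
    "\<bar>real q / real p - r\<bar> < \<epsilon> / 3" using rec e3 unfolding recurrent_def by blast
  have pos: "real p > 0" "real q > 0" using pq prime_gt_0_nat by auto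
  have gq: "g q \<noteq> 0" using pq by auto
  have 1: "\<bar>mass (t / r / real p) (\<phi> / g p) - mass (t / r) \<phi>\<bar> \<le> \<epsilon> / 3" using pq by (auto simp: not_less)
  have "\<bar>mass (t / real q) ((\<phi> / g p * g q) / g q) - mass t (\<phi> / g p * g q)\<bar> \<le> \<epsilon> / 3"
    using pq(2,4) gq by (simp only: Un_iff mem_Collect_eq de_Morgan_disj de_Morgan_conj not_ex not_less) blast
  then have 2: "\<bar>mass (t / real q) (\<phi> / g p) - mass t (\<phi> / g p * g q)\<bar> \<le> \<epsilon> / 3" using gq by simp
  have "\<bar>mass (t / r / real p) (\<phi> / g p) - mass (t / real q) (\<phi> / g p)\<bar>
      \<le> \<bar>t / r / real p - t / real q\<bar> / (t / real q)"
    using t r pos by (intro mass_lipschitz) auto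
  also have "\<dots> = \<bar>real q / real p - r\<bar> / r"
  proof -
    have "t / r / real p - t / real q = (real q / real p - r) * (t / (r * real q))"
      using t r pos by (simp add: field_simps)
    then have "\<bar>t / r / real p - t / real q\<bar> = \<bar>real q / real p - r\<bar> * (t / (r * real q))"
      using t r pos by (simp add: abs_mult)
    then show ?thesis using t r pos by simp
  qed
  also have "\<dots> \<le> \<bar>real q / real p - r\<bar> / 1" using r by (intro divide_left_mono) auto
  also have "\<dots> \<le> \<epsilon> / 3" using pq by simp
  finally have 3: "\<bar>mass (t / r / real p) (\<phi> / g p) - mass (t / real q) (\<phi> / g p)\<bar> \<le> \<epsilon> / 3" .
  have "\<bar>mass (t / r) \<phi> - mass t (\<phi> / g p * g q)\<bar> \<le> \<epsilon>" using 1 2 3 by linarith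
  then show "\<exists>\<psi>. \<bar>mass (t / r) \<phi> - mass t \<psi>\<bar> \<le> \<epsilon>" ..
qed

text \<open>
  Powers of a recurrent ratio close to \<open>1\<close> come close to every scale, and masses are Lipschitz in the scale.
\<close>

lemma masses_near_1:
  assumes t: "0 < t" "t \<le> 1"
  shows "masses_near t 1"
  unfolding masses_near_def
proof (intro allI impI)
  fix \<epsilon> :: real and \<phi> assume e: "\<epsilon> > 0"
  then have "0 < \<epsilon> / 2" by simp
  from recurrent_ratio[OF this] obtain r where r: "1 < r" "r \<le> 1 + \<epsilon> / 2" and rec: "recurrent r" by blast
  have near: "masses_near (1 / r ^ k) 1" for k
  proof (induction k)
    case 0
    have "\<bar>mass 1 \<phi> - mass 1 \<phi>\<bar> \<le> \<epsilon>" if "0 < \<epsilon>" for \<epsilon> \<phi> using that by simp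
    then show ?case unfolding masses_near_def power_0 div_by_1 by blast
  next
    case (Suc k)
    have "masses_near (1 / r ^ k / r) (1 / r ^ k)" using r by (intro masses_near_ratio rec) auto
    then show ?case using masses_near_trans[OF _ Suc] by (simp add: mult.commute)
  qed
  obtain k0 where "1 / t < r ^ k0" using real_arch_pow[OF r(1)] by blast
  then have "\<exists>k. 1 / t < r ^ Suc k" using r t by (cases k0) auto
  define k where "k = (LEAST k. 1 / t < r ^ Suc k)"
  have k1: "1 / t < r ^ Suc k" unfolding k_def by (rule LeastI_ex) fact
  have k2: "r ^ k \<le> 1 / t"
  proof (cases k)
    case (Suc k')
    have "\<not> 1 / t < r ^ Suc k'" by (rule not_less_Least) (use Suc in \<open>simp add: k_def\<close>)
    then show ?thesis using Suc by simp
  qed (use t in simp)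
  let ?u = "1 / r ^ k"
  have u: "0 < ?u" "t \<le> ?u" "?u < t * r" using k1 k2 r t by (auto simp: field_simps)
  have "\<bar>mass ?u \<phi> - mass t \<phi>\<bar> \<le> \<bar>?u - t\<bar> / t" using u t by (intro mass_lipschitz) auto
  also have "\<dots> \<le> (t * r - t) / t" using u t by (intro divide_right_mono) auto
  also have "\<dots> = r - 1" using t by (simp add: field_simps)
  also have "\<dots> \<le> \<epsilon> / 2" using r by simp
  finally have 1: "\<bar>mass ?u \<phi> - mass t \<phi>\<bar> \<le> \<epsilon> / 2" .
  obtain \<psi> where 2: "\<bar>mass ?u \<phi> - mass 1 \<psi>\<bar> \<le> \<epsilon> / 2"
    using near[of k] e unfolding masses_near_def by (metis half_gt_zero)
  have "\<bar>mass t \<phi> - mass 1 \<psi>\<bar> \<le> \<epsilon>" using 1 2 by linarith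
  then show "\<exists>\<psi>. \<bar>mass t \<phi> - mass 1 \<psi>\<bar> \<le> \<epsilon>" ..
qed

lemma mass_in_values:
  assumes t: "0 < t" "t \<le> 1" and pos: "0 < mass t \<phi>"
  shows "mass t \<phi> \<in> mass 1 ` {\<psi>. 0 < mass 1 \<psi>}"
proof -
  let ?v = "mass t \<phi>"
  let ?S = "mass 1 ` {\<psi>. ?v / 2 \<le> mass 1 \<psi>}"
  have "finite ?S" using pos by (intro finite_imageI finite_heavy) simp
  then obtain d where d: "d > 0" "\<And>x. x \<in> ?S \<Longrightarrow> x \<noteq> ?v \<Longrightarrow> d \<le> dist ?v x"
    using finite_set_avoid by metis
  define e where "e = min (d / 2) (?v / 2)"
  have e: "0 < e" "e < d" "e \<le> ?v / 2" using d pos by (auto simp: e_def)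
  obtain \<psi> where \<psi>: "\<bar>?v - mass 1 \<psi>\<bar> \<le> e"
    using masses_near_1[OF t] e unfolding masses_near_def by blast
  then have v2: "?v / 2 \<le> mass 1 \<psi>" using e by linarith
  then have "mass 1 \<psi> = ?v" using d(2)[of "mass 1 \<psi>"] \<psi> e by (force simp: dist_real_def)
  then show ?thesis using pos by (intro image_eqI[of _ _ \<psi>]) auto
qed

text \<open>
  A continuous function with values in a countable set is constant on an interval.
\<close>

lemma mass_constant:
  assumes t: "0 < t" "t \<le> 1"
  shows "mass t \<phi> = mass 1 \<phi>"
proof (rule ccontr)
  assume ne: "mass t \<phi> \<noteq> mass 1 \<phi>"
  let ?f = "\<lambda>x. mass x \<phi>"
  have "continuous_on {0<..1} ?f"
  proof (rule continuous_at_imp_continuous_on, rule ballI)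
    fix x :: real assume x: "x \<in> {0<..1}"
    have lim: "((\<lambda>y. \<bar>y - x\<bar> / x) \<longlongrightarrow> \<bar>x - x\<bar> / x) (at x)" using x by (intro tendsto_intros) auto
    have "((\<lambda>y. ?f y - ?f x) \<longlongrightarrow> 0) (at x)"
    proof (rule Lim_null_comparison)
      show "((\<lambda>y. \<bar>y - x\<bar> / x) \<longlongrightarrow> 0) (at x)" using lim by simp
      have "\<forall>\<^sub>F y in at x. 0 < y" using x by (intro eventually_at_in_open'[of "{0<..}", simplified]) auto
      then show "\<forall>\<^sub>F y in at x. norm (?f y - ?f x) \<le> \<bar>y - x\<bar> / x"
        by eventually_elim (use x mass_lipschitz in auto)
    qed
    then show "isCont ?f x" unfolding isCont_def using LIM_zero_iff by blast
  qed
  then have conn: "connected (?f ` {0<..1})" by (intro connected_continuous_image) auto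
  have "uncountable (?f ` {0<..1})"
    by (rule connected_uncountable[OF conn, of "mass t \<phi>" "mass 1 \<phi>"]) (use ne t in auto)
  moreover have "?f ` {0<..1} \<subseteq> {0} \<union> mass 1 ` {\<psi>. 0 < mass 1 \<psi>}"
  proof
    fix v assume "v \<in> ?f ` {0<..1}"
    then obtain x where x: "0 < x" "x \<le> 1" "v = mass x \<phi>" by auto
    show "v \<in> {0} \<union> mass 1 ` {\<psi>. 0 < mass 1 \<psi>}"
      using mass_in_values[OF x(1,2), of \<phi>] mass_nonneg[OF x(1), of \<phi>] x(3) by (cases "v = 0") auto
  qed
  moreover have "countable ({0} \<union> mass 1 ` {\<psi>. 0 < mass 1 \<psi>})"
  proof -
    have "{\<psi>. 0 < mass 1 \<psi>} \<subseteq> (\<Union>n. {\<psi>. 1 / real (Suc n) \<le> mass 1 \<psi>})"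
    proof
      fix \<psi> assume "\<psi> \<in> {\<psi>. 0 < mass 1 \<psi>}"
      then have "0 < mass 1 \<psi>" by simp
      then obtain n where "1 / real (Suc n) < mass 1 \<psi>" by (rule nat_approx_posE)
      then show "\<psi> \<in> (\<Union>n. {\<psi>. 1 / real (Suc n) \<le> mass 1 \<psi>})" using less_imp_le by blast
    qed
    moreover have "countable (\<Union>n. {\<psi>. 1 / real (Suc n) \<le> mass 1 \<psi>})"
    proof (rule countable_UN)
      show "countable {\<psi>. 1 / real (Suc n) \<le> mass 1 \<psi>}" for n
        by (rule countable_finite, rule finite_heavy) simp
    qed simp
    ultimately have "countable {\<psi>. 0 < mass 1 \<psi>}" by (rule countable_subset)
    then show ?thesis by simp
  qed
  ultimately show False using countable_subset by blast
qed

text \<open>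
  For almost all \<open>p\<close> the point \<open>\<phi> / g p\<close> carries at the scale \<open>1 / p\<close>, hence also at the scale \<open>1\<close>, an atom of at
  least half the mass of \<open>\<phi>\<close>. There are finitely many such atoms.
\<close>

lemma finite_values_if_atom:
  assumes "\<phi> \<noteq> 0" and pos: "0 < atom 1 \<phi>"
  shows "\<exists>W. finite W \<and> thin {p. prime p \<and> g p \<notin> W}"
proof -
  define \<eta> where "\<eta> = mass 1 \<phi>"
  have \<eta>: "\<eta> > 0" using pos by (simp add: \<eta>_def mass_def)
  let ?W = "(\<lambda>\<psi>. \<phi> / \<psi>) ` {\<psi>. \<eta> / 2 \<le> mass 1 \<psi>}"
  have "finite ?W" using \<eta> by (intro finite_imageI finite_heavy) simp
  moreover have "thin {p. prime p \<and> g p \<notin> ?W}"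
  proof (rule thin_subset[OF thin_mass_deviation[of 1 "\<eta> / 2"]])
    show "{p. prime p \<and> g p \<notin> ?W}
      \<subseteq> {p. prime p \<and> (g p = 0 \<or> (\<exists>\<phi>. \<bar>mass (1 / real p) (\<phi> / g p) - mass 1 \<phi>\<bar> > \<eta> / 2))}"
    proof safe
      fix p assume p: "prime p" "g p \<notin> ?W" and nex: "\<not> (\<exists>\<phi>. \<bar>mass (1 / real p) (\<phi> / g p) - mass 1 \<phi>\<bar> > \<eta> / 2)"
      show "g p = 0"
      proof (rule ccontr)
        assume gp: "g p \<noteq> 0"
        have "real p \<ge> 1" using p prime_ge_1_nat by force
        then have "mass (1 / real p) (\<phi> / g p) = mass 1 (\<phi> / g p)" by (intro mass_constant) auto
        then have "\<eta> / 2 \<le> mass 1 (\<phi> / g p)" using nex \<eta> unfolding \<eta>_def by (smt (verit) field_sum_of_halves)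
        moreover have "g p = \<phi> / (\<phi> / g p)" using gp assms by simp
        ultimately show False using p(2) by blast
      qed
    qed
  qed (use \<eta> in auto)
  ultimately show ?thesis by blast
qed

end

definition atomless_at :: "(nat \<Rightarrow> complex) \<Rightarrow> complex \<Rightarrow> bool" where
  "atomless_at g \<phi> \<longleftrightarrow> (\<forall>\<epsilon>>0. \<exists>\<delta>>0. \<forall>\<^sub>F N in sequentially.
     real (card ({n. cmod (g n - \<phi>) < \<delta>} \<inter> {1..N})) \<le> \<epsilon> * real N)"

text \<open>
  If \<open>g\<close> has an atom of positive upper density at \<open>\<phi>\<close>, an ultrafilter can be chosen along numbers \<open>N\<close> where
  the balls of radius \<open>1 / Suc i\<close> around \<open>\<phi>\<close> still carry the mass \<open>\<epsilon>\<close>.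
\<close>

theorem atomless_or_finite_values:
  assumes mult: "multiplicative g" and bd: "\<And>n. n > 0 \<Longrightarrow> cmod (g n) \<le> 1"
    and nz: "thin {p. prime p \<and> g p = 0}" and \<phi>: "\<phi> \<noteq> 0" and not: "\<not> atomless_at g \<phi>"
  shows "\<exists>W. finite W \<and> thin {p. prime p \<and> g p \<notin> W}"
proof -
  let ?A = "\<lambda>\<delta>. {n. cmod (g n - \<phi>) < \<delta>}"
  obtain \<epsilon> where e: "\<epsilon> > 0" and fr: "\<And>\<delta>. \<delta> > 0 \<Longrightarrow> \<not> (\<forall>\<^sub>F N in sequentially. real (card (?A \<delta> \<inter> {1..N})) \<le> \<epsilon> * real N)"
    using not unfolding atomless_at_def by blast
  have "\<exists>N\<ge>i. \<epsilon> * real N < real (card (?A (1 / real (Suc i)) \<inter> {1..N}))" for i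
    using fr[of "1 / real (Suc i)"] unfolding eventually_sequentially by (auto simp: not_le)
  then obtain \<N> where N: "\<And>i. \<N> i \<ge> i" "\<And>i. \<epsilon> * real (\<N> i) < real (card (?A (1 / real (Suc i)) \<inter> {1..\<N> i}))"
    by metis
  have Nlim: "filterlim \<N> sequentially sequentially"
    by (rule filterlim_at_top_mono[OF filterlim_ident]) (use N(1) in auto)
  have "filtermap \<N> sequentially \<noteq> bot" by (simp add: filtermap_bot_iff)
  from ultrafilter_below[OF this] obtain F where F: "F \<le> filtermap \<N> sequentially" "F \<noteq> bot"
    "\<forall>P. eventually P F \<or> eventually (\<lambda>x. \<not> P x) F" by (elim exE conjE)
  interpret ultra_multiplicative F g
  proof
    show "F \<le> sequentially" using F(1) Nlim unfolding filterlim_def by (rule order_trans)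
  qed (use F mult bd nz in auto)
  have "\<epsilon> \<le> atom 1 \<phi>"
  proof (rule atom_greatest)
    fix \<delta> :: real assume d: "0 < \<delta>"
    obtain i0 where i0: "1 / real (Suc i0) < \<delta>" using nat_approx_posE[OF d] by blast
    let ?B = "{n. 0 < n \<and> g n \<in> ball \<phi> \<delta>}"
    have "\<epsilon> * real (\<N> i) \<le> real (cnt 1 ?B (\<N> i))" if "i \<ge> i0" for i
    proof -
      have "1 / real (Suc i) \<le> 1 / real (Suc i0)" using that by (intro divide_left_mono) auto
      then have "?A (1 / real (Suc i)) \<inter> {1..\<N> i} \<subseteq> ?B \<inter> {1..\<N> i}"
        using i0 by (auto simp: dist_norm norm_minus_commute)
      then have "card (?A (1 / real (Suc i)) \<inter> {1..\<N> i}) \<le> cnt 1 ?B (\<N> i)"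
        unfolding cnt_def by (intro card_mono) auto
      then show ?thesis using N(2)[of i] by linarith
    qed
    then have "\<forall>\<^sub>F i in sequentially. \<epsilon> * real (\<N> i) \<le> real (cnt 1 ?B (\<N> i))"
      by (auto simp: eventually_sequentially)
    then have "\<forall>\<^sub>F N in F. \<epsilon> * real N \<le> real (cnt 1 ?B N)"
      by (intro filter_leD[OF F(1)]) (simp add: eventually_filtermap)
    moreover have "\<forall>\<^sub>F N in F. N > 0"
      using below_sequentially eventually_gt_at_top[of 0] by (rule filter_leD)
    ultimately have "\<forall>\<^sub>F N in F. \<epsilon> \<le> real (cnt 1 ?B N) / real N"
      by eventually_elim (simp add: le_divide_eq)
    then show "\<epsilon> \<le> law 1 (ball \<phi> \<delta>)"
      unfolding law_def by (intro tendsto_lowerbound[OF dens_tendsto _ nontrivial]) auto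
  qed
  then show ?thesis using e by (intro finite_values_if_atom[OF \<phi>]) linarith
qed

section \<open>Multiplicative functions with a nonzero mean modulus\<close>

text \<open>
  The Turan-Kubilius inequality for \<open>cmod \<circ> f\<close>: if \<open>cmod (f p) \<le> 1 - \<epsilon>\<close> for all \<open>p\<close> in a finite set \<open>P\<close>, the mean
  value \<open>\<alpha>\<close> satisfies \<open>\<alpha> \<le> (1 - \<epsilon>) * \<alpha>\<close> up to an error that is small when \<open>recip_sum P\<close> is large.
\<close>

lemma mean_modulus_thin:
  assumes f: "multiplicative f" and bd: "\<And>n. n > 0 \<Longrightarrow> cmod (f n) \<le> 1"
    and lim: "(\<lambda>N. (\<Sum>n=1..N. cmod (f n)) / real N) \<longlonglongrightarrow> \<alpha>" and \<alpha>: "\<alpha> \<noteq> 0" and e: "\<epsilon> > 0"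
  shows "thin {p. prime p \<and> cmod (f p) \<le> 1 - \<epsilon>}"
proof (rule ccontr)
  assume nt: "\<not> ?thesis"
  define M where "M N = (\<Sum>n=1..N. cmod (f n))" for N
  have M0: "0 \<le> M N" for N unfolding M_def by (rule sum_nonneg) simp
  have MN: "M N \<le> real N" for N
  proof -
    have "M N \<le> (\<Sum>n=1..N. 1)" unfolding M_def by (intro sum_mono bd) auto
    then show ?thesis by simp
  qed
  have \<alpha>0: "\<alpha> > 0"
  proof -
    have "0 \<le> \<alpha>" by (rule LIMSEQ_le_const[OF lim]) (auto intro!: divide_nonneg_nonneg sum_nonneg)
    then show ?thesis using \<alpha> by simp
  qed
  \<comment> \<open>Replacing \<open>\<alpha>\<close> by \<open>\<alpha> - \<eta>\<close> on the left and by \<open>\<alpha> + \<eta>\<close> on the right costs half of the gain \<open>\<epsilon> * \<alpha>\<close>.\<close>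
  define \<eta> where "\<eta> = \<epsilon> * \<alpha> / 4"
  have \<eta>: "\<eta> > 0" using e \<alpha>0 by (simp add: \<eta>_def)
  obtain P where P: "finite P" "P \<subseteq> {p. prime p \<and> cmod (f p) \<le> 1 - \<epsilon>}"
    "max 1 ((8 / (\<epsilon> * \<alpha>))\<^sup>2 + 1) \<le> (\<Sum>p\<in>P. 1 / real p)"
    using nt by (rule not_thin_imp_unbounded[where C = "max 1 ((8 / (\<epsilon> * \<alpha>))\<^sup>2 + 1)"])
  define L where "L = recip_sum P"
  have L: "L \<ge> 1" "(8 / (\<epsilon> * \<alpha>))\<^sup>2 < L" using P(3) unfolding L_def recip_sum_def by linarith+
  have pr: "prime p" if "p \<in> P" for p using that P by auto
  have p1: "p \<ge> 1" if "p \<in> P" for p using pr[OF that] prime_ge_1_nat by blast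
  have up: "\<forall>\<^sub>F N in sequentially. M N \<le> (\<alpha> + \<eta>) * real N"
  proof -
    have "\<forall>\<^sub>F N in sequentially. M N / real N < \<alpha> + \<eta>"
      unfolding M_def by (rule order_tendstoD(2)[OF lim]) (use \<eta> in simp)
    then show ?thesis using eventually_gt_at_top[of 0]
      by eventually_elim (simp add: divide_less_eq less_imp_le)
  qed
  have low: "\<forall>\<^sub>F N in sequentially. (\<alpha> - \<eta>) * real N \<le> M N"
  proof -
    have "\<forall>\<^sub>F N in sequentially. \<alpha> - \<eta> < M N / real N"
      unfolding M_def by (rule order_tendstoD(1)[OF lim]) (use \<eta> in simp)
    then show ?thesis using eventually_gt_at_top[of 0]
      by eventually_elim (simp add: less_divide_eq less_imp_le)
  qed
  have up_div: "\<forall>\<^sub>F N in sequentially. \<forall>p\<in>P. M (N div p) \<le> (\<alpha> + \<eta>) * real (N div p)"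
  proof (subst eventually_ball_finite_distrib[OF P(1)], rule ballI)
    fix p assume p: "p \<in> P"
    have "filterlim (\<lambda>N. N div p) sequentially sequentially" by (rule filterlim_div[OF p1[OF p]])
    then show "\<forall>\<^sub>F N in sequentially. M (N div p) \<le> (\<alpha> + \<eta>) * real (N div p)"
      by (rule eventually_compose_filterlim[OF up])
  qed
  have "\<forall>\<^sub>F N in sequentially. False"
    using up_div low eventually_gt_at_top[of 0] eventually_ge_at_top[of "2 * card P"]
  proof eventually_elim
    case (elim N)
    have N: "real N > 0" using elim by simp
    have NP: "2 * real (card P) \<le> real N" using elim(4) by linarith
    define F where "F n = (if n = 0 then 0 else cmod (f n))" for n
    have F1: "\<bar>F n\<bar> \<le> 1" for n using bd[of n] by (simp add: F_def)
    have MF: "(\<Sum>n=1..N. 1 * F n) = M N" for N unfolding M_def by (intro sum.cong) (auto simp: F_def)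
    have "\<bar>(\<Sum>p\<in>P. \<Sum>n=1..N. 1 * of_bool (p dvd n) * F n) - L * M N\<bar>
      \<le> sqrt (real N * (real N * L + 2 * L * real (card P)))"
      using turan_kubilius_sum[OF P(1) pr balanced_1[of N], of F] F1 unfolding MF L_def by simp
    also have "\<dots> \<le> sqrt (real N * (real N * L + L * real N))"
    proof (intro real_sqrt_le_mono mult_left_mono add_mono order_refl)
      have "L * (2 * real (card P)) \<le> L * real N" using NP L by (intro mult_left_mono) auto
      then show "2 * L * real (card P) \<le> L * real N" by (simp add: mult_ac)
    qed auto
    also have "real N * (real N * L + L * real N) = (real N)\<^sup>2 * (2 * L)" by (simp add: power2_eq_square algebra_simps)
    also have "sqrt \<dots> = real N * sqrt (2 * L)" by (simp add: real_sqrt_mult)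
    finally have tk: "L * M N \<le> (\<Sum>p\<in>P. \<Sum>n=1..N. 1 * of_bool (p dvd n) * F n) + real N * sqrt (2 * L)"
      by (simp only: abs_le_iff) linarith
    have "(\<Sum>p\<in>P. \<Sum>n=1..N. 1 * of_bool (p dvd n) * F n)
      \<le> (\<Sum>p\<in>P. (1 - \<epsilon>) * (\<alpha> + \<eta>) * real N * (1 / real p) + real N * (1 / (real p)\<^sup>2))"
    proof (rule sum_mono)
      fix p assume p: "p \<in> P"
      have fp: "cmod (f p) \<le> 1 - \<epsilon>" using p P by auto
      then have e1: "0 \<le> 1 - \<epsilon>" by (rule order_trans[rotated]) simp
      have "(\<Sum>n=1..N. 1 * of_bool (p dvd n) * F n) = (\<Sum>n=1..N. F n * of_bool (p dvd n))"
        by (simp add: mult.commute)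
      also have "\<dots> = (\<Sum>m=1..N div p. F (p * m))" by (rule sum_multiples[OF p1[OF p]])
      also have "\<dots> \<le> (\<Sum>m=1..N div p. (1 - \<epsilon>) * F m + of_bool (p dvd m))"
      proof (rule sum_mono)
        fix m assume m: "m \<in> {1..N div p}"
        show "F (p * m) \<le> (1 - \<epsilon>) * F m + of_bool (p dvd m)"
        proof (cases "p dvd m")
          case True
          have "F (p * m) \<le> 1" using F1[of "p * m"] by linarith
          moreover have "0 \<le> (1 - \<epsilon>) * F m" using e1 by (simp add: F_def)
          ultimately show ?thesis using True by simp
        next
          case False
          have "f (p * m) = f p * f m" using multiplicative_prime[OF f pr[OF p] _ False] m by auto
          then show ?thesis using False fp m p1[OF p] by (auto simp: F_def norm_mult intro!: mult_right_mono)
        qed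
      qed
      also have "\<dots> = (1 - \<epsilon>) * M (N div p) + real (card {m\<in>{1..N div p}. p dvd m})"
      proof -
        have "(\<Sum>m=1..N div p. F m) = M (N div p)" using MF[of "N div p"] by simp
        moreover have "real (card {m\<in>{1..N div p}. p dvd m}) = (\<Sum>m=1..N div p. of_bool (p dvd m))"
          using card_Int_interval[of "{m. p dvd m}" "N div p"] by (simp add: Int_def conj_commute)
        ultimately show ?thesis by (simp add: sum.distrib sum_distrib_left[symmetric])
      qed
      also have "\<dots> \<le> (1 - \<epsilon>) * ((\<alpha> + \<eta>) * (real N / real p)) + real N / real p / real p"
      proof (intro add_mono mult_left_mono e1)
        have "M (N div p) \<le> (\<alpha> + \<eta>) * real (N div p)" using elim(1) p by blast
        also have "\<dots> \<le> (\<alpha> + \<eta>) * (real N / real p)" using \<alpha>0 \<eta> by (intro mult_left_mono real_div_le) auto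
        finally show "M (N div p) \<le> (\<alpha> + \<eta>) * (real N / real p)" .
        have "real (card {m\<in>{1..N div p}. p dvd m}) \<le> real (N div p) / real p" by (rule card_multiples[OF p1[OF p]])
        also have "\<dots> \<le> real N / real p / real p" by (intro divide_right_mono real_div_le) simp
        finally show "real (card {m\<in>{1..N div p}. p dvd m}) \<le> real N / real p / real p" .
      qed
      finally show "(\<Sum>n=1..N. 1 * of_bool (p dvd n) * F n)
        \<le> (1 - \<epsilon>) * (\<alpha> + \<eta>) * real N * (1 / real p) + real N * (1 / (real p)\<^sup>2)"
        by (simp add: power2_eq_square mult_ac)
    qed
    also have "\<dots> = (1 - \<epsilon>) * (\<alpha> + \<eta>) * real N * L + real N * (\<Sum>p\<in>P. 1 / (real p)\<^sup>2)"
      by (simp add: sum.distrib sum_distrib_left L_def recip_sum_def)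
    also have "\<dots> \<le> (1 - \<epsilon>) * (\<alpha> + \<eta>) * real N * L + real N * 2"
      using p1 by (intro add_left_mono mult_left_mono sum_inverse_squares_le_finite[OF P(1)]) force+
    finally have "L * M N \<le> (1 - \<epsilon>) * (\<alpha> + \<eta>) * real N * L + real N * 2 + real N * sqrt (2 * L)"
      using tk by linarith
    moreover have "L * ((\<alpha> - \<eta>) * real N) \<le> L * M N" using elim(2) L by (intro mult_left_mono) auto
    ultimately have "real N * (L * (\<alpha> - \<eta>)) \<le> real N * ((1 - \<epsilon>) * (\<alpha> + \<eta>) * L + 2 + sqrt (2 * L))"
      by (simp add: algebra_simps)
    then have "L * (\<alpha> - \<eta>) \<le> (1 - \<epsilon>) * (\<alpha> + \<eta>) * L + 2 + sqrt (2 * L)"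
      using N by (simp add: mult_le_cancel_left_pos)
    moreover have "L * (\<alpha> - \<eta>) - (1 - \<epsilon>) * (\<alpha> + \<eta>) * L = L * (\<epsilon> * \<alpha> / 2) + L * (\<epsilon> * \<eta>)"
    proof -
      have "L * (\<alpha> - \<eta>) - (1 - \<epsilon>) * (\<alpha> + \<eta>) * L = L * (\<epsilon> * \<alpha> - 2 * \<eta>) + L * (\<epsilon> * \<eta>)"
        by (simp add: algebra_simps)
      also have "\<epsilon> * \<alpha> - 2 * \<eta> = \<epsilon> * \<alpha> / 2" by (simp add: \<eta>_def)
      finally show ?thesis .
    qed
    moreover have "0 \<le> L * (\<epsilon> * \<eta>)" using L e \<eta> by simp
    ultimately have "L * (\<epsilon> * \<alpha> / 2) \<le> 2 + sqrt (2 * L)" by linarith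
    also have "\<dots> \<le> 4 * sqrt L"
    proof -
      have "sqrt (2 * L) \<le> sqrt (4 * L)" using L by simp
      also have "sqrt (4 * L) = 2 * sqrt L" by (simp add: real_sqrt_mult)
      finally have "sqrt (2 * L) \<le> 2 * sqrt L" .
      moreover have "1 \<le> sqrt L" using L by simp
      ultimately show ?thesis by linarith
    qed
    finally have fin: "L * (\<epsilon> * \<alpha> / 2) \<le> 4 * sqrt L" .
    have sL: "sqrt L > 0" "sqrt L * sqrt L = L" using L by auto
    have eq: "sqrt L * (sqrt L * (\<epsilon> * \<alpha> / 2)) = L * (\<epsilon> * \<alpha> / 2)"
      unfolding mult.assoc[symmetric] sL(2) ..
    have "sqrt L * (sqrt L * (\<epsilon> * \<alpha> / 2)) \<le> sqrt L * 4"
      unfolding eq by (rule order_trans[OF fin]) simp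
    then have "sqrt L * (\<epsilon> * \<alpha> / 2) \<le> 4" using sL(1) by (simp only: mult_le_cancel_left_pos)
    then have "sqrt L \<le> 8 / (\<epsilon> * \<alpha>)" using e \<alpha>0 by (simp add: le_divide_eq)
    moreover have "8 / (\<epsilon> * \<alpha>) < sqrt L" using L(2) by (rule real_less_rsqrt)
    ultimately show False by simp
  qed
  then show False by simp
qed

section \<open>Sets that are elementary in polar coordinates\<close>

lemma finite_frontier_interval:
  assumes I: "is_interval (I :: real set)"
  shows "finite (frontier I)"
proof (rule ccontr)
  assume inf: "infinite (frontier I)"
  obtain a where a: "a \<in> frontier I" using inf by (metis finite.emptyI ex_in_conv)
  have "infinite (frontier I - {a})" using inf by simp
  then obtain b where b: "b \<in> frontier I" "b \<noteq> a" by (metis finite.emptyI ex_in_conv Diff_iff insertI1)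
  have "infinite (frontier I - {a, b})" using inf by simp
  then obtain c where c: "c \<in> frontier I" "c \<noteq> a" "c \<noteq> b"
    by (metis finite.emptyI ex_in_conv Diff_iff insertI1 insertI2)
  have no3: False if xyz: "x < y" "y < z" "x \<in> frontier I" "y \<in> frontier I" "z \<in> frontier I" for x y z
  proof -
    have cl: "x \<in> closure I" "z \<in> closure I" using that by (auto simp: frontier_def)
    obtain x' where x': "x' \<in> I" "dist x' x < y - x" using cl(1)[unfolded closure_approachable, rule_format, of "y - x"] xyz(1) by auto
    obtain z' where z': "z' \<in> I" "dist z' z < z - y" using cl(2)[unfolded closure_approachable, rule_format, of "z - y"] xyz(2) by auto
    have ord: "x' < y" "y < z'" using x'(2) z'(2) by (auto simp: dist_real_def abs_less_iff)
    have "{x'<..<z'} \<subseteq> I" using mem_is_interval_1_I[OF I x'(1) z'(1)] by auto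
    then have "{x'<..<z'} \<subseteq> interior I" by (rule interior_maximal) simp
    then have "y \<in> interior I" using ord by auto
    then show False using that by (simp add: frontier_def)
  qed
  consider "a < b" "b < c" | "a < c" "c < b" | "b < a" "a < c" | "b < c" "c < a" | "c < a" "a < b" | "c < b" "b < a"
    using b c by linarith
  then show False using no3 a b c by cases blast+
qed

lemma interval_crossing:
  assumes "x \<in> I \<longleftrightarrow> y \<notin> (I :: real set)"
  shows "\<exists>b\<in>frontier I. min x y \<le> b \<and> b \<le> max x y"
proof -
  have "{min x y..max x y} \<inter> frontier I \<noteq> {}"
  proof (rule connected_Int_frontier)
    have "x \<in> {min x y..max x y}" "y \<in> {min x y..max x y}" by simp_all
    then show "{min x y..max x y} \<inter> I \<noteq> {}" "{min x y..max x y} - I \<noteq> {}"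
      using assms by blast+
  qed simp
  then show ?thesis by auto
qed

definition circle_arc :: "real set \<Rightarrow> complex set" where
  "circle_arc I = (\<lambda>\<phi>. cis (2 * pi * \<phi>)) ` I"

lemma dist_cis_le: "dist (cis a) (cis b) \<le> \<bar>a - b\<bar>"
proof -
  have "cis a - cis b = cis b * (cis (a - b) - 1)" by (simp add: right_diff_distrib cis_mult)
  then have "dist (cis a) (cis b) = norm (exp (\<i> * of_real (a - b)) - 1)"
    by (simp add: dist_norm norm_mult cis_conv_exp)
  also have "\<dots> = 2 * \<bar>sin ((a - b) / 2)\<bar>" by (rule dist_exp_i_1)
  also have "\<dots> \<le> 2 * \<bar>(a - b) / 2\<bar>" by (intro mult_left_mono abs_sin_x_le_abs_x) simp
  finally show ?thesis by simp
qed

lemma unit_rotation: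
  assumes "\<eta> > 0"
  shows "\<exists>\<delta>>0. \<forall>u u'. cmod u = 1 \<longrightarrow> cmod u' = 1 \<longrightarrow> dist u u' < \<delta> \<longrightarrow> (\<exists>t. \<bar>t\<bar> < \<eta> \<and> u' = u * cis (2 * pi * t))"
proof -
  have "isCont Arg 1" by (rule continuous_at_Arg) (simp add: complex_nonpos_Reals_iff)
  moreover have "0 < 2 * pi * \<eta>" using assms by simp
  ultimately obtain \<delta> where d: "\<delta> > 0" "\<And>z. dist z 1 < \<delta> \<Longrightarrow> dist (Arg z) (Arg 1) < 2 * pi * \<eta>"
    unfolding continuous_at_eps_delta by blast
  have "\<exists>t. \<bar>t\<bar> < \<eta> \<and> u' = u * cis (2 * pi * t)" if u: "cmod u = 1" "cmod u' = 1" "dist u u' < \<delta>" for u u'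
  proof -
    let ?z = "u' / u"
    have u0: "u \<noteq> 0" using u by auto
    have z: "cmod ?z = 1" using u by (simp add: norm_divide)
    have "?z - 1 = (u' - u) / u" using u0 by (simp add: diff_divide_distrib)
    then have "dist ?z 1 = dist u u'" using u by (simp add: dist_norm norm_divide norm_minus_commute)
    then have "\<bar>Arg ?z\<bar> < 2 * pi * \<eta>" using d(2)[of ?z] u by (simp add: dist_real_def)
    then have "\<bar>Arg ?z / (2 * pi)\<bar> < \<eta>" by (simp add: abs_divide divide_less_eq mult.commute)
    moreover have "cis (Arg ?z) = ?z" using z cis_Arg[of ?z] by (metis norm_zero sgn_eq div_by_1 of_real_1 zero_neq_one)
    then have "u' = u * cis (2 * pi * (Arg ?z / (2 * pi)))" using u0 by simp
    ultimately show ?thesis by blast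
  qed
  then show ?thesis using d(1) by blast
qed

text \<open>
  The shorter way around the circle from \<open>u\<close> to \<open>u'\<close> lifts to a short interval of angles, one end of
  which is in \<open>I\<close> and the other is not. It contains a boundary point of \<open>I\<close>.
\<close>

lemma arc_boundary:
  assumes "\<delta> > 0"
  shows "\<exists>\<delta>'>0. \<forall>u u'. cmod u = 1 \<longrightarrow> cmod u' = 1 \<longrightarrow> dist u u' < \<delta>' \<longrightarrow>
    (u \<in> circle_arc I \<longleftrightarrow> u' \<notin> circle_arc I) \<longrightarrow> (\<exists>b\<in>circle_arc (frontier I). dist u' b < \<delta>)"
proof -
  have "0 < \<delta> / (2 * pi)" using assms by simp
  from unit_rotation[OF this] obtain \<delta>' where d: "\<delta>' > 0"
    and rot: "\<And>u u'. cmod u = 1 \<Longrightarrow> cmod u' = 1 \<Longrightarrow> dist u u' < \<delta>' \<Longrightarrow> \<exists>t. \<bar>t\<bar> < \<delta> / (2 * pi) \<and> u' = u * cis (2 * pi * t)"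
    by blast
  have cross: "\<exists>b\<in>circle_arc (frontier I). dist u b < \<delta> \<and> dist u' b < \<delta>"
    if u: "cmod u = 1" "cmod u' = 1" "dist u u' < \<delta>'" "u \<in> circle_arc I" "u' \<notin> circle_arc I" for u u'
  proof -
    obtain t where t: "\<bar>t\<bar> < \<delta> / (2 * pi)" "u' = u * cis (2 * pi * t)" using rot[OF u(1-3)] by blast
    obtain \<phi> where \<phi>: "\<phi> \<in> I" "u = cis (2 * pi * \<phi>)" using u(4) by (auto simp: circle_arc_def)
    have u': "u' = cis (2 * pi * (\<phi> + t))" unfolding t(2) \<phi>(2) by (simp add: cis_mult distrib_left)
    then have "\<phi> + t \<notin> I" using u(5) by (auto simp: circle_arc_def)
    then obtain b where b: "b \<in> frontier I" "min \<phi> (\<phi> + t) \<le> b" "b \<le> max \<phi> (\<phi> + t)"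
      using interval_crossing[of \<phi> I "\<phi> + t"] \<phi>(1) by blast
    have near: "dist (cis (2 * pi * x)) (cis (2 * pi * b)) < \<delta>" if x: "x = \<phi> \<or> x = \<phi> + t" for x
    proof -
      have "\<bar>x - b\<bar> \<le> \<bar>t\<bar>" using b x by (auto simp: min_def max_def abs_if split: if_splits)
      then have "\<bar>x - b\<bar> < \<delta> / (2 * pi)" using t(1) by linarith
      then have "2 * pi * \<bar>x - b\<bar> < \<delta>" by (simp add: less_divide_eq mult.commute)
      moreover have "dist (cis (2 * pi * x)) (cis (2 * pi * b)) \<le> \<bar>2 * pi * x - 2 * pi * b\<bar>" by (rule dist_cis_le)
      moreover have "\<bar>2 * pi * x - 2 * pi * b\<bar> = 2 * pi * \<bar>x - b\<bar>"
        unfolding right_diff_distrib[symmetric] by (simp add: abs_mult)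
      ultimately show ?thesis by linarith
    qed
    show ?thesis using b(1) near[of \<phi>] near[of "\<phi> + t"] unfolding u' \<phi>(2) by (auto simp: circle_arc_def)
  qed
  have "\<exists>b\<in>circle_arc (frontier I). dist u' b < \<delta>"
    if "cmod u = 1" "cmod u' = 1" "dist u u' < \<delta>'" "u \<in> circle_arc I \<longleftrightarrow> u' \<notin> circle_arc I" for u u'
    using cross[of u u'] cross[of u' u] that by (cases "u \<in> circle_arc I") (auto simp: dist_commute)
  then show ?thesis using d by blast
qed

text \<open>
  In each of the two polar coordinates, \<open>w\<close> and \<open>w'\<close> agree or are close and stay away from the boundary
  values \<open>R\<close>, respectively \<open>U\<close>. Exact agreement is a separate alternative because it requires no
  distance from the boundary.
\<close>

definition polar_close :: "real set \<Rightarrow> complex set \<Rightarrow> real \<Rightarrow> real \<Rightarrow> complex \<Rightarrow> complex \<Rightarrow> bool" where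
  "polar_close R U \<delta> \<delta>' w w' \<longleftrightarrow> w \<noteq> 0 \<and> w' \<noteq> 0 \<and>
    (cmod w = cmod w' \<or> \<bar>cmod w - cmod w'\<bar> < \<delta>' \<and> (\<forall>\<rho>\<in>R. \<delta> \<le> \<bar>cmod w' - \<rho>\<bar>)) \<and>
    (sgn w = sgn w' \<or> dist (sgn w) (sgn w') < \<delta>' \<and> (\<forall>u\<in>U. \<delta> \<le> dist (sgn w') u))"

definition polar_regular :: "complex set \<Rightarrow> bool" where
  "polar_regular K \<longleftrightarrow> (\<exists>R U. finite R \<and> (\<forall>\<rho>\<in>R. (0::real) < \<rho>) \<and> finite U \<and> (\<forall>u\<in>U. cmod u = 1) \<and>
    (\<forall>\<delta>>0. \<exists>\<delta>'>0. \<forall>w w'. polar_close R U \<delta> \<delta>' w w' \<longrightarrow> (w \<in> K \<longleftrightarrow> w' \<in> K)))"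

text \<open>
  The interval of radii may contain negative numbers, and a negative radius turns the angle by half
  a revolution.
\<close>

lemma polar_rectangle_iff:
  assumes "w \<noteq> 0"
  shows "w \<in> polar_rectangle I1 I2 \<longleftrightarrow>
    (cmod w \<in> I1 \<and> sgn w \<in> circle_arc I2) \<or> (- cmod w \<in> I1 \<and> - sgn w \<in> circle_arc I2)"
proof -
  have form: "complex_of_real r * exp (2 * complex_of_real pi * \<i> * complex_of_real \<phi>) = complex_of_real r * cis (2 * pi * \<phi>)" for r \<phi>
    by (simp add: cis_conv_exp mult_ac)
  have w: "w = complex_of_real (cmod w) * sgn w" using assms by (simp add: sgn_eq)
  show ?thesis
  proof
    assume "w \<in> polar_rectangle I1 I2"
    then obtain r \<phi> where r: "r \<in> I1" "\<phi> \<in> I2" "w = complex_of_real r * cis (2 * pi * \<phi>)"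
      unfolding polar_rectangle_def form by blast
    have c: "cmod w = \<bar>r\<bar>" and s: "sgn w = complex_of_real (sgn r) * cis (2 * pi * \<phi>)"
      unfolding r(3) by (simp_all add: norm_mult sgn_mult sgn_of_real sgn_cis)
    have "r \<noteq> 0" using r(3) assms by auto
    then show "(cmod w \<in> I1 \<and> sgn w \<in> circle_arc I2) \<or> (- cmod w \<in> I1 \<and> - sgn w \<in> circle_arc I2)"
      using r c s by (cases "r > 0") (auto simp: circle_arc_def)
  next
    assume "(cmod w \<in> I1 \<and> sgn w \<in> circle_arc I2) \<or> (- cmod w \<in> I1 \<and> - sgn w \<in> circle_arc I2)"
    then show "w \<in> polar_rectangle I1 I2"
    proof
      assume "cmod w \<in> I1 \<and> sgn w \<in> circle_arc I2"
      then obtain \<phi> where "cmod w \<in> I1" "\<phi> \<in> I2" "sgn w = cis (2 * pi * \<phi>)" by (auto simp: circle_arc_def)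
      moreover from this have "w = complex_of_real (cmod w) * cis (2 * pi * \<phi>)" using w by simp
      ultimately show ?thesis unfolding polar_rectangle_def form by blast
    next
      assume "- cmod w \<in> I1 \<and> - sgn w \<in> circle_arc I2"
      then obtain \<phi> where "- cmod w \<in> I1" "\<phi> \<in> I2" "- sgn w = cis (2 * pi * \<phi>)" by (auto simp: circle_arc_def)
      moreover from this have "w = complex_of_real (- cmod w) * cis (2 * pi * \<phi>)" using w by (metis minus_mult_minus of_real_minus)
      ultimately show ?thesis unfolding polar_rectangle_def form by blast
    qed
  qed
qed

lemma polar_regular_rectangle:
  assumes I1: "is_interval I1" and I2: "is_interval I2"
  shows "polar_regular (polar_rectangle I1 I2)"
proof -
  let ?R = "abs ` frontier I1 - {0}"
  let ?U = "circle_arc (frontier I2) \<union> uminus ` circle_arc (frontier I2)"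
  have fin: "finite ?R" "finite ?U" using finite_frontier_interval[OF I1] finite_frontier_interval[OF I2] by (auto simp: circle_arc_def)
  have radial: "\<sigma> * x \<in> I1 \<longleftrightarrow> \<sigma> * y \<in> I1"
    if xy: "0 < x" "0 < y" and \<sigma>: "\<sigma> = 1 \<or> \<sigma> = - 1" and cl: "x = y \<or> \<bar>x - y\<bar> < \<delta> \<and> (\<forall>\<rho>\<in>?R. \<delta> \<le> \<bar>y - \<rho>\<bar>)" for x y \<delta> \<sigma> :: real
  proof (rule ccontr)
    assume ne: "\<not> ?thesis"
    then obtain b where b: "b \<in> frontier I1" "min (\<sigma> * x) (\<sigma> * y) \<le> b" "b \<le> max (\<sigma> * x) (\<sigma> * y)"
      using interval_crossing[of "\<sigma> * x" I1 "\<sigma> * y"] by blast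
    have "b \<noteq> 0" "\<bar>y - \<bar>b\<bar>\<bar> \<le> \<bar>x - y\<bar>"
      using b(2,3) \<sigma> xy by (auto simp: min_def max_def abs_if split: if_splits)
    moreover have "x \<noteq> y" using ne by auto
    ultimately show False using cl b(1) by force
  qed
  show ?thesis unfolding polar_regular_def
  proof (intro exI[of _ ?R] exI[of _ ?U] conjI allI impI)
    show "finite ?R" "finite ?U" by (rule fin)+
    show "\<forall>\<rho>\<in>?R. 0 < \<rho>" "\<forall>u\<in>?U. cmod u = 1" by (auto simp: circle_arc_def)
    fix \<delta> :: real assume d: "0 < \<delta>"
    from arc_boundary[OF this, of I2] obtain \<delta>' where d': "\<delta>' > 0"
      and bnd: "\<And>u u'. cmod u = 1 \<Longrightarrow> cmod u' = 1 \<Longrightarrow> dist u u' < \<delta>' \<Longrightarrow>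
        (u \<in> circle_arc I2 \<longleftrightarrow> u' \<notin> circle_arc I2) \<Longrightarrow> \<exists>b\<in>circle_arc (frontier I2). dist u' b < \<delta>" by blast
    have ang: "u \<in> circle_arc I2 \<longleftrightarrow> u' \<in> circle_arc I2"
      if u: "cmod u = 1" "cmod u' = 1" "u = u' \<or> dist u u' < \<delta>' \<and> (\<forall>b\<in>circle_arc (frontier I2). \<delta> \<le> dist u' b)" for u u'
      using bnd[of u u'] u by force
    show "\<exists>\<delta>'>0. \<forall>w w'. polar_close ?R ?U \<delta> \<delta>' w w' \<longrightarrow> (w \<in> polar_rectangle I1 I2 \<longleftrightarrow> w' \<in> polar_rectangle I1 I2)"
    proof (intro exI[of _ "min \<delta> \<delta>'"] conjI allI impI)
      show "0 < min \<delta> \<delta>'" using d d' by simp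
      fix w w' :: complex
      assume "polar_close ?R ?U \<delta> (min \<delta> \<delta>') w w'"
      then have w: "w \<noteq> 0" "w' \<noteq> 0"
        and rad: "cmod w = cmod w' \<or> \<bar>cmod w - cmod w'\<bar> < min \<delta> \<delta>' \<and> (\<forall>\<rho>\<in>?R. \<delta> \<le> \<bar>cmod w' - \<rho>\<bar>)"
        and an: "sgn w = sgn w' \<or> dist (sgn w) (sgn w') < min \<delta> \<delta>' \<and> (\<forall>u\<in>?U. \<delta> \<le> dist (sgn w') u)"
        unfolding polar_close_def by blast+
      have r: "cmod w = cmod w' \<or> \<bar>cmod w - cmod w'\<bar> < \<delta> \<and> (\<forall>\<rho>\<in>?R. \<delta> \<le> \<bar>cmod w' - \<rho>\<bar>)" using rad by auto
      have r1: "cmod w \<in> I1 \<longleftrightarrow> cmod w' \<in> I1" and r2: "- cmod w \<in> I1 \<longleftrightarrow> - cmod w' \<in> I1"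
        using radial[OF _ _ _ r, of 1] radial[OF _ _ _ r, of "- 1"] w by auto
      have a1: "sgn w \<in> circle_arc I2 \<longleftrightarrow> sgn w' \<in> circle_arc I2"
        by (rule ang) (use w an in \<open>auto simp: norm_sgn\<close>)
      have neg: "dist (- sgn w') b = dist (sgn w') (- b)" "dist (- sgn w) (- sgn w') = dist (sgn w) (sgn w')" for b
        by (simp_all add: dist_norm norm_minus_commute) (metis add.commute diff_minus_eq_add minus_add_distrib norm_minus_cancel uminus_add_conv_diff)
      have a2: "- sgn w \<in> circle_arc I2 \<longleftrightarrow> - sgn w' \<in> circle_arc I2"
        by (rule ang) (use w an in \<open>auto simp: norm_sgn neg\<close>)
      show "w \<in> polar_rectangle I1 I2 \<longleftrightarrow> w' \<in> polar_rectangle I1 I2"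
        using r1 r2 a1 a2 by (simp add: polar_rectangle_iff[OF w(1)] polar_rectangle_iff[OF w(2)])
    qed
  qed
qed

lemma polar_regular_empty: "polar_regular {}"
  unfolding polar_regular_def by (intro exI[of _ "{}"]) (auto intro: exI[of _ 1])

lemma polar_regular_Un:
  assumes "polar_regular K" "polar_regular K'"
  shows "polar_regular (K \<union> K')"
proof -
  obtain R U where 1: "finite R" "\<forall>\<rho>\<in>R. (0::real) < \<rho>" "finite U" "\<forall>u\<in>U. cmod u = 1"
    and reg1: "\<forall>\<delta>>0. \<exists>\<delta>'>0. \<forall>w w'. polar_close R U \<delta> \<delta>' w w' \<longrightarrow> (w \<in> K \<longleftrightarrow> w' \<in> K)" using assms(1) unfolding polar_regular_def by (elim exE conjE)
  obtain R' U' where 2: "finite R'" "\<forall>\<rho>\<in>R'. (0::real) < \<rho>" "finite U'" "\<forall>u\<in>U'. cmod u = 1"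
    and reg2: "\<forall>\<delta>>0. \<exists>\<delta>'>0. \<forall>w w'. polar_close R' U' \<delta> \<delta>' w w' \<longrightarrow> (w \<in> K' \<longleftrightarrow> w' \<in> K')" using assms(2) unfolding polar_regular_def by (elim exE conjE)
  show ?thesis unfolding polar_regular_def
  proof (intro exI[of _ "R \<union> R'"] exI[of _ "U \<union> U'"] conjI allI impI)
    fix \<delta> :: real assume d: "0 < \<delta>"
    obtain a where a: "a > 0" "\<forall>w w'. polar_close R U \<delta> a w w' \<longrightarrow> (w \<in> K \<longleftrightarrow> w' \<in> K)" using reg1[rule_format, OF d] by (elim exE conjE)
    obtain b where b: "b > 0" "\<forall>w w'. polar_close R' U' \<delta> b w w' \<longrightarrow> (w \<in> K' \<longleftrightarrow> w' \<in> K')" using reg2[rule_format, OF d] by (elim exE conjE)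
    show "\<exists>\<delta>'>0. \<forall>w w'. polar_close (R \<union> R') (U \<union> U') \<delta> \<delta>' w w' \<longrightarrow> (w \<in> K \<union> K' \<longleftrightarrow> w' \<in> K \<union> K')"
    proof (intro exI[of _ "min a b"] conjI allI impI)
      show "0 < min a b" using a b by simp
      fix w w' :: complex
      assume c: "polar_close (R \<union> R') (U \<union> U') \<delta> (min a b) w w'"
      have "polar_close R U \<delta> a w w'" "polar_close R' U' \<delta> b w w'"
        using c unfolding polar_close_def by auto
      then show "w \<in> K \<union> K' \<longleftrightarrow> w' \<in> K \<union> K'" using a(2) b(2) by blast
    qed
  qed (use 1 2 in auto)
qed

lemma elementary_polar_regular:
  assumes "elementary_polar K"
  shows "polar_regular K"
proof -
  obtain \<R> where fin: "finite \<R>" and rect: "\<forall>R\<in>\<R>. \<exists>I1 I2. is_interval I1 \<and> is_interval I2 \<and> R = polar_rectangle I1 I2"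
    and K: "K = \<Union>\<R>" using assms unfolding elementary_polar_def by blast
  have "polar_regular (\<Union>\<R>)" using fin rect
  proof (induction \<R> rule: finite_induct)
    case (insert R \<R>)
    then have "polar_regular R" using polar_regular_rectangle by auto
    then show ?case using insert polar_regular_Un[of R "\<Union>\<R>"] by simp
  qed (simp add: polar_regular_empty)
  then show ?thesis using K by simp
qed

lemma atomless_finite:
  assumes "finite \<Phi>" and "\<And>\<phi>. \<phi> \<in> \<Phi> \<Longrightarrow> atomless_at g \<phi>" and "\<epsilon> > 0"
  shows "\<exists>\<delta>>0. \<forall>\<^sub>F N in sequentially. real (card ({n. \<exists>\<phi>\<in>\<Phi>. cmod (g n - \<phi>) < \<delta>} \<inter> {1..N})) \<le> \<epsilon> * real N"
  using assms
proof (induction \<Phi> arbitrary: \<epsilon> rule: finite_induct)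
  case empty
  then show ?case by (intro exI[of _ 1]) auto
next
  case (insert \<phi> \<Phi>)
  have e: "0 < \<epsilon> / 2" using insert by simp
  obtain a where a: "a > 0" "\<forall>\<^sub>F N in sequentially. real (card ({n. \<exists>\<phi>\<in>\<Phi>. cmod (g n - \<phi>) < a} \<inter> {1..N})) \<le> \<epsilon> / 2 * real N"
    using insert.IH[OF _ e] insert.prems by blast
  obtain b where b: "b > 0" "\<forall>\<^sub>F N in sequentially. real (card ({n. cmod (g n - \<phi>) < b} \<inter> {1..N})) \<le> \<epsilon> / 2 * real N"
    using insert.prems(1)[of \<phi>] e unfolding atomless_at_def by blast
  have "\<forall>\<^sub>F N in sequentially. real (card ({n. \<exists>\<phi>\<in>insert \<phi> \<Phi>. cmod (g n - \<phi>) < min a b} \<inter> {1..N})) \<le> \<epsilon> * real N"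
    using a(2) b(2)
  proof eventually_elim
    case (elim N)
    have "card ({n. \<exists>\<phi>\<in>insert \<phi> \<Phi>. cmod (g n - \<phi>) < min a b} \<inter> {1..N})
      \<le> card (({n. \<exists>\<phi>\<in>\<Phi>. cmod (g n - \<phi>) < a} \<inter> {1..N}) \<union> ({n. cmod (g n - \<phi>) < b} \<inter> {1..N}))"
      by (intro card_mono) auto
    also have "\<dots> \<le> card ({n. \<exists>\<phi>\<in>\<Phi>. cmod (g n - \<phi>) < a} \<inter> {1..N}) + card ({n. cmod (g n - \<phi>) < b} \<inter> {1..N})"
      by (rule card_Un_le)
    finally show ?case using elim by linarith
  qed
  then show ?case using a b by (intro exI[of _ "min a b"]) simp
qed

text \<open>
  The number \<open>z\<close> has to be found before the tolerances: the boundary that \<open>f m\<close> has to avoid is the one of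
  \<open>K\<close> rotated by \<open>z\<close>, and it determines \<open>\<delta>\<close>, from which \<open>\<delta>'\<close> and the set of primes are obtained.
\<close>

lemma polar_sieve_stable:
  assumes pr: "\<not> thin {p :: nat. prime p}"
    and f: "multiplicative f" and bd: "\<And>n. n > 0 \<Longrightarrow> cmod (f n) \<le> 1"
    and lim: "(\<lambda>N. (\<Sum>n=1..N. cmod (f n)) / real N) \<longlonglongrightarrow> \<alpha>" and \<alpha>: "\<alpha> \<noteq> 0"
    and K: "elementary_polar K"
  shows "sieve_stable {n. 0 < n \<and> f n \<in> K}"
proof -
  define g1 where "g1 n = complex_of_real (cmod (f n))" for n
  define g2 where "g2 n = sgn (f n)" for n
  have m1: "multiplicative g1" and m2: "multiplicative g2"
    using f unfolding multiplicative_def g1_def g2_def by (auto simp: norm_mult sgn_mult)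
  have b1: "cmod (g1 n) \<le> 1" if "n > 0" for n using bd[OF that] by (simp add: g1_def)
  have b2: "cmod (g2 n) \<le> 1" if "n > 0" for n by (simp add: g2_def norm_sgn)
  have small: "thin {p. prime p \<and> cmod (f p) \<le> 1 - \<epsilon>}" if "\<epsilon> > 0" for \<epsilon>
    by (rule mean_modulus_thin[OF f bd lim \<alpha> that])
  have nz: "thin {p. prime p \<and> f p = 0}"
    by (rule thin_subset[OF small[of 1]]) auto
  have nz1: "thin {p. prime p \<and> g1 p = 0}" and nz2: "thin {p. prime p \<and> g2 p = 0}"
    using nz by (simp_all add: g1_def g2_def sgn_zero_iff)
  \<comment> \<open>\<open>A1\<close> and \<open>A2\<close> say that the modulus, respectively the argument, does not accumulate at a point
    (for the modulus, at a positive one). If \<open>A1\<close>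
    fails, then \<open>cmod (f p) = 1\<close> for almost all primes; if \<open>A2\<close> fails, then \<open>sgn (f p) = z\<close> can be achieved.\<close>
  define A1 where "A1 \<longleftrightarrow> (\<forall>\<rho>>0. atomless_at g1 (complex_of_real \<rho>))"
  define A2 where "A2 \<longleftrightarrow> (\<forall>u. cmod u = 1 \<longrightarrow> atomless_at g2 u)"
  have mod1: "thin {p. prime p \<and> cmod (f p) \<noteq> 1}" if "\<not> A1"
  proof -
    obtain \<rho> where \<rho>: "\<rho> > 0" "\<not> atomless_at g1 (complex_of_real \<rho>)" using \<open>\<not> A1\<close> unfolding A1_def by blast
    obtain W where W: "finite W" "thin {p. prime p \<and> g1 p \<notin> W}"
      using atomless_or_finite_values[OF m1 b1 nz1 _ \<rho>(2)] \<rho>(1) by auto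
    let ?V = "cmod ` W - {1}"
    obtain \<epsilon> where e: "\<epsilon> > 0" "\<And>v. v \<in> ?V \<Longrightarrow> \<epsilon> \<le> dist 1 v"
      using finite_set_avoid[of ?V "1::real"] W(1) by (metis Diff_iff finite_Diff finite_imageI insertI1)
    show ?thesis
    proof (rule thin_subset[OF thin_Un[OF W(2) small[OF e(1)]]], intro subsetI)
      fix p assume "p \<in> {p. prime p \<and> cmod (f p) \<noteq> 1}"
      then have p: "prime p" "cmod (f p) \<noteq> 1" by auto
      have le: "cmod (f p) \<le> 1" using bd[of p] p(1) prime_gt_0_nat by blast
      have "cmod (f p) \<le> 1 - \<epsilon>" if "g1 p \<in> W"
      proof -
        have "cmod (g1 p) \<in> cmod ` W" using that by (rule imageI)
        then have "cmod (f p) \<in> ?V" using p(2) by (simp add: g1_def)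
        then have "\<epsilon> \<le> \<bar>1 - cmod (f p)\<bar>" using e(2) by (force simp: dist_real_def)
        then show ?thesis using le by simp
      qed
      then show "p \<in> {p. prime p \<and> g1 p \<notin> W} \<union> {p. prime p \<and> cmod (f p) \<le> 1 - \<epsilon>}" using p by blast
    qed
  qed
  define D where "D z \<delta> = {p. prime p \<and> f p \<noteq> 0 \<and> (if A2 then dist (g2 p) z < \<delta> else g2 p = z)}" for z and \<delta> :: real
  have "\<exists>z. cmod z = 1 \<and> (\<forall>\<delta>>0. \<not> thin (D z \<delta>))"
  proof (cases A2)
    case True
    show ?thesis
    proof (rule ccontr)
      assume no: "\<not> ?thesis"
      have "\<forall>z. \<exists>\<delta>. cmod z = 1 \<longrightarrow> \<delta> > 0 \<and> thin (D z \<delta>)" using no by blast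
      then obtain \<delta> where d: "\<And>z. cmod z = 1 \<Longrightarrow> \<delta> z > 0" "\<And>z. cmod z = 1 \<Longrightarrow> thin (D z (\<delta> z))" by metis
      have "compact (sphere (0::complex) 1)" by simp
      then obtain C where C: "C \<subseteq> sphere 0 1" "finite C" "sphere 0 1 \<subseteq> (\<Union>z\<in>C. ball z (\<delta> z))"
        by (rule compactE_image[of _ "sphere 0 1" "\<lambda>z. ball z (\<delta> z)"]) (use d(1) in auto)
      have "thin ({p. prime p \<and> f p = 0} \<union> (\<Union>z\<in>C. D z (\<delta> z)))"
        using C d(2) nz by (intro thin_Un thin_UN) auto
      then have "thin {p :: nat. prime p}"
      proof (rule thin_subset, intro subsetI)
        fix p :: nat assume p: "p \<in> {p. prime p}"
        show "p \<in> {p. prime p \<and> f p = 0} \<union> (\<Union>z\<in>C. D z (\<delta> z))"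
        proof (cases "f p = 0")
          case False
          then have "g2 p \<in> sphere 0 1" by (simp add: g2_def norm_sgn)
          then obtain z where "z \<in> C" "dist z (g2 p) < \<delta> z" using C(3) by auto
          then show ?thesis using p False True by (auto simp: D_def dist_commute)
        qed (use p in simp)
      qed
      then show False using pr by simp
    qed
  next
    case False
    then obtain u where u: "cmod u = 1" "\<not> atomless_at g2 u" unfolding A2_def by blast
    then obtain W where W: "finite W" "thin {p. prime p \<and> g2 p \<notin> W}"
      using atomless_or_finite_values[OF m2 b2 nz2 _ u(2)] by force
    have "\<exists>w\<in>W. \<not> thin (D w 1)"
    proof (rule ccontr)
      assume "\<not> ?thesis"
      then have "thin ({p. prime p \<and> f p = 0} \<union> {p. prime p \<and> g2 p \<notin> W} \<union> (\<Union>w\<in>W. D w 1))"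
        using W nz by (intro thin_Un thin_UN) auto
      then have "thin {p :: nat. prime p}"
        by (rule thin_subset) (use False in \<open>auto simp: D_def\<close>)
      then show False using pr by simp
    qed
    then obtain w where w: "\<not> thin (D w 1)" by blast
    then have "D w 1 \<noteq> {}" by auto
    then have "cmod w = 1" using False by (auto simp: D_def g2_def norm_sgn)
    moreover have "\<not> thin (D w \<delta>)" for \<delta> using w False by (simp add: D_def)
    ultimately show ?thesis by blast
  qed
  then obtain z where z: "cmod z = 1" and Dz: "\<And>\<delta>. \<delta> > 0 \<Longrightarrow> \<not> thin (D z \<delta>)" by blast
  obtain R U where RU: "finite R" "\<forall>\<rho>\<in>R. (0::real) < \<rho>" "finite U" "\<forall>u\<in>U. cmod u = 1"
    and reg: "\<forall>\<delta>>0. \<exists>\<delta>'>0. \<forall>w w'. polar_close R U \<delta> \<delta>' w w' \<longrightarrow> (w \<in> K \<longleftrightarrow> w' \<in> K)" using elementary_polar_regular[OF K] unfolding polar_regular_def by (elim exE conjE)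
  show ?thesis unfolding sieve_stable_def
  proof (intro allI impI)
    fix \<epsilon> :: real assume e: "\<epsilon> > 0"
    then have e2: "\<epsilon> / 2 > 0" by simp
    have "\<exists>\<delta>>0. A1 \<longrightarrow> (\<forall>\<^sub>F N in sequentially.
      real (card ({n. \<exists>\<rho>\<in>R. \<bar>cmod (f n) - \<rho>\<bar> < \<delta>} \<inter> {1..N})) \<le> \<epsilon> / 2 * real N)"
    proof (cases A1)
      case True
      have "\<exists>\<delta>>0. \<forall>\<^sub>F N in sequentially.
        real (card ({n. \<exists>\<phi>\<in>complex_of_real ` R. cmod (g1 n - \<phi>) < \<delta>} \<inter> {1..N})) \<le> \<epsilon> / 2 * real N"
        by (rule atomless_finite) (use True RU e2 in \<open>auto simp: A1_def\<close>)
      moreover have "cmod (g1 n - complex_of_real \<rho>) = \<bar>cmod (f n) - \<rho>\<bar>" for n \<rho>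
        unfolding g1_def of_real_diff[symmetric] norm_of_real ..
      ultimately have "\<exists>\<delta>>0. \<forall>\<^sub>F N in sequentially.
        real (card ({n. \<exists>\<rho>\<in>R. \<bar>cmod (f n) - \<rho>\<bar> < \<delta>} \<inter> {1..N})) \<le> \<epsilon> / 2 * real N" by simp
      then show ?thesis by blast
    qed (auto intro: exI[of _ 1])
    then obtain \<delta>1 where d1: "\<delta>1 > 0" "A1 \<Longrightarrow> (\<forall>\<^sub>F N in sequentially.
      real (card ({n. \<exists>\<rho>\<in>R. \<bar>cmod (f n) - \<rho>\<bar> < \<delta>1} \<inter> {1..N})) \<le> \<epsilon> / 2 * real N)" by blast
    have "\<exists>\<delta>>0. A2 \<longrightarrow> (\<forall>\<^sub>F N in sequentially.
      real (card ({n. \<exists>u\<in>U. dist (z * g2 n) u < \<delta>} \<inter> {1..N})) \<le> \<epsilon> / 2 * real N)"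
    proof (cases A2)
      case True
      have "\<exists>\<delta>>0. \<forall>\<^sub>F N in sequentially.
        real (card ({n. \<exists>\<phi>\<in>(\<lambda>u. u / z) ` U. cmod (g2 n - \<phi>) < \<delta>} \<inter> {1..N})) \<le> \<epsilon> / 2 * real N"
        by (rule atomless_finite) (use True RU e2 z in \<open>auto simp: A2_def norm_divide\<close>)
      moreover have "cmod (g2 n - u / z) = dist (z * g2 n) u" for n u
      proof -
        have "z \<noteq> 0" using z by auto
        then have "z * g2 n - u = z * (g2 n - u / z)" by (simp add: right_diff_distrib)
        then show ?thesis using z by (simp add: dist_norm norm_mult)
      qed
      ultimately have "\<exists>\<delta>>0. \<forall>\<^sub>F N in sequentially.
        real (card ({n. \<exists>u\<in>U. dist (z * g2 n) u < \<delta>} \<inter> {1..N})) \<le> \<epsilon> / 2 * real N" by simp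
      then show ?thesis by blast
    qed (auto intro: exI[of _ 1])
    then obtain \<delta>2 where d2: "\<delta>2 > 0" "A2 \<Longrightarrow> (\<forall>\<^sub>F N in sequentially.
      real (card ({n. \<exists>u\<in>U. dist (z * g2 n) u < \<delta>2} \<inter> {1..N})) \<le> \<epsilon> / 2 * real N)" by blast
    define \<delta> where "\<delta> = min \<delta>1 \<delta>2"
    have d: "\<delta> > 0" using d1 d2 by (simp add: \<delta>_def)
    obtain \<delta>' where d': "\<delta>' > 0" and regular: "\<forall>w w'. polar_close R U \<delta> \<delta>' w w' \<longrightarrow> (w \<in> K \<longleftrightarrow> w' \<in> K)" using reg[rule_format, OF d] by (elim exE conjE)
    define B1 where "B1 = {n. A1 \<and> (\<exists>\<rho>\<in>R. \<bar>cmod (f n) - \<rho>\<bar> < \<delta>)}"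
    define B2 where "B2 = {n. A2 \<and> (\<exists>u\<in>U. dist (z * g2 n) u < \<delta>)}"
    have ev1: "\<forall>\<^sub>F N in sequentially. real (card (B1 \<inter> {1..N})) \<le> \<epsilon> / 2 * real N"
    proof (cases A1)
      case True
      show ?thesis using d1(2)[OF True]
      proof eventually_elim
        case (elim N)
        have "card (B1 \<inter> {1..N}) \<le> card ({n. \<exists>\<rho>\<in>R. \<bar>cmod (f n) - \<rho>\<bar> < \<delta>1} \<inter> {1..N})"
          by (intro card_mono) (auto simp: B1_def \<delta>_def)
        then show ?case using elim by linarith
      qed
    qed (use e in \<open>simp add: B1_def\<close>)
    have ev2: "\<forall>\<^sub>F N in sequentially. real (card (B2 \<inter> {1..N})) \<le> \<epsilon> / 2 * real N"
    proof (cases A2)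
      case True
      show ?thesis using d2(2)[OF True]
      proof eventually_elim
        case (elim N)
        have "card (B2 \<inter> {1..N}) \<le> card ({n. \<exists>u\<in>U. dist (z * g2 n) u < \<delta>2} \<inter> {1..N})"
          by (intro card_mono) (auto simp: B2_def \<delta>_def)
        then show ?case using elim by linarith
      qed
    qed (use e in \<open>simp add: B2_def\<close>)
    have ev: "\<forall>\<^sub>F N in sequentially. real (card ((B1 \<union> B2) \<inter> {1..N})) \<le> \<epsilon> * real N"
      using ev1 ev2
    proof eventually_elim
      case (elim N)
      have "card ((B1 \<union> B2) \<inter> {1..N}) \<le> card (B1 \<inter> {1..N}) + card (B2 \<inter> {1..N})"
        unfolding Int_Un_distrib2 by (rule card_Un_le)
      then show ?case using elim by linarith
    qed
    define Z where "Z = {p. prime p \<and> cmod (f p) \<le> 1 - \<delta>'} \<union> (if A1 then {} else {p. prime p \<and> cmod (f p) \<noteq> 1})"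
    have "thin Z" unfolding Z_def using small[OF d'] mod1 by (intro thin_Un) auto
    then have nt: "\<not> thin (D z \<delta>' - Z)" using Dz[OF d'] by (intro not_thin_Diff)
    have st: "p * m \<in> {n. 0 < n \<and> f n \<in> K} \<longleftrightarrow> m \<in> {m. z * f m \<in> K}"
      if pm: "p \<in> D z \<delta>' - Z" "m > 0" "\<not> p dvd m" "m \<notin> B1 \<union> B2" for p m
    proof -
      have p: "prime p" "f p \<noteq> 0" using pm(1) by (auto simp: D_def)
      have p0: "p > 0" using p(1) by (rule prime_gt_0_nat)
      have fpm: "f (p * m) = f p * f m" by (rule multiplicative_prime[OF f p(1) pm(2,3)])
      have "f p * f m \<in> K \<longleftrightarrow> z * f m \<in> K"
      proof (cases "f m = 0")
        case False
        have sz: "sgn z = z" using z by (simp add: sgn_eq)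
        have sm: "cmod (sgn (f m)) = 1" using False by (simp add: norm_sgn)
        show ?thesis
        proof (rule regular[rule_format], unfold polar_close_def, intro conjI)
          show "f p * f m \<noteq> 0" "z * f m \<noteq> 0" using p False z by auto
          show "cmod (f p * f m) = cmod (z * f m) \<or> \<bar>cmod (f p * f m) - cmod (z * f m)\<bar> < \<delta>' \<and>
            (\<forall>\<rho>\<in>R. \<delta> \<le> \<bar>cmod (z * f m) - \<rho>\<bar>)"
          proof (cases A1)
            case True
            have c: "cmod (f p) \<le> 1" "1 - \<delta>' < cmod (f p)" using bd[OF p0] pm(1) p by (auto simp: Z_def not_le)
            have "\<bar>cmod (f p * f m) - cmod (z * f m)\<bar> = (1 - cmod (f p)) * cmod (f m)"
            proof -
              have "cmod (f p * f m) - cmod (z * f m) = - ((1 - cmod (f p)) * cmod (f m))"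
                using z by (simp add: norm_mult left_diff_distrib)
              then show ?thesis using c by (simp add: abs_mult)
            qed
            also have "\<dots> \<le> 1 - cmod (f p)" using c bd[OF pm(2)] by (intro mult_left_le) auto
            also have "\<dots> < \<delta>'" using c by simp
            finally have "\<bar>cmod (f p * f m) - cmod (z * f m)\<bar> < \<delta>'" .
            moreover have "\<forall>\<rho>\<in>R. \<delta> \<le> \<bar>cmod (z * f m) - \<rho>\<bar>"
              using pm(4) True z by (auto simp: B1_def norm_mult not_less)
            ultimately show ?thesis by blast
          next
            case False
            then have "cmod (f p) = 1" using pm(1) p by (auto simp: Z_def)
            then show ?thesis using z by (simp add: norm_mult)
          qed
          show "sgn (f p * f m) = sgn (z * f m) \<or> dist (sgn (f p * f m)) (sgn (z * f m)) < \<delta>' \<and>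
            (\<forall>u\<in>U. \<delta> \<le> dist (sgn (z * f m)) u)"
          proof (cases A2)
            case True
            have "sgn (f p * f m) - sgn (z * f m) = (sgn (f p) - z) * sgn (f m)"
              by (simp add: sgn_mult sz left_diff_distrib)
            then have "dist (sgn (f p * f m)) (sgn (z * f m)) = dist (g2 p) z"
              using sm by (simp add: dist_norm norm_mult g2_def)
            also have "\<dots> < \<delta>'" using pm(1) True by (auto simp: D_def)
            finally have "dist (sgn (f p * f m)) (sgn (z * f m)) < \<delta>'" .
            moreover have "\<forall>u\<in>U. \<delta> \<le> dist (sgn (z * f m)) u"
              using pm(4) True by (auto simp: B2_def g2_def sgn_mult sz not_less)
            ultimately show ?thesis by blast
          next
            case False
            then have "sgn (f p) = z" using pm(1) by (auto simp: D_def g2_def)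
            then show ?thesis by (simp add: sgn_mult sz)
          qed
        qed
      qed simp
      then show ?thesis using fpm p0 pm(2) by simp
    qed
    have Dp: "D z \<delta>' - Z \<subseteq> {p. prime p}" by (auto simp: D_def)
    show "\<exists>Q E' B. Q \<subseteq> {p. prime p} \<and> \<not> thin Q \<and>
      (\<forall>p\<in>Q. \<forall>m>0. \<not> p dvd m \<longrightarrow> m \<notin> B \<longrightarrow> (p * m \<in> {n. 0 < n \<and> f n \<in> K} \<longleftrightarrow> m \<in> E')) \<and>
      (\<forall>\<^sub>F N in sequentially. real (card (B \<inter> {1..N})) \<le> \<epsilon> * real N)"
      by (intro exI[of _ "D z \<delta>' - Z"] exI[of _ "{m. z * f m \<in> K}"] exI[of _ "B1 \<union> B2"] conjI ballI allI impI Dp nt ev st)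
  qed
qed

section \<open>Averages along sieve stable sets\<close>

text \<open>
  With \<open>p < q\<close> and \<open>S = T ^^ (q - p)\<close> one has \<open>T ^^ (q * m) = S ^^ m \<circ> T ^^ (p * m)\<close>, and \<open>T ^^ (p * m)\<close> drops out of the
  integral by invariance of the measure.
\<close>

lemma totally_ergodic_average:
  assumes TE: "totally_ergodic_system M T" and E: "sieve_stable E"
    and wm: "w \<in> borel_measurable M" and sq: "integrable M (\<lambda>x. (w x)\<^sup>2)" and mean: "(\<integral>x. w x \<partial>M) = (0::real)"
  shows "(\<lambda>N. (\<integral>x. (\<Sum>k\<in>E \<inter> {1..N}. w ((T ^^ k) x))\<^sup>2 \<partial>M) / (real N)\<^sup>2) \<longlonglongrightarrow> 0"
proof -
  have T: "measure_preserving_system M T" and erg: "\<And>m. m \<ge> 1 \<Longrightarrow> ergodic M (T ^^ m)"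
    using TE by (auto simp: totally_ergodic_system_def)
  have Tm[measurable]: "(T ^^ k) \<in> measurable M M" for k
    using mps_funpow[OF T, of k] by (auto simp: measure_preserving_system_def)
  note wm[measurable]
  have sqT: "integrable M (\<lambda>x. (w ((T ^^ k) x))\<^sup>2)" "(\<integral>x. (w ((T ^^ k) x))\<^sup>2 \<partial>M) = (\<integral>x. (w x)\<^sup>2 \<partial>M)" for k
    using mps_integral[OF mps_funpow[OF T], of "\<lambda>x. (w x)\<^sup>2" k] sq by auto
  have corr: "(\<lambda>N. (\<Sum>m=1..N. \<integral>x. w ((T ^^ (p * m)) x) * w ((T ^^ (q * m)) x) \<partial>M) / real N) \<longlonglongrightarrow> 0"
    if "p < q" for p q
  proof -
    define S where "S = T ^^ (q - p)"
    have "(\<lambda>N. (\<Sum>m=1..N. \<integral>x. w ((S ^^ m) x) * w x \<partial>M) / real N) \<longlonglongrightarrow> 0"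
      unfolding S_def by (rule correlation_L2[OF mps_funpow[OF T] erg wm sq mean]) (use that in simp)
    moreover have "(\<integral>x. w ((T ^^ (p * m)) x) * w ((T ^^ (q * m)) x) \<partial>M) = (\<integral>x. w ((S ^^ m) x) * w x \<partial>M)" for m
    proof -
      have Sm[measurable]: "(S ^^ m) \<in> measurable M M" unfolding S_def funpow_mult by simp
      have "q * m = (q - p) * m + p * m" using that by (simp add: add_mult_distrib[symmetric])
      then have "(T ^^ (q * m)) x = (S ^^ m) ((T ^^ (p * m)) x)" for x
        unfolding S_def funpow_mult by (simp add: funpow_add)
      then have "(\<integral>x. w ((T ^^ (p * m)) x) * w ((T ^^ (q * m)) x) \<partial>M)
        = (\<integral>x. (\<lambda>y. w ((S ^^ m) y) * w y) ((T ^^ (p * m)) x) \<partial>M)" by (simp add: mult.commute)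
      also have "\<dots> = (\<integral>x. w ((S ^^ m) x) * w x \<partial>M)"
        by (rule mps_integral(1)[OF mps_funpow[OF T]]) simp
      finally show ?thesis .
    qed
    ultimately show ?thesis by simp
  qed
  show ?thesis
  proof (rule katai_L2[OF E, where V = "\<integral>x. (w x)\<^sup>2 \<partial>M"])
    fix p q :: nat assume "p \<noteq> q"
    then consider "p < q" | "q < p" by linarith
    then show "(\<lambda>N. (\<Sum>m=1..N. \<integral>x. w ((T ^^ (p * m)) x) * w ((T ^^ (q * m)) x) \<partial>M) / real N) \<longlonglongrightarrow> 0"
      by cases (use corr[of p q] corr[of q p] in \<open>simp_all add: mult.commute\<close>)
  qed (use sqT in auto)
qed

text \<open>
  The \<open>J\<close>-th average along the sequence is \<open>n J / J\<close> times the normalised sum over \<open>E \<inter> {1..n J}\<close>, and this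
  factor converges because \<open>E\<close> has positive density. Real and imaginary parts are treated separately.
\<close>

lemma sieve_stable_totally_ergodic:
  fixes n :: "nat \<Rightarrow> nat"
  assumes E: "sieve_stable E" and E0: "0 \<notin> E"
    and n: "strict_mono_on {1..} n" "E = n ` {1..}"
    and d: "has_natural_density E d" "d > 0"
  shows "totally_ergodic_seq TYPE('a) n"
  unfolding totally_ergodic_seq_def
proof (intro allI impI)
  fix M :: "'a measure" and T f
  assume TE: "totally_ergodic_system M T" and f: "square_integrable M f"
  have T: "measure_preserving_system M T" using TE by (simp add: totally_ergodic_system_def)
  interpret prob_space M using T by (simp add: measure_preserving_system_def)
  have Tm[measurable]: "(T ^^ k) \<in> measurable M M" for k
    using mps_funpow[OF T, of k] by (auto simp: measure_preserving_system_def)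
  have fm[measurable]: "f \<in> borel_measurable M" and fsq: "integrable M (\<lambda>x. (cmod (f x))\<^sup>2)"
    using f by (auto simp: square_integrable_def)
  have "integrable M (\<lambda>x. cmod (f x))"
    by (rule square_integrable_imp_integrable) (use fsq in auto)
  then have fi: "integrable M f" by (simp add: integrable_norm_iff)
  have set_eq: "E \<inter> {1..n J} = n ` {1..J}" if J: "J \<ge> 1" for J
  proof (intro equalityI subsetI)
    fix k assume "k \<in> E \<inter> {1..n J}"
    then obtain j where j: "j \<ge> 1" "k = n j" "n j \<le> n J" using n(2) by auto
    then have "j \<le> J" using strict_mono_on_leD[OF n(1)] strict_mono_onD[OF n(1), of J j] J by (meson atLeast_iff leD not_le_imp_less)
    then show "k \<in> n ` {1..J}" using j by auto
  next
    fix k assume "k \<in> n ` {1..J}"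
    then obtain j where j: "1 \<le> j" "j \<le> J" "k = n j" by auto
    have "k \<in> E" using j n(2) by auto
    moreover have "n j \<le> n J" using strict_mono_on_leD[OF n(1), of j J] j J by simp
    moreover have "k \<noteq> 0" using \<open>k \<in> E\<close> E0 by metis
    ultimately show "k \<in> E \<inter> {1..n J}" using j by simp
  qed
  have inj: "inj_on n {1..J}" for J
    using strict_mono_on_imp_inj_on[OF n(1)] by (rule inj_on_subset) auto
  have n_ge: "J \<le> n J" if "J \<ge> 1" for J
  proof -
    have "card (n ` {1..J}) \<le> card {1..n J}" using set_eq[OF that] by (metis card_mono finite_atLeastAtMost inf_le2)
    then show ?thesis using card_image[OF inj] by simp
  qed
  have nlim: "filterlim n sequentially sequentially"
    by (rule filterlim_at_top_mono[OF filterlim_ident]) (use n_ge in \<open>auto simp: eventually_sequentially\<close>)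
  have ratio: "(\<lambda>J. real (n J) / real J) \<longlonglongrightarrow> 1 / d"
  proof -
    have "(\<lambda>J. real (card (E \<inter> {1..n J})) / real (n J)) \<longlonglongrightarrow> d"
      using d(1) unfolding has_natural_density_def by (rule filterlim_compose) (rule nlim)
    then have "(\<lambda>J. inverse (real (card (E \<inter> {1..n J})) / real (n J))) \<longlonglongrightarrow> inverse d"
      using d(2) by (intro tendsto_inverse) auto
    moreover have "\<forall>\<^sub>F J in sequentially. inverse (real (card (E \<inter> {1..n J})) / real (n J)) = real (n J) / real J"
      using eventually_ge_at_top[of 1]
    proof eventually_elim
      case (elim J)
      have "card (E \<inter> {1..n J}) = J" using set_eq[OF elim] card_image[OF inj[of J]] by simp
      then show ?case by simp
    qed
    ultimately have "(\<lambda>J. real (n J) / real J) \<longlonglongrightarrow> inverse d" by (rule Lim_transform_eventually)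
    then show ?thesis by (simp add: inverse_eq_divide)
  qed
  have real_part: "(\<lambda>J. \<integral>x. ((\<Sum>j=1..J. u ((T ^^ n j) x)) / real J - (\<integral>x. u x \<partial>M))\<^sup>2 \<partial>M) \<longlonglongrightarrow> 0"
    if um: "u \<in> borel_measurable M" and usq: "integrable M (\<lambda>x. (u x)\<^sup>2)" for u :: "'a \<Rightarrow> real"
  proof -
    let ?c = "\<integral>x. u x \<partial>M"
    define w where "w x = u x - ?c" for x
    have ui: "integrable M u" by (rule square_integrable_imp_integrable[OF um usq])
    have wm: "w \<in> borel_measurable M" using um unfolding w_def by simp
    have wsq: "integrable M (\<lambda>x. (w x)\<^sup>2)"
      unfolding w_def power2_diff using usq ui by simp
    have w0: "(\<integral>x. w x \<partial>M) = 0" unfolding w_def using ui by (simp add: prob_space)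
    let ?I = "\<lambda>N. (\<integral>x. (\<Sum>k\<in>E \<inter> {1..N}. w ((T ^^ k) x))\<^sup>2 \<partial>M) / (real N)\<^sup>2"
    have "(\<lambda>J. ?I (n J) * (real (n J) / real J)\<^sup>2) \<longlonglongrightarrow> 0 * (1 / d)\<^sup>2"
      by (intro tendsto_mult tendsto_power ratio filterlim_compose[OF totally_ergodic_average[OF TE E wm wsq w0] nlim])
    moreover have "\<forall>\<^sub>F J in sequentially. ?I (n J) * (real (n J) / real J)\<^sup>2
      = (\<integral>x. ((\<Sum>j=1..J. u ((T ^^ n j) x)) / real J - ?c)\<^sup>2 \<partial>M)"
      using eventually_ge_at_top[of 1]
    proof eventually_elim
      case (elim J)
      have nJ: "real (n J) > 0" "real J > 0" using n_ge[OF elim] elim by auto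
      have s: "(\<Sum>k\<in>E \<inter> {1..n J}. w ((T ^^ k) x)) = (\<Sum>j=1..J. u ((T ^^ n j) x)) - real J * ?c" for x
        unfolding set_eq[OF elim] sum.reindex[OF inj] by (simp add: w_def sum_subtractf)
      have "((\<Sum>j=1..J. u ((T ^^ n j) x)) / real J - ?c)\<^sup>2 = (\<Sum>k\<in>E \<inter> {1..n J}. w ((T ^^ k) x))\<^sup>2 / (real J)\<^sup>2" for x
        unfolding s power_divide[symmetric] using nJ by (simp add: diff_divide_distrib)
      then show ?case using nJ by (simp add: power_divide)
    qed
    ultimately show ?thesis by (simp add: tendsto_cong)
  qed
  have Re_sq: "integrable M (\<lambda>x. (Re (f x))\<^sup>2)" and Im_sq: "integrable M (\<lambda>x. (Im (f x))\<^sup>2)"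
    by (rule Bochner_Integration.integrable_bound[OF fsq]; simp add: cmod_power2)+
  let ?h = "\<lambda>J x. (\<Sum>j=1..J. f ((T ^^ n j) x)) / of_nat J - integral\<^sup>L M f"
  let ?a = "\<lambda>J x. ((\<Sum>j=1..J. Re (f ((T ^^ n j) x))) / real J - (\<integral>x. Re (f x) \<partial>M))\<^sup>2"
  let ?b = "\<lambda>J x. ((\<Sum>j=1..J. Im (f ((T ^^ n j) x))) / real J - (\<integral>x. Im (f x) \<partial>M))\<^sup>2"
  have split: "(cmod (?h J x))\<^sup>2 = ?a J x + ?b J x" for J x
    unfolding cmod_power2 using fi by (simp add: Re_divide_of_nat Im_divide_of_nat)
  have int_sq: "integrable M (\<lambda>x. ((\<Sum>j=1..J. u ((T ^^ n j) x)) / real J - c)\<^sup>2)"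
    if um: "u \<in> borel_measurable M" and usq: "integrable M (\<lambda>x. (u x)\<^sup>2)" for u :: "'a \<Rightarrow> real" and J c
  proof -
    have uT: "integrable M (\<lambda>x. (u ((T ^^ k) x))\<^sup>2)" for k
      using mps_integral(2)[OF mps_funpow[OF T], of "\<lambda>x. (u x)\<^sup>2" k] um usq by auto
    have uTm: "(\<lambda>x. u ((T ^^ k) x)) \<in> borel_measurable M" for k using um by simp
    have "integrable M (\<lambda>x. (\<Sum>j=1..J. u ((T ^^ n j) x))\<^sup>2)"
      unfolding power2_eq_square sum_product
      by (intro Bochner_Integration.integrable_sum integrable_mult_L2 uTm uT)
    moreover have "integrable M (\<lambda>x. \<Sum>j=1..J. u ((T ^^ n j) x))"
      by (intro Bochner_Integration.integrable_sum square_integrable_imp_integrable[OF uTm uT])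
    ultimately show ?thesis unfolding power2_diff power_divide by simp
  qed
  have "(\<lambda>J. (\<integral>x. ?a J x \<partial>M) + (\<integral>x. ?b J x \<partial>M)) \<longlonglongrightarrow> 0 + 0"
    by (intro tendsto_add real_part Re_sq Im_sq) auto
  then have "(\<lambda>J. ennreal ((\<integral>x. ?a J x \<partial>M) + (\<integral>x. ?b J x \<partial>M))) \<longlonglongrightarrow> ennreal 0"
    by (intro tendsto_ennrealI) simp
  moreover have "(\<integral>\<^sup>+x. ennreal ((cmod (?h J x))\<^sup>2) \<partial>M) = ennreal ((\<integral>x. ?a J x \<partial>M) + (\<integral>x. ?b J x \<partial>M))" for J
  proof -
    have ia: "integrable M (?a J)" and ib: "integrable M (?b J)"
      using int_sq[of "\<lambda>x. Re (f x)"] int_sq[of "\<lambda>x. Im (f x)"] Re_sq Im_sq by auto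
    have "(\<integral>\<^sup>+x. ennreal ((cmod (?h J x))\<^sup>2) \<partial>M) = (\<integral>\<^sup>+x. ennreal (?a J x + ?b J x) \<partial>M)"
      by (simp only: split)
    also have "\<dots> = ennreal (\<integral>x. ?a J x + ?b J x \<partial>M)"
      by (rule nn_integral_eq_integral) (use ia ib in auto)
    also have "(\<integral>x. ?a J x + ?b J x \<partial>M) = (\<integral>x. ?a J x \<partial>M) + (\<integral>x. ?b J x \<partial>M)"
      using ia ib by (rule Bochner_Integration.integral_add)
    finally show ?thesis .
  qed
  ultimately show "converges_L2 M (\<lambda>N x. (\<Sum>j=1..N. f ((T ^^ n j) x)) / of_nat N) (\<lambda>_. integral\<^sup>L M f)"
    unfolding converges_L2_def by simp
qed

theorem corollary3:
  fixes E :: "nat set" and n :: "nat \<Rightarrow> nat" and d :: real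
  assumes "E \<in> all_mult_level_sets \<union> concentration_point_sets \<union> polar_sets"
    and "strict_mono_on {1..} n" and "E = n ` {1..}"
    and "has_natural_density E d" and "d > 0"
  shows "totally_ergodic_seq TYPE('a) n"
proof (rule sieve_stable_totally_ergodic[OF _ _ assms(2-5)])
  consider "E \<in> all_mult_level_sets" | "E \<in> concentration_point_sets" | "E \<in> polar_sets"
    using assms(1) by blast
  then show "sieve_stable E"
  proof cases
    case 1
    then obtain r where "E \<in> mult_level_sets r" unfolding all_mult_level_sets_def by blast
    then obtain f z where "\<forall>i\<in>{1..r}. multiplicative (f i)" and E: "E = {n. 0 < n \<and> (\<forall>i\<in>{1..r}. f i n = z i)}"
      unfolding mult_level_sets_def by blast
    then show ?thesis
      by (intro level_set_sieve_stable[OF primes_not_thin _ _ E assms(4,5)]) auto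
  next
    case 2
    then show ?thesis unfolding concentration_point_sets_def by (auto intro: concentration_sieve_stable)
  next
    case 3
    then show ?thesis unfolding polar_sets_def by (auto intro: polar_sieve_stable[OF primes_not_thin])
  qed
  show "0 \<notin> E"
    using assms(1) by (auto simp: all_mult_level_sets_def mult_level_sets_def concentration_point_sets_def polar_sets_def)
qed

end
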